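(* Let $R$ be a commutative ring of characteristic $2$ and let $K$ be a knot, given by an oriented diagram $D$ with a basepoint on one of its edges. Then, up to isomorphism, the reduced twisted Khovanov homology $\overline{Kh}(K)$ does not depend on the markings: for any finite collection of markings on the edges of $D$ with any weights in $R$, the resulting $\delta$-graded reduced twisted complexes are isomorphic. In particular, $\overline{Kh}(K)$ is isomorphic to the $\delta$-graded (untwisted) reduced Khovanov homology of $K$ with coefficients in $R$.
   Context: **Chain complexes.** Here a chain complex is a graded $R$-module with an endomorphism $d$ of degree $2$ satisfying $d^2=0$. Isomorphisms of complexes are degree-$0$ isomorphisms commuting with $d$. **The category $\mathbf{Kob}(E)$.** Objects are finite formal direct sums of crossingless tangles in the disc with boundary $E$, each with a shift $[a]\{b\}$ of homological grading by $a$ and $q$-grading by $b$. Morphisms are matrices of $R$-linear combinations of dotted cobordisms (up to isotopy rel boundary) modulo the relations modeled on the Frobenius algebra $R[x]/(x^2)$: two dots on a component give $0$, an undotted sphere is $0$, a once-dotted sphere is $1$, and a tube equals the sum of the two surfaces obtained by cutting the neck and placing one dot on one or the other of the two new discs. A dotted cobordism $S$ has $q$-degree $\chi(S)-|E|/2-2\cdot\#\text{dots}$ and homological degree $0$. A degree-$d$ morphism $C\to C'$ has degree $d+m-n$ as a morphism $C\{n\}\to C'\{m\}$, and similarly for $[\cdot]$. The $\delta$-grading is the homological grading minus the $q$-grading (the homological grading here is twice the usual one). Twisted complexes are graded only by $\delta$. **Elementary complexes.** - A positive crossing is assigned (oriented resolution)$\{1\}\to$(other resolution)$[2]\{2\}$,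 with differential the saddle cobordism. - A negative crossing is assigned (other resolution)$[-2]\{-2\}\to$(oriented resolution)$\{-1\}$, with differential the saddle cobordism. - An edge with a marking of weight $w\in R$ is assigned the arc itself, with differential $w$ times the identity cobordism carrying one dot. **Twisted Khovanov complex.** For a diagram with weighted markings on its edges, $Kh$ is the tensor product (planar gluing; differential the sum of the differentials of the factors) of the complexes of all crossings and markings. For a link diagram, $E=\emptyset$, and $\mathbf{Kob}(\emptyset)$ is equivalent to the category of finitely generated free graded $R$-modules, a circle corresponding to $R[x]/(x^2)$ and a dot to multiplication by $x$. The untwisted theory is the case without markings. **Reduced complex.** Let $x$ act on $Kh$ by a dot at the basepoint, making $Kh$ a complex of $R[x]$-modules. The reduced complex is $\overline{Kh}=Kh\otimes_{R[x]}R$, where $x$ acts as $0$ on $R$. The notation $\overline{Kh}$ is used for the reduced complex as well as for the homology it computes. *)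

theory Defs
  imports "HOL-Algebra.Algebraic_Closure_Type"
begin

section \<open>Graded modules and complexes\<close>

text \<open>Modules are those of \<^theory>\<open>HOL-Algebra.Module\<close>; the \<open>mult\<close> and \<open>one\<close> components that the
  record type inherits from rings carry no information. The differential of a complex has degree
  2.\<close>

record ('r, 'm) graded_module = "('r, 'm) module" +
  homog :: "int \<Rightarrow> 'm set"

record ('r, 'm) gr_complex = "('r, 'm) graded_module" +
  diff :: "'m \<Rightarrow> 'm"

definition is_graded_module :: "('r, 'x) ring_scheme \<Rightarrow> ('r, 'm, 'z) graded_module_scheme \<Rightarrow> bool"
  where "is_graded_module R M \<longleftrightarrow>
    module R M \<and>
    (\<forall>k. submodule (homog M k) R M) \<and>
    (\<forall>x\<in>carrier M. \<exists>!y :: int \<Rightarrow> 'm.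
        (\<forall>k. y k \<in> homog M k) \<and> finite {k. y k \<noteq> \<zero>\<^bsub>M\<^esub>} \<and>
        x = (\<Oplus>\<^bsub>M\<^esub>k\<in>{k. y k \<noteq> \<zero>\<^bsub>M\<^esub>}. y k))"

definition linear_maps ::
    "('r, 'x) ring_scheme \<Rightarrow> ('r, 'm, 'y) module_scheme \<Rightarrow> ('r, 'n, 'z) module_scheme \<Rightarrow> ('m \<Rightarrow> 'n) set"
  where "linear_maps R M N =
    {f \<in> carrier M \<rightarrow> carrier N.
      (\<forall>x\<in>carrier M. \<forall>y\<in>carrier M. f (x \<oplus>\<^bsub>M\<^esub> y) = f x \<oplus>\<^bsub>N\<^esub> f y) \<and>
      (\<forall>r\<in>carrier R. \<forall>x\<in>carrier M. f (r \<odot>\<^bsub>M\<^esub> x) = r \<odot>\<^bsub>N\<^esub> f x)}"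

definition is_complex :: "('r, 'x) ring_scheme \<Rightarrow> ('r, 'm) gr_complex \<Rightarrow> bool"
  where "is_complex R C \<longleftrightarrow>
    is_graded_module R C \<and>
    diff C \<in> linear_maps R C C \<and>
    (\<forall>k. diff C \<in> homog C k \<rightarrow> homog C (k + 2)) \<and>
    (\<forall>x\<in>carrier C. diff C (diff C x) = \<zero>\<^bsub>C\<^esub>)"

definition graded_isos ::
    "('r, 'x) ring_scheme \<Rightarrow> ('r, 'm, 'y) graded_module_scheme \<Rightarrow>
     ('r, 'n, 'z) graded_module_scheme \<Rightarrow> ('m \<Rightarrow> 'n) set"
  where "graded_isos R M N =
    {f \<in> linear_maps R M N.
      bij_betw f (carrier M) (carrier N) \<and> (\<forall>k. f ` homog M k = homog N k)}"

definition graded_isomorphic ::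
    "('r, 'x) ring_scheme \<Rightarrow> ('r, 'm) graded_module \<Rightarrow> ('r, 'n) graded_module \<Rightarrow> bool"
  where "graded_isomorphic R M N \<longleftrightarrow>
    is_graded_module R M \<and> is_graded_module R N \<and> graded_isos R M N \<noteq> {}"

definition complex_isomorphic ::
    "('r, 'x) ring_scheme \<Rightarrow> ('r, 'm) gr_complex \<Rightarrow> ('r, 'n) gr_complex \<Rightarrow> bool"
  where "complex_isomorphic R C C' \<longleftrightarrow>
    is_complex R C \<and> is_complex R C' \<and>
    (\<exists>f\<in>graded_isos R C C'. \<forall>x\<in>carrier C. f (diff C x) = diff C' (f x))"

definition quotient_module ::
    "('r, 'm, 'z) graded_module_scheme \<Rightarrow> 'm set \<Rightarrow> ('r, 'm set) graded_module"
  where "quotient_module M N =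
    \<lparr>carrier = a_rcosets\<^bsub>M\<^esub> N, monoid.mult = undefined, one = undefined,
     zero = N, add = set_add M, module.smult = (\<lambda>r A. set_add M N ((\<lambda>x. r \<odot>\<^bsub>M\<^esub> x) ` A)),
     homog = (\<lambda>k. (\<lambda>x. N +>\<^bsub>M\<^esub> x) ` homog M k)\<rparr>"

definition quotient_complex :: "('r, 'm) gr_complex \<Rightarrow> 'm set \<Rightarrow> ('r, 'm set) gr_complex"
  where "quotient_complex C N =
    graded_module.extend (quotient_module C N)
      (gr_complex.fields (\<lambda>A. set_add C N (diff C ` A)))"

definition cycles :: "('r, 'm) gr_complex \<Rightarrow> ('r, 'm) gr_complex"
  where "cycles C =
    C\<lparr>carrier := {x \<in> carrier C. diff C x = \<zero>\<^bsub>C\<^esub>},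
      homog := (\<lambda>k. {x \<in> homog C k. diff C x = \<zero>\<^bsub>C\<^esub>})\<rparr>"

definition homology :: "('r, 'm) gr_complex \<Rightarrow> ('r, 'm set) graded_module"
  where "homology C = quotient_module (cycles C) (diff C ` carrier C)"

section \<open>Link diagrams\<close>

text \<open>An oriented diagram is given by its planar diagram code. The four ends at a crossing \<open>c\<close>
  are numbered counterclockwise, \<open>0\<close> being the incoming and hence \<open>2\<close> the outgoing end of the
  lower strand; the upper strand runs from \<open>3\<close> to \<open>1\<close> if \<open>c\<close> is positive and from \<open>1\<close> to \<open>3\<close> if
  it is negative. \<open>edge_at D c s\<close> is the edge of the diagram that leaves \<open>c\<close> at the end \<open>s\<close>.
  An edge that meets no crossing is a closed circle.\<close>

record ('c, 'e) diagram =
  crossings :: "'c set"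
  edges :: "'e set"
  positive :: "'c \<Rightarrow> bool"
  edge_at :: "'c \<Rightarrow> nat \<Rightarrow> 'e"

definition in_ends :: "('c, 'e) diagram \<Rightarrow> ('c \<times> nat) set"
  where "in_ends D = (SIGMA c:crossings D. {0, if positive D c then 3 else 1})"

definition out_ends :: "('c, 'e) diagram \<Rightarrow> ('c \<times> nat) set"
  where "out_ends D = (SIGMA c:crossings D. {2, if positive D c then 1 else 3})"

abbreviation ends :: "('c, 'e) diagram \<Rightarrow> ('c \<times> nat) set"
  where "ends D \<equiv> crossings D \<times> {..<4}"

text \<open>The partition of \<open>A\<close> into classes of the equivalence relation generated by \<open>r\<close>.\<close>

definition gen_classes :: "'a set \<Rightarrow> ('a \<times> 'a) set \<Rightarrow> 'a set set"
  where "gen_classes A r = A // (r \<union> r\<inverse>)\<^sup>*"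

text \<open>Follow an edge from one of its ends to the other and turn to the next end of the crossing
  reached there: the orbits are the faces of the surface on which the code describes a
  diagram.\<close>

definition face_steps :: "('c, 'e) diagram \<Rightarrow> (('c \<times> nat) \<times> ('c \<times> nat)) set"
  where "face_steps D =
    {((c, s), (c', (s' + 1) mod 4)) | c s c' s'.
      (c, s) \<in> ends D \<and> (c', s') \<in> ends D \<and> (c, s) \<noteq> (c', s') \<and> edge_at D c s = edge_at D c' s'}"

definition adjacent_crossings :: "('c, 'e) diagram \<Rightarrow> ('c \<times> 'c) set"
  where "adjacent_crossings D =
    {(c, c') | c s c' s'. (c, s) \<in> ends D \<and> (c', s') \<in> ends D \<and> edge_at D c s = edge_at D c' s'}"

text \<open>Euler's formula: a 4-valent graph with \<open>n\<close> vertices has \<open>2 n\<close> edges, and the surfaces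
  belonging to its \<open>k\<close> connected components are all spheres iff \<open>n - 2 n + F = 2 k\<close>.\<close>

definition planar :: "('c, 'e) diagram \<Rightarrow> bool"
  where "planar D \<longleftrightarrow>
    card (gen_classes (ends D) (face_steps D)) =
      card (crossings D) + 2 * card (gen_classes (crossings D) (adjacent_crossings D))"

definition link_diagram :: "('c, 'e) diagram \<Rightarrow> bool"
  where "link_diagram D \<longleftrightarrow>
    finite (crossings D) \<and> finite (edges D) \<and>
    inj_on (case_prod (edge_at D)) (in_ends D) \<and>
    inj_on (case_prod (edge_at D)) (out_ends D) \<and>
    case_prod (edge_at D) ` in_ends D = case_prod (edge_at D) ` out_ends D \<and>
    case_prod (edge_at D) ` in_ends D \<subseteq> edges D \<and>
    planar D"

definition strands :: "('c, 'e) diagram \<Rightarrow> ('e \<times> 'e) set"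
  where "strands D = {(edge_at D c s, edge_at D c (s + 2)) | c s. c \<in> crossings D \<and> s \<in> {0, 1}}"

definition knot_diagram :: "('c, 'e) diagram \<Rightarrow> bool"
  where "knot_diagram D \<longleftrightarrow> link_diagram D \<and> card (gen_classes (edges D) (strands D)) = 1"

section \<open>Resolutions\<close>

definition oriented_resolution :: "('c, 'e) diagram \<Rightarrow> 'c \<Rightarrow> (nat \<times> nat) set"
  where "oriented_resolution D c = (if positive D c then {(0, 1), (3, 2)} else {(0, 3), (1, 2)})"

definition other_resolution :: "('c, 'e) diagram \<Rightarrow> 'c \<Rightarrow> (nat \<times> nat) set"
  where "other_resolution D c = (if positive D c then {(0, 3), (1, 2)} else {(0, 1), (3, 2)})"

text \<open>A state is the set \<open>I\<close> of crossings at which the second term of the complex of the crossing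
  (the target of the saddle) is chosen.\<close>

definition resolution :: "('c, 'e) diagram \<Rightarrow> 'c set \<Rightarrow> 'c \<Rightarrow> (nat \<times> nat) set"
  where "resolution D I c =
    (if positive D c \<longleftrightarrow> c \<notin> I then oriented_resolution D c else other_resolution D c)"

definition h_shift :: "('c, 'e) diagram \<Rightarrow> 'c set \<Rightarrow> 'c \<Rightarrow> int"
  where "h_shift D I c =
    (if positive D c then if c \<in> I then 2 else 0 else if c \<in> I then 0 else - 2)"

definition q_shift :: "('c, 'e) diagram \<Rightarrow> 'c set \<Rightarrow> 'c \<Rightarrow> int"
  where "q_shift D I c =
    (if positive D c then if c \<in> I then 2 else 1 else if c \<in> I then - 1 else - 2)"

text \<open>A circle of the resolved diagram is represented by the set of edges of \<open>D\<close> on it.\<close>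

definition circles :: "('c, 'e) diagram \<Rightarrow> 'c set \<Rightarrow> 'e set set"
  where "circles D I =
    gen_classes (edges D)
      {(edge_at D c s, edge_at D c t) | c s t. c \<in> crossings D \<and> (s, t) \<in> resolution D I c}"

section \<open>The twisted complex\<close>

text \<open>A link diagram has its complex over the category of dotted cobordisms between closed
  curves, which is equivalent to the category of finitely generated free graded modules; the
  definitions give the image of that complex under the equivalence, under which a circle becomes
  \<open>R[x]/(x\<^sup>2)\<close> and a dot multiplication by \<open>x\<close>.

  The tensor power of \<open>R[x]/(x\<^sup>2)\<close> over a set \<open>Z\<close> of circles has the basis of the subsets
  \<open>S \<subseteq> Z\<close>: \<open>S\<close> stands for the tensor product of \<open>x\<close> at the circles in \<open>S\<close> and \<open>1\<close> at the others.
  An element of the complex is its coefficient function on the pairs \<open>(I, S)\<close>.\<close>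

definition generators :: "('c, 'e) diagram \<Rightarrow> ('c set \<times> 'e set set) set"
  where "generators D = (SIGMA I:Pow (crossings D). Pow (circles D I))"

definition h_degree :: "('c, 'e) diagram \<Rightarrow> 'c set \<times> 'e set set \<Rightarrow> int"
  where "h_degree D = (\<lambda>(I, S). \<Sum>c\<in>crossings D. h_shift D I c)"

text \<open>An undotted disc bounding a circle has degree \<open>1\<close>, a once-dotted one degree \<open>- 1\<close>.\<close>

definition q_degree :: "('c, 'e) diagram \<Rightarrow> 'c set \<times> 'e set set \<Rightarrow> int"
  where "q_degree D = (\<lambda>(I, S).
    (\<Sum>c\<in>crossings D. q_shift D I c) + (\<Sum>z\<in>circles D I. if z \<in> S then - 1 else 1))"

definition \<delta>_degree :: "('c, 'e) diagram \<Rightarrow> 'c set \<times> 'e set set \<Rightarrow> int"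
  where "\<delta>_degree D g = h_degree D g - q_degree D g"

text \<open>The matrix entry from \<open>S \<subseteq> Z\<close> to \<open>T \<subseteq> Z'\<close> of a saddle between the circles \<open>Z\<close> and \<open>Z'\<close>.
  It is the identity on the circles \<open>Z \<inter> Z'\<close> it does not touch, and on the others
  multiplication (\<open>1 \<otimes> 1 \<mapsto> 1\<close>, \<open>x \<otimes> 1, 1 \<otimes> x \<mapsto> x\<close>, \<open>x \<otimes> x \<mapsto> 0\<close>) or, by neck-cutting,
  comultiplication (\<open>1 \<mapsto> x \<otimes> 1 + 1 \<otimes> x\<close>, \<open>x \<mapsto> x \<otimes> x\<close>). The last case does not occur in
  planar diagrams.\<close>

definition saddle_coeff :: "'z set \<Rightarrow> 'z set \<Rightarrow> 'z set \<Rightarrow> 'z set \<Rightarrow> 'r::zero_neq_one"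
  where "saddle_coeff Z Z' S T =
    (let s = card (S - Z'); t = card (T - Z) in
     if S \<inter> Z' \<noteq> T \<inter> Z then 0
     else if card (Z - Z') = 2 \<and> card (Z' - Z) = 1 then of_bool ((s, t) \<in> {(0, 0), (1, 1)})
     else if card (Z - Z') = 1 \<and> card (Z' - Z) = 2 then of_bool ((s, t) \<in> {(0, 1), (1, 2)})
     else 0)"

definition saddle_map ::
    "('c, 'e) diagram \<Rightarrow> 'c \<Rightarrow> ('c set \<times> 'e set set \<Rightarrow> 'r) \<Rightarrow> 'c set \<times> 'e set set \<Rightarrow> 'r::comm_ring_1"
  where "saddle_map D c f = (\<lambda>(J, T).
    if (J, T) \<in> generators D \<and> c \<in> J
    then \<Sum>S\<in>Pow (circles D (J - {c})).
           saddle_coeff (circles D (J - {c})) (circles D J) S T * f (J - {c}, S)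
    else 0)"

text \<open>A dot on the edge \<open>e\<close>: multiplication by \<open>x\<close> in the tensor factor of the circle \<open>z\<close> through
  \<open>e\<close>.\<close>

definition dot_map ::
    "('c, 'e) diagram \<Rightarrow> 'e \<Rightarrow> ('c set \<times> 'e set set \<Rightarrow> 'r) \<Rightarrow> 'c set \<times> 'e set set \<Rightarrow> 'r::comm_ring_1"
  where "dot_map D e f = (\<lambda>(I, T).
    if (I, T) \<in> generators D then \<Sum>z | z \<in> T \<and> e \<in> z. f (I, T - {z}) else 0)"

text \<open>The tensor product of the complexes of the crossings and of the markings \<open>ms\<close>, each given
  by an edge and a weight. No signs are needed in the differential, since it is only
  used in characteristic 2.\<close>

definition twisted_Kh ::
    "('c, 'e) diagram \<Rightarrow> ('e \<times> 'r::comm_ring_1) list \<Rightarrow> ('r, 'c set \<times> 'e set set \<Rightarrow> 'r) gr_complex"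
  where "twisted_Kh D ms =
    \<lparr>carrier = {f. \<forall>g. g \<notin> generators D \<longrightarrow> f g = 0}, monoid.mult = undefined, one = undefined,
     zero = (\<lambda>g. 0), add = (\<lambda>f f' g. f g + f' g), module.smult = (\<lambda>r f g. r * f g),
     homog = (\<lambda>k. {f. \<forall>g. \<not> (g \<in> generators D \<and> \<delta>_degree D g = k) \<longrightarrow> f g = 0}),
     diff = (\<lambda>f g. (\<Sum>c\<in>crossings D. saddle_map D c f g) + (\<Sum>(e, w)\<leftarrow>ms. w * dot_map D e f g))\<rparr>"

text \<open>For a module \<open>M\<close> over \<open>R[x]\<close>, the tensor product of \<open>M\<close> with \<open>R = R[x]/(x)\<close> over \<open>R[x]\<close>
  is \<open>M / x M\<close>; here \<open>x\<close> acts as a dot on the edge \<open>p\<close> of the basepoint.\<close>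

definition reduced_Kh ::
    "('c, 'e) diagram \<Rightarrow> 'e \<Rightarrow> ('e \<times> 'r::comm_ring_1) list \<Rightarrow>
     ('r, ('c set \<times> 'e set set \<Rightarrow> 'r) set) gr_complex"
  where "reduced_Kh D p ms =
    quotient_complex (twisted_Kh D ms) (dot_map D p ` carrier (twisted_Kh D ms))"

end

theory Submission
  imports Defs "HOL-Library.Disjoint_Sets"
begin

text \<open>Let \<open>H\<close> be the reverse saddle at a crossing. By neck-cutting, \<open>d H + H d\<close> is the sum of the
  dots on the two ends of a strand through the crossing, while composing \<open>H\<close> with either of these
  dots gives the same map. Since moreover \<open>H\<^sup>2 = 0\<close>, in characteristic 2 the involution \<open>1 + w H\<close> is an
  isomorphism between the complexes in which a marking of weight \<open>w\<close> sits at one end of the strand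
  or at the other; it has \<open>\<delta>\<close>-degree 0 and commutes with dots. On a knot all markings can thus be moved to
  the basepoint, where a dot vanishes in the reduced complex.\<close>

section \<open>Linear maps and submodules\<close>

text \<open>The obstacle is that \<open>H\<close> has to commute with the saddles at all other
  crossings, so that only its own crossing contributes to \<open>d H + H d\<close>. Such squares of
  saddles occur with many configurations of circles. They are treated uniformly: saddle maps are
  linear over the dots on all edges, the tensor power is generated by its unit, and on the unit a
  saddle between the ends \<open>p\<close> and \<open>q\<close> gives 1 or \<open>x_p + x_q\<close>,
  according to whether \<open>p\<close> and \<open>q\<close> lie on different circles or on the same
  one. What remains is to compare equivalence relations on the edges. The input from the diagram is
  a parity count: a set of edges closed under the arcs outside a crossing contains an even number of
  the four ends at that crossing. The degree of \<open>H\<close> explains the choice of grading.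
  Seen in the cube, \<open>H\<close> lowers the homological degree by 2 and the q-degree by 2 as
  well, one from the shifts and one from the Euler characteristic of the saddle. Only the difference
  of the two gradings is preserved.\<close>

lemma linear_mapsI:
  assumes "\<And>x. x \<in> carrier M \<Longrightarrow> f x \<in> carrier N"
    and "\<And>x y. x \<in> carrier M \<Longrightarrow> y \<in> carrier M \<Longrightarrow> f (x \<oplus>\<^bsub>M\<^esub> y) = f x \<oplus>\<^bsub>N\<^esub> f y"
    and "\<And>r x. r \<in> carrier R \<Longrightarrow> x \<in> carrier M \<Longrightarrow> f (r \<odot>\<^bsub>M\<^esub> x) = r \<odot>\<^bsub>N\<^esub> f x"
  shows "f \<in> linear_maps R M N"
  using assms by (auto simp: linear_maps_def)

lemma linear_mapsD:
  assumes "f \<in> linear_maps R M N"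
  shows "\<And>x. x \<in> carrier M \<Longrightarrow> f x \<in> carrier N"
    and "\<And>x y. x \<in> carrier M \<Longrightarrow> y \<in> carrier M \<Longrightarrow> f (x \<oplus>\<^bsub>M\<^esub> y) = f x \<oplus>\<^bsub>N\<^esub> f y"
    and "\<And>r x. r \<in> carrier R \<Longrightarrow> x \<in> carrier M \<Longrightarrow> f (r \<odot>\<^bsub>M\<^esub> x) = r \<odot>\<^bsub>N\<^esub> f x"
  using assms by (auto simp: linear_maps_def)

lemma linear_map_hom:
  assumes "module R M" "module R N" "f \<in> linear_maps R M N"
  shows "abelian_group_hom M N f"
proof -
  interpret M: module R M by fact
  interpret N: module R N by fact
  show ?thesis
    using linear_mapsD[OF assms(3)]
    by (intro abelian_group_homI M.abelian_group_axioms N.abelian_group_axioms group_hom.intro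
        group_hom_axioms.intro M.a_group N.a_group homI) auto
qed

lemma (in abelian_group_hom) hom_finsum:
  "finite A \<Longrightarrow> g \<in> A \<rightarrow> carrier G \<Longrightarrow> h (finsum G g A) = finsum H (\<lambda>i. h (g i)) A"
  by (induction A rule: finite_induct) (auto simp: Pi_iff)

lemma (in abelian_group) add_eq_imp_zero:
  "a \<oplus> x = x \<Longrightarrow> a \<in> carrier G \<Longrightarrow> x \<in> carrier G \<Longrightarrow> a = \<zero>"
  using add.r_cancel_one[of x a] by simp

lemma (in abelian_group) minus_eq_zero_imp_eq:
  assumes "a \<ominus> b = \<zero>" "a \<in> carrier G" "b \<in> carrier G"
  shows "a = b"
proof -
  have "a = (a \<ominus> b) \<oplus> b" using assms(2,3) by (simp add: a_minus_def a_assoc l_neg)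
  then show ?thesis using assms by simp
qed

lemma (in module) submoduleI':
  assumes "K \<subseteq> carrier M" "\<zero>\<^bsub>M\<^esub> \<in> K"
    and "\<And>x y. x \<in> K \<Longrightarrow> y \<in> K \<Longrightarrow> x \<oplus>\<^bsub>M\<^esub> y \<in> K"
    and smult: "\<And>r x. r \<in> carrier R \<Longrightarrow> x \<in> K \<Longrightarrow> r \<odot>\<^bsub>M\<^esub> x \<in> K"
  shows "submodule K R M"
proof (rule submoduleI)
  fix x assume x: "x \<in> K"
  then have "\<ominus>\<^bsub>M\<^esub> x = (\<ominus>\<^bsub>R\<^esub> \<one>\<^bsub>R\<^esub>) \<odot>\<^bsub>M\<^esub> x"
    using assms(1) by (simp add: smult_l_minus subset_iff)
  then show "\<ominus>\<^bsub>M\<^esub> x \<in> K" using x smult by simp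
qed (use assms in auto)

lemma ex1_unique: "\<exists>!x. P x \<Longrightarrow> P a \<Longrightarrow> P b \<Longrightarrow> a = b"
  by blast

lemma submodule_imp_abelian_subgroup:
  assumes "module R M" "submodule N R M"
  shows "abelian_subgroup N M"
proof -
  interpret M: module R M by fact
  show ?thesis
    using assms(2) by (intro abelian_subgroupI3 additive_subgroup.intro M.abelian_group_axioms)
      (auto simp: submodule_def)
qed

lemma submoduleD:
  assumes "module R M" "submodule N R M"
  shows "\<And>x. x \<in> N \<Longrightarrow> x \<in> carrier M" and "\<zero>\<^bsub>M\<^esub> \<in> N"
    and "\<And>x y. x \<in> N \<Longrightarrow> y \<in> N \<Longrightarrow> x \<oplus>\<^bsub>M\<^esub> y \<in> N"
    and "\<And>x y. x \<in> N \<Longrightarrow> y \<in> N \<Longrightarrow> x \<ominus>\<^bsub>M\<^esub> y \<in> N"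
    and "\<And>r x. r \<in> carrier R \<Longrightarrow> x \<in> N \<Longrightarrow> r \<odot>\<^bsub>M\<^esub> x \<in> N"
proof -
  interpret M: module R M by fact
  interpret N: abelian_subgroup N M by (rule submodule_imp_abelian_subgroup[OF assms])
  show "\<And>x. x \<in> N \<Longrightarrow> x \<in> carrier M" "\<zero>\<^bsub>M\<^esub> \<in> N"
    "\<And>x y. x \<in> N \<Longrightarrow> y \<in> N \<Longrightarrow> x \<oplus>\<^bsub>M\<^esub> y \<in> N"
    "\<And>x y. x \<in> N \<Longrightarrow> y \<in> N \<Longrightarrow> x \<ominus>\<^bsub>M\<^esub> y \<in> N"
    by (auto simp: a_minus_def)
  show "\<And>r x. r \<in> carrier R \<Longrightarrow> x \<in> N \<Longrightarrow> r \<odot>\<^bsub>M\<^esub> x \<in> N"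
    using assms(2) by (simp add: submodule.smult_closed)
qed

lemma submodule_linear_image:
  assumes "module R M" "module R N" "f \<in> linear_maps R M N" "submodule K R M"
  shows "submodule (f ` K) R N"
proof -
  interpret M: module R M by fact
  interpret N: module R N by fact
  interpret f: abelian_group_hom M N f by (rule linear_map_hom[OF assms(1-3)])
  note K = submoduleD[OF assms(1,4)]
  note f = linear_mapsD[OF assms(3)]
  show ?thesis
  proof (rule N.submoduleI')
    show "f ` K \<subseteq> carrier N" using K f by auto
    show "\<zero>\<^bsub>N\<^esub> \<in> f ` K" using K(2) f.hom_zero by (metis imageI)
  next
    fix a b assume "a \<in> f ` K" "b \<in> f ` K"
    then obtain x y where "x \<in> K" "a = f x" "y \<in> K" "b = f y" by auto
    then show "a \<oplus>\<^bsub>N\<^esub> b \<in> f ` K"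
      using K(1) K(3)[of x y] f(2)[of x y] by (metis imageI)
  next
    fix r a assume r: "r \<in> carrier R" and "a \<in> f ` K"
    then obtain x where "x \<in> K" "a = f x" by auto
    then show "r \<odot>\<^bsub>N\<^esub> a \<in> f ` K" using K(1) K(5)[OF r, of x] f(3)[OF r, of x] by (metis imageI)
  qed
qed

text \<open>All module axioms pass to the image of a map that respects the operations. That zero
  goes to zero is a separate hypothesis: \<open>linear_maps\<close> implies it only once the target
  is known to be a group.\<close>

lemma module_linear_image:
  fixes M :: "('r, 'm, 'y) module_scheme" and Q :: "('r, 'n, 'z) module_scheme"
  assumes "module R M" and surj: "carrier Q = f ` carrier M"
    and f: "f \<in> linear_maps R M Q" and zero: "f \<zero>\<^bsub>M\<^esub> = \<zero>\<^bsub>Q\<^esub>"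
  shows "module R Q"
proof -
  interpret M: module R M by fact
  have add: "f x \<oplus>\<^bsub>Q\<^esub> f y = f (x \<oplus>\<^bsub>M\<^esub> y)" if "x \<in> carrier M" "y \<in> carrier M" for x y
    using linear_mapsD(2)[OF f] that by simp
  have smult: "r \<odot>\<^bsub>Q\<^esub> f x = f (r \<odot>\<^bsub>M\<^esub> x)" if "r \<in> carrier R" "x \<in> carrier M" for r x
    using linear_mapsD(3)[OF f] that by simp
  show ?thesis
  proof (rule moduleI)
    show "cring R" by (rule M.R.cring_axioms)
    show "abelian_group Q"
    proof (rule abelian_groupI)
      fix x assume "x \<in> carrier Q"
      then obtain a where a: "a \<in> carrier M" "x = f a" by (auto simp: surj)
      then have "f (\<ominus>\<^bsub>M\<^esub> a) \<oplus>\<^bsub>Q\<^esub> x = \<zero>\<^bsub>Q\<^esub>" by (simp add: add M.l_neg zero)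
      then show "\<exists>y\<in>carrier Q. y \<oplus>\<^bsub>Q\<^esub> x = \<zero>\<^bsub>Q\<^esub>" using a surj M.a_inv_closed by blast
    qed (auto simp: surj add M.a_ac zero[symmetric])
  qed (auto simp: surj smult add M.smult_l_distr M.smult_r_distr M.smult_assoc1)
qed

section \<open>Graded modules\<close>

text \<open>The definition sums over the exact support of a family, which changes under maps and
  differences. Here any finite index set will do, and uniqueness becomes independence: two
  decompositions are taken over a common index set and subtracted.\<close>

lemma graded_moduleI:
  assumes mod: "module R M" and sub: "\<And>k. submodule (homog M k) R M"
    and ex: "\<And>x. x \<in> carrier M \<Longrightarrow>
      \<exists>y A. finite A \<and> (\<forall>k. y k \<in> homog M k) \<and> x = finsum M y A"
    and indep: "\<And>y A k. finite A \<Longrightarrow> (\<And>k. y k \<in> homog M k) \<Longrightarrow> finsum M y A = \<zero>\<^bsub>M\<^esub> \<Longrightarrow>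
      k \<in> A \<Longrightarrow> y k = \<zero>\<^bsub>M\<^esub>"
  shows "is_graded_module R M"
  unfolding is_graded_module_def
proof (intro conjI ballI)
  interpret M: module R M by fact
  note H = submoduleD[OF mod sub]
  show "module R M" by fact
  show "\<forall>k. submodule (homog M k) R M" using sub by simp
  fix x assume "x \<in> carrier M"
  then obtain y A where y: "finite A" "\<And>k. y k \<in> homog M k" "x = finsum M y A"
    using ex by blast
  show "\<exists>!y. (\<forall>k. y k \<in> homog M k) \<and> finite {k. y k \<noteq> \<zero>\<^bsub>M\<^esub>} \<and>
      x = (\<Oplus>\<^bsub>M\<^esub>k\<in>{k. y k \<noteq> \<zero>\<^bsub>M\<^esub>}. y k)"
  proof (rule ex1I[of _ "\<lambda>k. if k \<in> A then y k else \<zero>\<^bsub>M\<^esub>"])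
    let ?z = "\<lambda>k. if k \<in> A then y k else \<zero>\<^bsub>M\<^esub>"
    have sub: "{k. ?z k \<noteq> \<zero>\<^bsub>M\<^esub>} \<subseteq> A" by auto
    have "finsum M ?z {k. ?z k \<noteq> \<zero>\<^bsub>M\<^esub>} = finsum M y A"
      using y(1) sub H(1)[OF y(2)] by (intro M.add.finprod_mono_neutral_cong_left) (auto split: if_splits)
    then show "(\<forall>k. ?z k \<in> homog M k) \<and> finite {k. ?z k \<noteq> \<zero>\<^bsub>M\<^esub>} \<and>
        x = finsum M ?z {k. ?z k \<noteq> \<zero>\<^bsub>M\<^esub>}"
      using y H(2) finite_subset[OF sub] by auto
  next
    fix z assume "(\<forall>k. z k \<in> homog M k) \<and> finite {k. z k \<noteq> \<zero>\<^bsub>M\<^esub>} \<and>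
      x = finsum M z {k. z k \<noteq> \<zero>\<^bsub>M\<^esub>}"
    then have z: "\<And>k. z k \<in> homog M k" "finite {k. z k \<noteq> \<zero>\<^bsub>M\<^esub>}" "x = finsum M z {k. z k \<noteq> \<zero>\<^bsub>M\<^esub>}"
      by auto
    let ?y = "\<lambda>k. if k \<in> A then y k else \<zero>\<^bsub>M\<^esub>"
    let ?B = "A \<union> {k. z k \<noteq> \<zero>\<^bsub>M\<^esub>}"
    have B: "finite ?B" using y z by simp
    have yc: "?y k \<in> homog M k" for k using y(2) H(2) by simp
    have 1: "finsum M ?y ?B = x"
      unfolding y(3) using B H(1)[OF y(2)]
      by (intro M.add.finprod_mono_neutral_cong_right) (auto split: if_splits)
    have 2: "finsum M z ?B = x"
      using B H(1) z(1)
      by (subst z(3), intro M.add.finprod_mono_neutral_cong_right) auto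
    \<comment> \<open>Both families sum to \<open>x\<close> over \<open>?B\<close>, so adding
      \<open>x\<close> to the sum of their differences returns \<open>x\<close>, and the differences
      sum to zero.\<close>
    have "finsum M (\<lambda>k. ?y k \<ominus>\<^bsub>M\<^esub> z k) ?B \<oplus>\<^bsub>M\<^esub> x = finsum M (\<lambda>k. (?y k \<ominus>\<^bsub>M\<^esub> z k) \<oplus>\<^bsub>M\<^esub> z k) ?B"
      using H(1)[OF yc] H(1)[OF z(1)]
      by (subst 2[symmetric], subst M.finsum_addf) (auto simp: a_minus_def simp del: if_split)
    also have "(\<lambda>k. (?y k \<ominus>\<^bsub>M\<^esub> z k) \<oplus>\<^bsub>M\<^esub> z k) = ?y"
      using H(1)[OF yc] H(1)[OF z(1)] by (intro ext) (simp add: a_minus_def M.a_assoc M.l_neg)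
    finally have "finsum M (\<lambda>k. ?y k \<ominus>\<^bsub>M\<^esub> z k) ?B \<oplus>\<^bsub>M\<^esub> x = x" by (simp add: 1)
    moreover have "finsum M (\<lambda>k. ?y k \<ominus>\<^bsub>M\<^esub> z k) ?B \<in> carrier M"
      using H(1)[OF H(4)[OF yc z(1)]] by (intro M.finsum_closed) auto
    ultimately have s0: "finsum M (\<lambda>k. ?y k \<ominus>\<^bsub>M\<^esub> z k) ?B = \<zero>\<^bsub>M\<^esub>"
      using \<open>x \<in> carrier M\<close> by (rule M.add_eq_imp_zero)
    have eq: "?y k = z k" if "k \<in> ?B" for k
    proof -
      have "?y k \<ominus>\<^bsub>M\<^esub> z k = \<zero>\<^bsub>M\<^esub>"
        by (rule indep[OF B H(4)[OF yc z(1)] s0 that])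
      then show ?thesis using H(1)[OF yc] H(1)[OF z(1)] by (rule M.minus_eq_zero_imp_eq)
    qed
    show "z = ?y"
    proof
      fix k show "z k = ?y k" using eq[of k] by (cases "k \<in> ?B") auto
    qed
  qed
qed

lemma graded_moduleE:
  assumes "is_graded_module R M"
  shows graded_module_module: "module R M"
    and graded_module_homog: "submodule (homog M k) R M"
    and graded_module_decomp: "x \<in> carrier M \<Longrightarrow>
      \<exists>y A. finite A \<and> (\<forall>k. y k \<in> homog M k) \<and> x = finsum M y A"
  using assms unfolding is_graded_module_def by blast+

text \<open>The zero element is decomposed by the zero family and by \<open>y\<close> cut off
  outside \<open>A\<close>; uniqueness identifies the two.\<close>

lemma graded_module_indep:
  assumes gr: "is_graded_module R M"
    and A: "finite A" "\<And>k. k \<in> A \<Longrightarrow> y k \<in> homog M k" "finsum M y A = \<zero>\<^bsub>M\<^esub>" "k \<in> A"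
  shows "y k = \<zero>\<^bsub>M\<^esub>"
proof -
  interpret M: module R M by (rule graded_module_module[OF gr])
  note H = submoduleD[OF graded_module_module[OF gr] graded_module_homog[OF gr]]
  let ?z = "\<lambda>k. if k \<in> A then y k else \<zero>\<^bsub>M\<^esub>"
  let ?P = "\<lambda>y. (\<forall>k. y k \<in> homog M k) \<and> finite {k. y k \<noteq> \<zero>\<^bsub>M\<^esub>} \<and>
    \<zero>\<^bsub>M\<^esub> = (\<Oplus>\<^bsub>M\<^esub>k\<in>{k. y k \<noteq> \<zero>\<^bsub>M\<^esub>}. y k)"
  have uniq: "\<exists>!y. ?P y" using gr M.zero_closed unfolding is_graded_module_def by blast
  have sub: "{k. ?z k \<noteq> \<zero>\<^bsub>M\<^esub>} \<subseteq> A" by auto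
  have "finsum M ?z {k. ?z k \<noteq> \<zero>\<^bsub>M\<^esub>} = finsum M y A"
    using A(1) sub H(1) A(2) by (intro M.add.finprod_mono_neutral_cong_left) (auto split: if_splits)
  then have "?P ?z" using A H(2) finite_subset[OF sub] by auto
  moreover have "?P (\<lambda>k. \<zero>\<^bsub>M\<^esub>)" using H(2) by auto
  ultimately have "?z = (\<lambda>k. \<zero>\<^bsub>M\<^esub>)" by (intro ex1_unique[OF uniq])
  from fun_cong[OF this, of k] show ?thesis using A(4) by simp
qed

text \<open>A homogeneous submodule. Having the components inside \<open>N\<close> is what keeps the
  images of different degrees independent in the quotient.\<close>

definition graded_submodule where
  "graded_submodule R M N \<longleftrightarrow> submodule N R M \<and>
    (\<forall>x\<in>N. \<exists>y A. finite A \<and> (\<forall>k. y k \<in> homog M k \<inter> N) \<and> x = finsum M y A)"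

lemma graded_submodule_linear_image:
  assumes M: "is_graded_module R M" and N: "is_graded_module R N"
    and f: "f \<in> linear_maps R M N" "\<And>k. f ` homog M k \<subseteq> homog N (k + d)"
  shows "graded_submodule R N (f ` carrier M)"
  unfolding graded_submodule_def
proof (intro conjI ballI)
  note mod = graded_module_module[OF M] graded_module_module[OF N]
  interpret M: module R M by (rule mod)
  interpret N: module R N by (rule mod)
  interpret f: abelian_group_hom M N f by (rule linear_map_hom[OF mod f(1)])
  note H = submoduleD[OF mod(1) graded_module_homog[OF M]]
  show "submodule (f ` carrier M) R N"
    by (rule submodule_linear_image[OF mod f(1) M.carrier_is_submodule])
  fix x assume "x \<in> f ` carrier M"
  then obtain a where a: "a \<in> carrier M" "x = f a" by auto
  then obtain y A where y: "finite A" "\<And>k. y k \<in> homog M k" "a = finsum M y A"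
    using graded_module_decomp[OF M] by blast
  have "x = finsum N (\<lambda>k. f (y k)) A"
    using y H(1)[OF y(2)] a by (simp add: f.hom_finsum)
  \<comment> \<open>A map of degree \<open>d\<close> moves the component of degree
    \<open>k - d\<close> to degree \<open>k\<close>, whence the shifted index set.\<close>
  also have "\<dots> = finsum N (\<lambda>k. f (y (k - d))) ((\<lambda>k. k + d) ` A)"
    using H(1)[OF y(2)] by (subst N.finsum_reindex) (auto simp: inj_on_def)
  finally show "\<exists>z A. finite A \<and> (\<forall>k. z k \<in> homog N k \<inter> f ` carrier M) \<and> x = finsum N z A"
    using y(1,2) H(1)[OF y(2)] f(2)
    using f(2)[of "_ - d"]
    by (intro exI[of _ "\<lambda>k. f (y (k - d))"] exI[of _ "(\<lambda>k. k + d) ` A"]) (auto simp: image_subset_iff)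
qed

section \<open>Quotients\<close>

text \<open>Operations on quotients are defined by applying a map to a coset and adding the
  submodule. The image of a coset can be smaller than a coset; adding \<open>N'\<close> fills it up.
  This serves scalar multiplication as well as differentials.\<close>

lemma coset_linear_image:
  assumes M: "module R M" "submodule N R M" and M': "module R M'" "submodule N' R M'"
    and f: "f \<in> linear_maps R M M'" "f ` N \<subseteq> N'" and x: "x \<in> carrier M"
  shows "set_add M' N' (f ` (N +>\<^bsub>M\<^esub> x)) = N' +>\<^bsub>M'\<^esub> f x"
proof -
  interpret M: module R M by (rule M)
  interpret M': module R M' by (rule M')
  note N = submoduleD[OF M] and N' = submoduleD[OF M'] and F = linear_mapsD[OF f(1)]
  have 1: "n' \<oplus>\<^bsub>M'\<^esub> f (n \<oplus>\<^bsub>M\<^esub> x) = (n' \<oplus>\<^bsub>M'\<^esub> f n) \<oplus>\<^bsub>M'\<^esub> f x" "n' \<oplus>\<^bsub>M'\<^esub> f n \<in> N'"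
    if "n' \<in> N'" "n \<in> N" for n n'
    using that x f(2) N' N(1) F by (auto simp: M'.a_assoc image_subset_iff)
  have 2: "n' \<oplus>\<^bsub>M'\<^esub> f x = n' \<oplus>\<^bsub>M'\<^esub> f (\<zero>\<^bsub>M\<^esub> \<oplus>\<^bsub>M\<^esub> x)" for n' using x by simp
  show ?thesis
    unfolding set_add_def' a_r_coset_def'
  proof (intro equalityI subsetI)
    fix z assume "z \<in> (\<Union>n'\<in>N'. \<Union>k\<in>f ` (\<Union>n\<in>N. {n \<oplus>\<^bsub>M\<^esub> x}). {n' \<oplus>\<^bsub>M'\<^esub> k})"
    then obtain n n' where "n \<in> N" "n' \<in> N'" "z = n' \<oplus>\<^bsub>M'\<^esub> f (n \<oplus>\<^bsub>M\<^esub> x)" by auto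
    then show "z \<in> (\<Union>n\<in>N'. {n \<oplus>\<^bsub>M'\<^esub> f x})" using 1 by auto
  next
    fix z assume "z \<in> (\<Union>n\<in>N'. {n \<oplus>\<^bsub>M'\<^esub> f x})"
    then show "z \<in> (\<Union>n'\<in>N'. \<Union>k\<in>f ` (\<Union>n\<in>N. {n \<oplus>\<^bsub>M\<^esub> x}). {n' \<oplus>\<^bsub>M'\<^esub> k})"
      using N(2) 2 by blast
  qed
qed

lemma quotient_module_simps:
  "carrier (quotient_module M N) = (\<lambda>x. N +>\<^bsub>M\<^esub> x) ` carrier M"
  "zero (quotient_module M N) = N"
  "add (quotient_module M N) = set_add M"
  "module.smult (quotient_module M N) = (\<lambda>r A. set_add M N ((\<lambda>x. r \<odot>\<^bsub>M\<^esub> x) ` A))"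
  "homog (quotient_module M N) k = (\<lambda>x. N +>\<^bsub>M\<^esub> x) ` homog M k"
  by (auto simp: quotient_module_def A_RCOSETS_def')

lemma coset_eq_iff:
  assumes M: "module R M" "submodule N R M" and "x \<in> carrier M" "y \<in> carrier M"
  shows "N +>\<^bsub>M\<^esub> x = N +>\<^bsub>M\<^esub> y \<longleftrightarrow> x \<ominus>\<^bsub>M\<^esub> y \<in> N"
proof -
  interpret M: module R M by (rule M)
  interpret N: abelian_subgroup N M by (rule submodule_imp_abelian_subgroup[OF M])
  show ?thesis
    using assms(3,4) N.a_rcos_module_minus[of y x] M.ring_axioms
    by (metis N.a_rcos_self N.a_repr_independence' N.a_rcos_module a_minus_def)
qed

lemma coset_eq_zero_iff:
  assumes M: "module R M" "submodule N R M" and "x \<in> carrier M"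
  shows "N +>\<^bsub>M\<^esub> x = N \<longleftrightarrow> x \<in> N"
proof -
  interpret M: module R M by (rule M)
  have N: "N \<subseteq> carrier M" using submoduleD(1)[OF M] by auto
  show ?thesis
    using coset_eq_iff[OF M, of x "\<zero>\<^bsub>M\<^esub>"] assms(3) submoduleD(1)[OF M]
    by (simp add: a_minus_def a_inv_def M.a_coset_add_zero[OF N])
qed

lemma coset_linear:
  fixes M :: "('r, 'm, 'z) graded_module_scheme"
  assumes M: "module R M" "submodule N R M"
  shows "(\<lambda>x. N +>\<^bsub>M\<^esub> x) \<in> linear_maps R M (quotient_module M N)"
proof -
  interpret M: module R M by (rule M)
  interpret N: abelian_subgroup N M by (rule submodule_imp_abelian_subgroup[OF M])
  have sm: "set_add M N ((\<lambda>x. r \<odot>\<^bsub>M\<^esub> x) ` (N +>\<^bsub>M\<^esub> x)) = N +>\<^bsub>M\<^esub> (r \<odot>\<^bsub>M\<^esub> x)"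
    if "r \<in> carrier R" "x \<in> carrier M" for r x
    using that submoduleD(5)[OF M]
    by (intro coset_linear_image[OF M M] linear_mapsI)
      (auto simp: M.smult_r_distr M.smult_assoc1[symmetric] M.R.m_comm)
  show ?thesis
    by (rule linear_mapsI) (auto simp: quotient_module_simps N.a_rcos_sum sm)
qed

lemma quotient_module_module:
  fixes M :: "('r, 'm, 'z) graded_module_scheme"
  assumes M: "module R M" "submodule N R M"
  shows "module R (quotient_module M N)"
proof -
  interpret M: module R M by (rule M)
  show ?thesis
    by (rule module_linear_image[OF M(1) _ coset_linear[OF M]])
      (use coset_eq_zero_iff[OF M, of "\<zero>\<^bsub>M\<^esub>"] submoduleD(2)[OF M] in
        \<open>auto simp: quotient_module_simps\<close>)
qed

text \<open>A vanishing sum of cosets lifts to an element of \<open>N\<close>. Its homogeneous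
  components inside \<open>N\<close> and the chosen lifts decompose the same element, so the lifts
  lie in \<open>N\<close>.\<close>

lemma quotient_graded_module:
  fixes M :: "('r, 'm, 'z) graded_module_scheme"
  assumes gr: "is_graded_module R M" and N: "graded_submodule R M N"
  shows "is_graded_module R (quotient_module M N)" (is "is_graded_module R ?Q")
proof -
  note M = graded_module_module[OF gr]
  have sN: "submodule N R M" using N by (simp add: graded_submodule_def)
  note Q = quotient_module_module[OF M sN]
  interpret M: module R M by (rule M)
  interpret Q: module R ?Q by (rule Q)
  interpret \<kappa>: abelian_group_hom M ?Q "\<lambda>x. N +>\<^bsub>M\<^esub> x"
    by (rule linear_map_hom[OF M Q coset_linear[OF M sN]])
  note H = submoduleD[OF M graded_module_homog[OF gr]]
  note zero = coset_eq_zero_iff[OF M sN]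
  show ?thesis
  proof (rule graded_moduleI[OF Q])
    fix k show "submodule (homog ?Q k) R ?Q"
      unfolding quotient_module_simps
      by (rule submodule_linear_image[OF M Q coset_linear[OF M sN] graded_module_homog[OF gr]])
  next
    fix x assume "x \<in> carrier ?Q"
    then obtain a where a: "a \<in> carrier M" "x = N +>\<^bsub>M\<^esub> a" by (auto simp: quotient_module_simps)
    then obtain y A where y: "finite A" "\<And>k. y k \<in> homog M k" "a = finsum M y A"
      using graded_module_decomp[OF gr] by blast
    have "x = finsum ?Q (\<lambda>k. N +>\<^bsub>M\<^esub> y k) A"
      using y H(1)[OF y(2)] a by (simp add: \<kappa>.hom_finsum)
    then show "\<exists>y A. finite A \<and> (\<forall>k. y k \<in> homog ?Q k) \<and> x = finsum ?Q y A"
      using y by (intro exI[of _ "\<lambda>k. N +>\<^bsub>M\<^esub> y k"] exI[of _ A]) (auto simp: quotient_module_simps)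
  next
    fix z A k assume A: "finite A" "\<And>k. z k \<in> homog ?Q k" "finsum ?Q z A = \<zero>\<^bsub>?Q\<^esub>" "k \<in> A"
    then obtain y where y: "\<And>k. y k \<in> homog M k" "\<And>k. z k = N +>\<^bsub>M\<^esub> y k"
      unfolding quotient_module_simps image_iff by metis
    have yc: "y k \<in> carrier M" for k using y H by blast
    have "N +>\<^bsub>M\<^esub> finsum M y A = finsum ?Q (\<lambda>k. N +>\<^bsub>M\<^esub> y k) A"
      using A(1) yc by (simp add: \<kappa>.hom_finsum)
    also have "(\<lambda>k. N +>\<^bsub>M\<^esub> y k) = z" using y(2) by auto
    also have "finsum ?Q z A = N" using A(3) by (simp add: quotient_module_simps)
    finally have "finsum M y A \<in> N" using zero yc by simp
    then obtain n B where n: "finite B" "\<And>k. n k \<in> homog M k \<inter> N" "finsum M y A = finsum M n B"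
      using N unfolding graded_submodule_def by blast
    have nc: "n k \<in> carrier M" for k using n H by blast
    let ?y = "\<lambda>k. if k \<in> A then y k else \<zero>\<^bsub>M\<^esub>" and ?n = "\<lambda>k. if k \<in> B then n k else \<zero>\<^bsub>M\<^esub>"
    have 1: "finsum M ?y (A \<union> B) = finsum M y A"
      using A n yc by (intro M.add.finprod_mono_neutral_cong_right) (auto split: if_splits)
    have 2: "finsum M ?n (A \<union> B) = finsum M y A"
      unfolding n(3) using A n nc by (intro M.add.finprod_mono_neutral_cong_right) (auto split: if_splits)
    have "finsum M (\<lambda>k. ?y k \<ominus>\<^bsub>M\<^esub> ?n k) (A \<union> B) \<oplus>\<^bsub>M\<^esub> finsum M ?n (A \<union> B) =
        finsum M (\<lambda>k. (?y k \<ominus>\<^bsub>M\<^esub> ?n k) \<oplus>\<^bsub>M\<^esub> ?n k) (A \<union> B)"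
      using yc nc by (subst M.finsum_addf) (auto simp: a_minus_def)
    also have "(\<lambda>k. (?y k \<ominus>\<^bsub>M\<^esub> ?n k) \<oplus>\<^bsub>M\<^esub> ?n k) = ?y"
      using yc nc by (intro ext) (simp add: a_minus_def M.a_assoc M.l_neg)
    finally have "finsum M (\<lambda>k. ?y k \<ominus>\<^bsub>M\<^esub> ?n k) (A \<union> B) \<oplus>\<^bsub>M\<^esub> finsum M y A = finsum M y A"
      by (simp add: 1 2)
    moreover have "finsum M (\<lambda>k. ?y k \<ominus>\<^bsub>M\<^esub> ?n k) (A \<union> B) \<in> carrier M"
      using yc nc by (intro M.finsum_closed) (auto simp: a_minus_def)
    moreover have "finsum M y A \<in> carrier M" using yc by simp
    ultimately have s0: "finsum M (\<lambda>k. ?y k \<ominus>\<^bsub>M\<^esub> ?n k) (A \<union> B) = \<zero>\<^bsub>M\<^esub>"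
      by (rule M.add_eq_imp_zero)
    have "?y k \<ominus>\<^bsub>M\<^esub> ?n k = \<zero>\<^bsub>M\<^esub>"
      by (rule graded_module_indep[OF gr _ _ s0])
        (use A(1,4) n y H(2,4) in auto)
    then have "?y k = ?n k" by (rule M.minus_eq_zero_imp_eq) (use yc nc in auto)
    then have "y k \<in> N" using A(4) n(2)[of k] submoduleD(2)[OF M sN] by (auto split: if_splits)
    then show "z k = \<zero>\<^bsub>?Q\<^esub>" using zero yc y by (simp add: quotient_module_simps)
  qed
qed

text \<open>\<open>coset_map C N (diff C)\<close> is the differential of
  \<open>quotient_complex C N\<close>, so differentials and chain maps descend by the same
  lemmas.\<close>

definition coset_map where
  "coset_map M' N' f A = set_add M' N' (f ` A)"

lemma coset_map_coset:
  assumes "module R M" "submodule N R M" "module R M'" "submodule N' R M'"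
    and "f \<in> linear_maps R M M'" "f ` N \<subseteq> N'" "x \<in> carrier M"
  shows "coset_map M' N' f (N +>\<^bsub>M\<^esub> x) = N' +>\<^bsub>M'\<^esub> f x"
  unfolding coset_map_def using assms by (rule coset_linear_image)

lemma coset_map_linear:
  fixes M :: "('r, 'm, 'z) graded_module_scheme" and M' :: "('r, 'n, 'y) graded_module_scheme"
  assumes M: "module R M" "submodule N R M" and M': "module R M'" "submodule N' R M'"
    and f: "f \<in> linear_maps R M M'" "f ` N \<subseteq> N'"
  shows "coset_map M' N' f \<in> linear_maps R (quotient_module M N) (quotient_module M' N')"
proof -
  interpret M: module R M by (rule M)
  note cs = coset_map_coset[OF M M' f]
  note k = linear_mapsD[OF coset_linear[OF M]] linear_mapsD[OF coset_linear[OF M']]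
  note F = linear_mapsD[OF f(1)]
  show ?thesis
  proof (rule linear_mapsI)
    fix A assume "A \<in> carrier (quotient_module M N)"
    then obtain x where x: "x \<in> carrier M" "A = N +>\<^bsub>M\<^esub> x" by (auto simp: quotient_module_simps)
    then show "coset_map M' N' f A \<in> carrier (quotient_module M' N')" using cs k(4) F(1) by simp
    fix r assume "r \<in> carrier R"
    then show "coset_map M' N' f (r \<odot>\<^bsub>quotient_module M N\<^esub> A) =
        r \<odot>\<^bsub>quotient_module M' N'\<^esub> coset_map M' N' f A"
      using x cs F k(3)[symmetric] k(6) by simp
  next
    fix A B assume "A \<in> carrier (quotient_module M N)" "B \<in> carrier (quotient_module M N)"
    then obtain x y where x: "x \<in> carrier M" "A = N +>\<^bsub>M\<^esub> x" and y: "y \<in> carrier M" "B = N +>\<^bsub>M\<^esub> y"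
      by (auto simp: quotient_module_simps)
    then show "coset_map M' N' f (A \<oplus>\<^bsub>quotient_module M N\<^esub> B) =
        coset_map M' N' f A \<oplus>\<^bsub>quotient_module M' N'\<^esub> coset_map M' N' f B"
      using cs F k(2)[symmetric] k(5) by simp
  qed
qed

text \<open>That \<open>f\<close> maps \<open>N\<close> onto \<open>N'\<close>, and not only into
  it, gives injectivity: if \<open>f (x - y)\<close> lies in \<open>N'\<close>, it is the image of
  an element of \<open>N\<close>, which must be \<open>x - y\<close>.\<close>

lemma quotient_graded_iso:
  fixes M :: "('r, 'm, 'z) graded_module_scheme" and M' :: "('r, 'n, 'y) graded_module_scheme"
  assumes M: "is_graded_module R M" "submodule N R M"
    and M': "is_graded_module R M'" "submodule N' R M'"
    and f: "f \<in> graded_isos R M M'" "f ` N = N'"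
  shows "coset_map M' N' f \<in> graded_isos R (quotient_module M N) (quotient_module M' N')"
    (is "?F \<in> graded_isos R ?Q ?Q'")
proof -
  note m = graded_module_module[OF M(1)] graded_module_module[OF M'(1)]
  have lin: "f \<in> linear_maps R M M'" and bij: "bij_betw f (carrier M) (carrier M')"
    and hom: "\<And>k. f ` homog M k = homog M' k"
    using f(1) by (auto simp: graded_isos_def)
  interpret M: module R M by (rule m)
  interpret M': module R M' by (rule m)
  interpret f: abelian_group_hom M M' f by (rule linear_map_hom[OF m lin])
  have sub: "f ` N \<subseteq> N'" using f(2) by simp
  note cs = coset_map_coset[OF m(1) M(2) m(2) M'(2) lin sub]
  note N = submoduleD[OF m(1) M(2)]
  have surj: "?F ` carrier ?Q = carrier ?Q'"
  proof -
    have "?F ` carrier ?Q = (\<lambda>y. N' +>\<^bsub>M'\<^esub> y) ` f ` carrier M"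
      unfolding quotient_module_simps image_image by (intro image_cong refl cs)
    then show ?thesis using bij by (simp add: quotient_module_simps bij_betw_def)
  qed
  have inj: "inj_on ?F (carrier ?Q)"
  proof (rule inj_onI)
    fix A B assume "A \<in> carrier ?Q" "B \<in> carrier ?Q" and eq: "?F A = ?F B"
    then obtain x y where x: "x \<in> carrier M" "A = N +>\<^bsub>M\<^esub> x" and y: "y \<in> carrier M" "B = N +>\<^bsub>M\<^esub> y"
      by (auto simp: quotient_module_simps)
    have "f x \<ominus>\<^bsub>M'\<^esub> f y \<in> N'" using eq x y cs coset_eq_iff[OF m(2) M'(2)] by simp
    then have "f (x \<ominus>\<^bsub>M\<^esub> y) \<in> f ` N" using x y f(2) by (simp add: a_minus_def)
    then obtain n where n: "n \<in> N" "f (x \<ominus>\<^bsub>M\<^esub> y) = f n" by auto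
    then have "x \<ominus>\<^bsub>M\<^esub> y = n" using bij x y N(1) by (auto simp: bij_betw_def inj_on_def)
    then show "A = B" using coset_eq_iff[OF m(1) M(2)] x y n by simp
  qed
  have "?F ` homog ?Q k = homog ?Q' k" for k
    unfolding quotient_module_simps image_image hom[symmetric]
    using cs submoduleD(1)[OF m(1) graded_module_homog[OF M(1)]] by (intro image_cong) auto
  then show ?thesis
    using coset_map_linear[OF m(1) M(2) m(2) M'(2) lin sub] surj inj
    by (auto simp: graded_isos_def bij_betw_def)
qed


section \<open>Complexes\<close>

lemma is_complexD:
  assumes "is_complex R C"
  shows "is_graded_module R C" "diff C \<in> linear_maps R C C"
    "\<And>x k. x \<in> homog C k \<Longrightarrow> diff C x \<in> homog C (k + 2)"
    "\<And>x. x \<in> carrier C \<Longrightarrow> diff C (diff C x) = \<zero>\<^bsub>C\<^esub>"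
  using assms by (auto simp: is_complex_def)

text \<open>Applied to the identity, this carries a grading between record types with the same
  operations, here from \<open>quotient_module\<close> to \<open>quotient_complex\<close>.\<close>

lemma is_graded_module_linear_image:
  assumes M: "is_graded_module R M"
    and f: "f \<in> linear_maps R M M'" "bij_betw f (carrier M) (carrier M')" "f \<zero>\<^bsub>M\<^esub> = \<zero>\<^bsub>M'\<^esub>"
    and homog: "\<And>k. homog M' k = f ` homog M k"
  shows "is_graded_module R M'"
proof -
  note m = graded_module_module[OF M]
  have m': "module R M'" by (rule module_linear_image[OF m _ f(1,3)]) (use f in \<open>auto simp: bij_betw_def\<close>)
  interpret M: module R M by (rule m)
  interpret M': module R M' by (rule m')
  interpret f: abelian_group_hom M M' f by (rule linear_map_hom[OF m m' f(1)])
  note H = submoduleD[OF m graded_module_homog[OF M]]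
  show ?thesis
  proof (rule graded_moduleI[OF m'])
    show "submodule (homog M' k) R M'" for k
      unfolding homog by (rule submodule_linear_image[OF m m' f(1) graded_module_homog[OF M]])
  next
    fix x assume "x \<in> carrier M'"
    then obtain a where a: "a \<in> carrier M" "x = f a" using f(2) by (auto simp: bij_betw_def)
    then obtain y A where y: "finite A" "\<And>k. y k \<in> homog M k" "a = finsum M y A"
      using graded_module_decomp[OF M] by blast
    have "x = finsum M' (\<lambda>k. f (y k)) A"
      using y H(1)[OF y(2)] a by (simp add: f.hom_finsum)
    then show "\<exists>y A. finite A \<and> (\<forall>k. y k \<in> homog M' k) \<and> x = finsum M' y A"
      using y by (intro exI[of _ "\<lambda>k. f (y k)"] exI[of _ A]) (auto simp: homog)
  next
    fix z A k assume A: "finite A" "\<And>k. z k \<in> homog M' k" "finsum M' z A = \<zero>\<^bsub>M'\<^esub>" "k \<in> A"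
    then obtain y where y: "\<And>k. y k \<in> homog M k" "\<And>k. z k = f (y k)"
      unfolding homog image_iff by metis
    have yc: "y k \<in> carrier M" for k using y H by blast
    have "f (finsum M y A) = finsum M' (\<lambda>k. f (y k)) A"
      using A(1) yc by (simp add: f.hom_finsum)
    also have "(\<lambda>k. f (y k)) = z" using y(2) by auto
    also have "finsum M' z A = f \<zero>\<^bsub>M\<^esub>" using A(3) f(3) by simp
    finally have "finsum M y A = \<zero>\<^bsub>M\<^esub>" using f(2) yc by (auto simp: bij_betw_def inj_on_def)
    then have "y k = \<zero>\<^bsub>M\<^esub>" by (intro graded_module_indep[OF M A(1) y(1) _ A(4)])
    then show "z k = \<zero>\<^bsub>M'\<^esub>" using y(2) f(3) by simp
  qed
qed

lemma quotient_complex_simps: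
  "carrier (quotient_complex C N) = carrier (quotient_module C N)"
  "zero (quotient_complex C N) = zero (quotient_module C N)"
  "add (quotient_complex C N) = add (quotient_module C N)"
  "module.smult (quotient_complex C N) = module.smult (quotient_module C N)"
  "homog (quotient_complex C N) = homog (quotient_module C N)"
  "diff (quotient_complex C N) = coset_map C N (diff C)"
  by (auto simp: quotient_complex_def graded_module.defs gr_complex.defs coset_map_def fun_eq_iff)

lemma quotient_complex_is_complex:
  assumes C: "is_complex R C" and N: "graded_submodule R C N" "diff C ` N \<subseteq> N"
  shows "is_complex R (quotient_complex C N)"
proof -
  note c = is_complexD[OF C]
  note m = graded_module_module[OF c(1)]
  have sN: "submodule N R C" using N by (simp add: graded_submodule_def)
  note cs = coset_map_coset[OF m sN m sN c(2) N(2)]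
  have gr: "is_graded_module R (quotient_complex C N)"
    by (rule is_graded_module_linear_image[OF quotient_graded_module[OF c(1) N(1)], of "\<lambda>x. x"])
      (auto simp: quotient_complex_simps linear_maps_def bij_betw_def)
  interpret M: module R C by (rule m)
  interpret Q: module R "quotient_complex C N" by (rule graded_module_module[OF gr])
  have "diff (quotient_complex C N) \<in> linear_maps R (quotient_complex C N) (quotient_complex C N)"
    using coset_map_linear[OF m sN m sN c(2) N(2)]
    by (simp add: linear_maps_def quotient_complex_simps)
  moreover have "diff (quotient_complex C N) A \<in> homog (quotient_complex C N) (k + 2)"
    if "A \<in> homog (quotient_complex C N) k" for A k
    using that c(3) cs submoduleD(1)[OF m graded_module_homog[OF c(1)]]
    by (auto simp: quotient_complex_simps quotient_module_simps)
  moreover have "diff (quotient_complex C N) (diff (quotient_complex C N) A) = \<zero>\<^bsub>quotient_complex C N\<^esub>"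
    if "A \<in> carrier (quotient_complex C N)" for A
    using that c(4) cs linear_mapsD(1)[OF c(2)] coset_eq_zero_iff[OF m sN M.zero_closed] submoduleD(2)[OF m sN]
    by (auto simp: quotient_complex_simps quotient_module_simps)
  ultimately show ?thesis using gr by (auto simp: is_complex_def)
qed

text \<open>Commuting with the differentials is required only modulo \<open>N'\<close>. This lets
  the identity discard a marking at the basepoint, where the two differentials differ by a multiple
  of the dot.\<close>

lemma quotient_complex_iso:
  assumes C: "is_complex R C" "graded_submodule R C N" "diff C ` N \<subseteq> N"
    and C': "is_complex R C'" "graded_submodule R C' N'" "diff C' ` N' \<subseteq> N'"
    and f: "f \<in> graded_isos R C C'" "f ` N = N'"
    and chain: "\<And>x. x \<in> carrier C \<Longrightarrow> f (diff C x) \<ominus>\<^bsub>C'\<^esub> diff C' (f x) \<in> N'"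
  shows "complex_isomorphic R (quotient_complex C N) (quotient_complex C' N')"
proof -
  note c = is_complexD[OF C(1)] and c' = is_complexD[OF C'(1)]
  note m = graded_module_module[OF c(1)] and m' = graded_module_module[OF c'(1)]
  have s: "submodule N R C" "submodule N' R C'" using C C' by (auto simp: graded_submodule_def)
  have lin: "f \<in> linear_maps R C C'" using f(1) by (simp add: graded_isos_def)
  note d = linear_mapsD(1)[OF c(2)] linear_mapsD(1)[OF c'(2)] linear_mapsD(1)[OF lin]
  have "coset_map C' N' f \<in> graded_isos R (quotient_complex C N) (quotient_complex C' N')"
    using quotient_graded_iso[OF c(1) s(1) c'(1) s(2) f]
    by (simp add: graded_isos_def linear_maps_def quotient_complex_simps)
  moreover have "coset_map C' N' f (diff (quotient_complex C N) A) =
      diff (quotient_complex C' N') (coset_map C' N' f A)"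
    if "A \<in> carrier (quotient_complex C N)" for A
  proof -
    obtain x where x: "x \<in> carrier C" "A = N +>\<^bsub>C\<^esub> x"
      using \<open>A \<in> _\<close> by (auto simp: quotient_complex_simps quotient_module_simps)
    show ?thesis
      unfolding x(2) quotient_complex_simps
      using x(1) d f(2) coset_map_coset[OF m s(1) m s(1) c(2) C(3)]
        coset_map_coset[OF m' s(2) m' s(2) c'(2) C'(3)] coset_map_coset[OF m s(1) m' s(2) lin]
        coset_eq_iff[OF m' s(2)] chain
      by simp
  qed
  ultimately show ?thesis
    using quotient_complex_is_complex[OF C] quotient_complex_is_complex[OF C']
    by (auto simp: complex_isomorphic_def)
qed

section \<open>Cycles and homology\<close>

lemma cycles_simps:
  "carrier (cycles C) = {x \<in> carrier C. diff C x = \<zero>\<^bsub>C\<^esub>}"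
  "zero (cycles C) = zero C" "add (cycles C) = add C" "module.smult (cycles C) = module.smult C"
  "homog (cycles C) k = {x \<in> homog C k. diff C x = \<zero>\<^bsub>C\<^esub>}"
  by (auto simp: cycles_def)

text \<open>The differentials of the components of a cycle have distinct degrees and sum to zero, so
  each of them vanishes: the components are cycles themselves.\<close>

lemma cycles_graded_module:
  assumes C: "is_complex R C"
  shows "is_graded_module R (cycles C)"
proof -
  note c = is_complexD[OF C]
  note m = graded_module_module[OF c(1)]
  note d = linear_mapsD[OF c(2)]
  note H = submoduleD[OF m graded_module_homog[OF c(1)]]
  interpret C: module R C by (rule m)
  interpret d: abelian_group_hom C C "diff C" by (rule linear_map_hom[OF m m c(2)])
  let ?Z = "{x \<in> carrier C. diff C x = \<zero>\<^bsub>C\<^esub>}"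
  have sub: "submodule ?Z R C" by (rule C.submoduleI') (auto simp: d)
  have m': "module R (cycles C)"
    by (rule module_linear_image[OF submodule.submodule_is_module[OF sub m], of _ "\<lambda>x. x"])
      (auto simp: cycles_simps linear_maps_def)
  interpret Z: module R "cycles C" by (rule m')
  have hom: "submodule (homog (cycles C) k) R (cycles C)" for k
  proof -
    note Hk = submoduleD[OF m graded_module_homog[OF c(1), of k]]
    show ?thesis by (rule Z.submoduleI') (use Hk d in \<open>auto simp: cycles_simps\<close>)
  qed
  \<comment> \<open>Finite sums of cycles can be computed in \<open>C\<close> because the inclusion
    is a homomorphism.\<close>
  have incl: "(\<lambda>x. x) \<in> linear_maps R (cycles C) C" by (auto simp: linear_maps_def cycles_simps)
  note incl_finsum = abelian_group_hom.hom_finsum[OF linear_map_hom[OF m' m incl]]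
  show ?thesis
  proof (rule graded_moduleI[OF m'])
    show "submodule (homog (cycles C) k) R (cycles C)" for k by (rule hom)
  next
    fix x assume "x \<in> carrier (cycles C)"
    then have x: "x \<in> carrier C" "diff C x = \<zero>\<^bsub>C\<^esub>" by (auto simp: cycles_simps)
    then obtain y A where y: "finite A" "\<And>k. y k \<in> homog C k" "x = finsum C y A"
      using graded_module_decomp[OF c(1)] by blast
    have yc: "y k \<in> carrier C" for k using y H by blast
    \<comment> \<open>Reindexing by 2 makes the index of each summand its degree.\<close>
    have "finsum C (\<lambda>k. diff C (y (k - 2))) ((\<lambda>k. k + 2) ` A) = finsum C (\<lambda>k. diff C (y k)) A"
      using yc d(1) by (subst C.finsum_reindex) (auto simp: inj_on_def)
    also have "\<dots> = diff C x" using y yc by (simp add: d.hom_finsum)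
    finally have s0: "finsum C (\<lambda>k. diff C (y (k - 2))) ((\<lambda>k. k + 2) ` A) = \<zero>\<^bsub>C\<^esub>" using x by simp
    have dy: "diff C (y k) = \<zero>\<^bsub>C\<^esub>" if "k \<in> A" for k
      using graded_module_indep[OF c(1) _ _ s0, of "k + 2"] y(1) c(3)[OF y(2), of "_ - 2"] that
      by auto
    let ?y = "\<lambda>k. if k \<in> A then y k else \<zero>\<^bsub>C\<^esub>"
    have yh: "?y k \<in> homog (cycles C) k" for k
      using y(2) H(2) dy by (auto simp: cycles_simps)
    then have "finsum (cycles C) ?y A = finsum C ?y A"
      using H(1) by (intro incl_finsum y(1)) (auto simp: cycles_simps)
    also have "\<dots> = x"
      unfolding y(3) using yc by (intro C.finsum_cong') auto
    finally show "\<exists>y A. finite A \<and> (\<forall>k. y k \<in> homog (cycles C) k) \<and> x = finsum (cycles C) y A"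
      using yh y(1) by (intro exI[of _ ?y] exI[of _ A]) auto
  next
    fix z A k
    assume A: "finite A" "\<And>k. z k \<in> homog (cycles C) k" "finsum (cycles C) z A = \<zero>\<^bsub>cycles C\<^esub>" "k \<in> A"
    have "finsum (cycles C) z A = finsum C z A"
      using A(2) H(1) by (intro incl_finsum A(1)) (auto simp: cycles_simps)
    then have s0: "finsum C z A = \<zero>\<^bsub>C\<^esub>" using A(3) by (simp add: cycles_simps)
    have zh: "z k \<in> homog C k" for k using A(2)[of k] unfolding cycles_simps by blast
    have "z k = \<zero>\<^bsub>C\<^esub>"
      by (rule graded_module_indep[OF c(1) A(1) zh s0 A(4)])
    then show "z k = \<zero>\<^bsub>cycles C\<^esub>" unfolding cycles_simps .
  qed
qed

lemma boundaries_graded_submodule: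
  assumes C: "is_complex R C"
  shows "graded_submodule R (cycles C) (diff C ` carrier C)"
proof (rule graded_submodule_linear_image[OF _ cycles_graded_module[OF C], of _ _ 2])
  note c = is_complexD[OF C]
  show "is_graded_module R C" by (rule c)
  show "diff C \<in> linear_maps R C (cycles C)"
    using c(2,4) by (auto simp: linear_maps_def cycles_simps)
  show "diff C ` homog C k \<subseteq> homog (cycles C) (k + 2)" for k
    using c(3,4) submoduleD(1)[OF graded_module_module[OF c(1)] graded_module_homog[OF c(1)]]
    by (auto simp: cycles_simps)
qed

text \<open>Injectivity and commutation with the differentials make \<open>f\<close> match cycles
  with cycles; surjectivity makes it map boundaries onto boundaries.\<close>

lemma homology_iso:
  assumes "complex_isomorphic R C C'"
  shows "graded_isomorphic R (homology C) (homology C')"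
proof -
  obtain f where C: "is_complex R C" "is_complex R C'"
    and f: "f \<in> graded_isos R C C'" "\<And>x. x \<in> carrier C \<Longrightarrow> f (diff C x) = diff C' (f x)"
    using assms by (auto simp: complex_isomorphic_def)
  note c = is_complexD[OF C(1)] and c' = is_complexD[OF C(2)]
  note m = graded_module_module[OF c(1)] and m' = graded_module_module[OF c'(1)]
  have lin: "f \<in> linear_maps R C C'" and bij: "bij_betw f (carrier C) (carrier C')"
    and hom: "\<And>k. f ` homog C k = homog C' k"
    using f(1) by (auto simp: graded_isos_def)
  interpret C: module R C by (rule m)
  interpret f: abelian_group_hom C C' f by (rule linear_map_hom[OF m m' lin])
  have cyc: "diff C' (f x) = \<zero>\<^bsub>C'\<^esub> \<longleftrightarrow> diff C x = \<zero>\<^bsub>C\<^esub>" if "x \<in> carrier C" for x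
    using that f(2) linear_mapsD(1)[OF c(2)] bij f.hom_zero C.zero_closed
    unfolding bij_betw_def inj_on_def by metis
  note H = submoduleD(1)[OF m graded_module_homog[OF c(1)]]
  have iso: "f \<in> graded_isos R (cycles C) (cycles C')"
  proof -
    have "f \<in> linear_maps R (cycles C) (cycles C')"
      using lin cyc by (auto simp: linear_maps_def cycles_simps)
    moreover have "f ` carrier (cycles C) = carrier (cycles C')"
      using bij_betw_imp_surj_on[OF bij, symmetric] cyc by (auto simp: cycles_simps)
    moreover have "inj_on f (carrier (cycles C))"
      using bij by (auto simp: cycles_simps bij_betw_def inj_on_def)
    moreover have "f ` homog (cycles C) k = homog (cycles C') k" for k
      using hom[of k, symmetric] cyc H by (auto simp: cycles_simps)
    ultimately show ?thesis by (simp add: graded_isos_def bij_betw_def)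
  qed
  have "f ` diff C ` carrier C = diff C' ` f ` carrier C"
    unfolding image_image by (intro image_cong refl f(2))
  then have im: "f ` diff C ` carrier C = diff C' ` carrier C'" using bij by (simp add: bij_betw_def)
  note B = boundaries_graded_submodule[OF C(1)] boundaries_graded_submodule[OF C(2)]
  note cg = cycles_graded_module[OF C(1)] cycles_graded_module[OF C(2)]
  show ?thesis
    unfolding graded_isomorphic_def homology_def
    using quotient_graded_module[OF cg(1) B(1)] quotient_graded_module[OF cg(2) B(2)]
      quotient_graded_iso[OF cg(1) _ cg(2) _ iso im] B
    by (auto simp: graded_submodule_def)
qed

section \<open>Isomorphism of complexes as an equivalence relation\<close>

lemma graded_isos_inv:
  assumes M: "is_graded_module R M" and f: "f \<in> graded_isos R M N"
  shows "inv_into (carrier M) f \<in> graded_isos R N M"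
proof -
  interpret M: module R M by (rule graded_module_module[OF M])
  let ?g = "inv_into (carrier M) f"
  have lin: "f \<in> linear_maps R M N" and bij: "bij_betw f (carrier M) (carrier N)"
    and hom: "\<And>k. f ` homog M k = homog N k"
    using f by (auto simp: graded_isos_def)
  have inv: "?g (f x) = x" if "x \<in> carrier M" for x
    using bij that by (simp add: bij_betw_inv_into_left)
  have img: "carrier N = f ` carrier M" using bij by (simp add: bij_betw_def)
  have "?g \<in> linear_maps R N M"
    by (rule linear_mapsI; (unfold img)?) (auto simp: linear_mapsD(2,3)[OF lin, symmetric] inv)
  moreover have "?g ` homog N k = homog M k" for k
  proof -
    have "homog M k \<subseteq> carrier M"
      using submoduleD(1)[OF graded_module_module[OF M] graded_module_homog[OF M]] by auto
    then show ?thesis unfolding hom[symmetric] image_image using inv by (auto simp: subset_iff image_iff)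
  qed
  ultimately show ?thesis using bij_betw_inv_into[OF bij] by (simp add: graded_isos_def)
qed

lemma graded_isos_comp:
  assumes f: "f \<in> graded_isos R M N" and g: "g \<in> graded_isos R N P"
  shows "g \<circ> f \<in> graded_isos R M P"
proof -
  have "(g \<circ> f) ` homog M k = homog P k" for k
    using f g unfolding graded_isos_def image_comp[symmetric] by simp
  then show ?thesis
    using assms bij_betw_trans[of f "carrier M" "carrier N" g "carrier P"]
    by (auto simp: graded_isos_def linear_maps_def Pi_iff)
qed

lemma complex_isomorphic_sym:
  assumes "complex_isomorphic R C C'"
  shows "complex_isomorphic R C' C"
proof -
  obtain f where C: "is_complex R C" "is_complex R C'"
    and f: "f \<in> graded_isos R C C'" "\<And>x. x \<in> carrier C \<Longrightarrow> f (diff C x) = diff C' (f x)"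
    using assms by (auto simp: complex_isomorphic_def)
  let ?g = "inv_into (carrier C) f"
  have bij: "bij_betw f (carrier C) (carrier C')" using f(1) by (simp add: graded_isos_def)
  have "?g (diff C' y) = diff C (?g y)" if y: "y \<in> carrier C'" for y
  proof -
    have x: "?g y \<in> carrier C" "f (?g y) = y"
      using bij y by (auto simp: bij_betw_inv_into_right inv_into_into bij_betw_def f_inv_into_f)
    then have "diff C' y = f (diff C (?g y))" using f(2) by metis
    then show ?thesis
      using bij x(1) linear_mapsD(1)[OF is_complexD(2)[OF C(1)]] by (simp add: bij_betw_inv_into_left)
  qed
  then show ?thesis
    using C graded_isos_inv[OF is_complexD(1)[OF C(1)] f(1)] by (auto simp: complex_isomorphic_def)
qed

lemma complex_isomorphic_trans:
  assumes "complex_isomorphic R C C'" "complex_isomorphic R C' C''"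
  shows "complex_isomorphic R C C''"
proof -
  obtain f where C: "is_complex R C" "is_complex R C'"
    and f: "f \<in> graded_isos R C C'" "\<And>x. x \<in> carrier C \<Longrightarrow> f (diff C x) = diff C' (f x)"
    using assms(1) by (auto simp: complex_isomorphic_def)
  obtain g where C'': "is_complex R C''"
    and g: "g \<in> graded_isos R C' C''" "\<And>x. x \<in> carrier C' \<Longrightarrow> g (diff C' x) = diff C'' (g x)"
    using assms(2) by (auto simp: complex_isomorphic_def)
  have "f x \<in> carrier C'" if "x \<in> carrier C" for x
    using f(1) that by (auto simp: graded_isos_def linear_maps_def)
  then show ?thesis
    using C C'' f(2) g(2) graded_isos_comp[OF f(1) g(1)]
    by (auto simp: complex_isomorphic_def intro!: bexI[of _ "g \<circ> f"])
qed

lemma complex_isomorphic_refl: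
  assumes "is_complex R C"
  shows "complex_isomorphic R C C"
  using assms by (auto simp: complex_isomorphic_def graded_isos_def linear_maps_def
      intro!: exI[of _ id])

section \<open>Saddles\<close>

text \<open>Circles of different resolutions are different sets of edges, so resolutions are
  compared through the relation of lying on a common circle.\<close>

definition same_block :: "'e set set \<Rightarrow> 'e \<Rightarrow> 'e \<Rightarrow> bool" where
  "same_block Z a b \<longleftrightarrow> (\<exists>A\<in>Z. a \<in> A \<and> b \<in> A)"

text \<open>Phrased by relations and not by the two blocks, so that it can be read off from the
  generating arcs of two resolutions by \<open>gen_equiv_merge\<close>.\<close>

definition merges :: "'e \<Rightarrow> 'e \<Rightarrow> 'e set set \<Rightarrow> 'e set set \<Rightarrow> bool" where
  "merges p q Z Z' \<longleftrightarrow> \<not> same_block Z p q \<and>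
    (\<forall>a b. same_block Z' a b \<longleftrightarrow> same_block Z a b \<or>
      (same_block Z a p \<and> same_block Z b q) \<or> (same_block Z a q \<and> same_block Z b p))"

text \<open>In the last case one circle goes to one circle and the saddle map is 0; in characteristic 2
  this agrees with the formula \<open>1 \<mapsto> x\<^sub>p + x\<^sub>q\<close> for a split, which is why no relation below needs a
  separate treatment of it.\<close>

definition surgery :: "'e \<Rightarrow> 'e \<Rightarrow> 'e set set \<Rightarrow> 'e set set \<Rightarrow> bool" where
  "surgery p q Z Z' \<longleftrightarrow>
    merges p q Z Z' \<or> merges p q Z' Z \<or> (Z = Z' \<and> same_block Z p q)"

lemma surgery_sym: "surgery p q Z Z' \<Longrightarrow> surgery p q Z' Z"
  by (auto simp: surgery_def)

lemma partition_on_same_block: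
  assumes "partition_on E Z" "A \<in> Z" "a \<in> A"
  shows "A = {b. same_block Z a b}"
  using assms unfolding partition_on_def disjoint_def same_block_def by blast

lemma same_block_equiv:
  assumes "partition_on E Z"
  shows "a \<in> E \<Longrightarrow> same_block Z a a" and "same_block Z a b \<Longrightarrow> same_block Z b a"
    and "same_block Z a b \<Longrightarrow> same_block Z b c \<Longrightarrow> same_block Z a c"
    and "same_block Z a b \<Longrightarrow> a \<in> E"
  using assms unfolding partition_on_def disjoint_def same_block_def by blast+

lemma partition_on_eqI:
  assumes Z: "partition_on E Z" and Z': "partition_on E Z'"
    and eq: "\<And>a b. same_block Z a b \<longleftrightarrow> same_block Z' a b"
  shows "Z = Z'"
proof -
  have "Y \<subseteq> Y'" if Y: "partition_on E Y" "partition_on E Y'" "\<And>a b. same_block Y a b \<longleftrightarrow> same_block Y' a b" for Y Y'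
  proof
    fix A assume A: "A \<in> Y"
    then obtain a where a: "a \<in> A" using Y(1) unfolding partition_on_def by (metis ex_in_conv)
    then have "a \<in> E" using A Y(1) by (auto simp: partition_on_def)
    then obtain B where B: "B \<in> Y'" "a \<in> B" using Y(2) by (auto simp: partition_on_def)
    have "A = B"
      using partition_on_same_block[OF Y(1) A a] partition_on_same_block[OF Y(2) B] Y(3) by simp
    then show "A \<in> Y'" using B by simp
  qed
  then show ?thesis using assms by (intro equalityI) auto
qed

text \<open>The concrete form behind the cardinalities in \<open>saddle_coeff\<close>: the
  conclusions make \<open>Z - Z'\<close> the pair \<open>A\<close>, \<open>B\<close> and
  \<open>Z' - Z\<close> the single circle \<open>A \<union> B\<close>.\<close>

lemma mergesE:
  assumes Z: "partition_on E Z" and Z': "partition_on E Z'" and pq: "p \<in> E" "q \<in> E"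
    and m: "merges p q Z Z'"
  obtains A B where "A \<in> Z" "B \<in> Z" "A \<noteq> B" "p \<in> A" "q \<in> B" "Z' = insert (A \<union> B) (Z - {A, B})"
    "A \<union> B \<notin> Z" "A \<notin> Z'" "B \<notin> Z'"
proof -
  obtain A B where AB: "A \<in> Z" "p \<in> A" "B \<in> Z" "q \<in> B"
    using Z pq by (auto simp: partition_on_def)
  have ne: "A \<noteq> B" using m AB by (auto simp: merges_def same_block_def)
  have disj: "A \<inter> B = {}" using Z AB ne by (auto simp: partition_on_def disjoint_def)
  have new: "A \<union> B \<notin> Z"
  proof
    assume "A \<union> B \<in> Z"
    moreover have "p \<in> A \<union> B" "q \<in> A \<union> B" using AB by auto
    ultimately have "same_block Z p q" unfolding same_block_def by blast
    then show False using m by (simp add: merges_def)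
  qed
  let ?Y = "insert (A \<union> B) (Z - {A, B})"
  have Y: "partition_on E ?Y"
    using Z AB by (auto simp: partition_on_def disjoint_def)
  have blocks: "same_block Z a p \<longleftrightarrow> a \<in> A" "same_block Z a q \<longleftrightarrow> a \<in> B" for a
    using partition_on_same_block[OF Z AB(1,2)] partition_on_same_block[OF Z AB(3,4)]
      same_block_equiv(2)[OF Z] by blast+
  have "same_block ?Y a b \<longleftrightarrow> same_block Z' a b" for a b
  proof -
    have "same_block ?Y a b \<longleftrightarrow> same_block Z a b \<or> (a \<in> A \<and> b \<in> B) \<or> (a \<in> B \<and> b \<in> A)"
      using AB by (auto simp: same_block_def)
    then show ?thesis using m by (auto simp: merges_def blocks)
  qed
  then have "Z' = ?Y" by (intro partition_on_eqI[OF Z' Y]) auto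
  moreover have "A \<notin> ?Y" "B \<notin> ?Y"
    using disj AB by auto
  ultimately show ?thesis using that AB ne new by simp
qed

section \<open>Dots and saddles as maps between tensor powers\<close>

definition dot :: "'e set set \<Rightarrow> 'e \<Rightarrow> ('e set set \<Rightarrow> 'r::comm_ring_1) \<Rightarrow> 'e set set \<Rightarrow> 'r" where
  "dot Z e f T = (if T \<subseteq> Z then \<Sum>z | z \<in> T \<and> e \<in> z. f (T - {z}) else 0)"

definition saddle :: "'e set set \<Rightarrow> 'e set set \<Rightarrow> ('e set set \<Rightarrow> 'r::comm_ring_1) \<Rightarrow> 'e set set \<Rightarrow> 'r" where
  "saddle Z Z' f T = (if T \<subseteq> Z' then \<Sum>S\<in>Pow Z. saddle_coeff Z Z' S T * f S else 0)"

definition linear_op :: "(('a \<Rightarrow> 'r::comm_ring_1) \<Rightarrow> 'b \<Rightarrow> 'r) \<Rightarrow> bool" where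
  "linear_op F \<longleftrightarrow> (\<forall>f g. F (\<lambda>x. f x + g x) = (\<lambda>x. F f x + F g x)) \<and>
    (\<forall>r f. F (\<lambda>x. r * f x) = (\<lambda>x. r * F f x))"

lemma linear_op_dot: "linear_op (dot Z e)"
  by (auto simp: linear_op_def dot_def fun_eq_iff sum.distrib sum_distrib_left)

lemma linear_op_saddle: "linear_op (saddle Z Z')"
  by (auto simp: linear_op_def saddle_def fun_eq_iff sum.distrib sum_distrib_left algebra_simps)

lemma linear_op_comp: "linear_op F \<Longrightarrow> linear_op G \<Longrightarrow> linear_op (\<lambda>f. F (G f))"
  by (auto simp: linear_op_def)

lemma linear_op_add: "linear_op F \<Longrightarrow> linear_op G \<Longrightarrow> linear_op (\<lambda>f x. F f x + G f x)"
  by (auto simp: linear_op_def fun_eq_iff algebra_simps)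

lemma linear_op_zero: "linear_op F \<Longrightarrow> F (\<lambda>x. 0) = (\<lambda>x. 0)"
  unfolding linear_op_def by (drule conjunct2) (drule spec[of _ 0], simp)

lemma linear_op_sum:
  assumes "linear_op F" "finite A"
  shows "F (\<lambda>x. \<Sum>i\<in>A. r i * f i x) = (\<lambda>y. \<Sum>i\<in>A. r i * F (f i) y)"
  using assms(2)
proof (induction A rule: finite_induct)
  case empty
  then show ?case by (simp add: linear_op_zero[OF assms(1)])
next
  case (insert a A)
  then show ?case using assms(1) by (simp add: linear_op_def)
qed

lemma dot_block:
  assumes Z: "partition_on E Z" and A: "A \<in> Z" "e \<in> A"
  shows "dot Z e f T = (if T \<subseteq> Z \<and> A \<in> T then f (T - {A}) else 0)"
proof -
  have "{z. z \<in> T \<and> e \<in> z} = (if A \<in> T then {A} else {})" if "T \<subseteq> Z"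
  proof -
    have "z = A" if "z \<in> Z" "e \<in> z" for z
      using that Z A unfolding partition_on_def disjoint_def by blast
    then show ?thesis using that A(2) by auto
  qed
  then show ?thesis by (auto simp: dot_def)
qed

text \<open>Only those \<open>S\<close> contribute that agree with \<open>T\<close> on the circles
  common to \<open>Z\<close> and \<open>Z'\<close>, and such an \<open>S\<close> is determined by
  its part in \<open>Z - Z'\<close>.\<close>

lemma saddle_expand:
  fixes f :: "'e set set \<Rightarrow> 'r::comm_ring_1"
  assumes fin: "finite Z" and T: "T \<subseteq> Z'"
  shows "saddle Z Z' f T = (\<Sum>S\<in>Pow (Z - Z'). saddle_coeff Z Z' S (T - Z) * f (T \<inter> Z \<union> S))"
proof -
  have z: "(saddle_coeff Z Z' S T :: 'r) = 0" if "S \<inter> Z' \<noteq> T \<inter> Z" for S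
    using that by (simp add: saddle_coeff_def Let_def)
  have "saddle Z Z' f T = (\<Sum>S\<in>Pow Z. saddle_coeff Z Z' S T * f S)"
    using T by (simp add: saddle_def)
  also have "\<dots> = (\<Sum>S\<in>{S\<in>Pow Z. S \<inter> Z' = T \<inter> Z}. saddle_coeff Z Z' S T * f S)"
  proof (rule sum.mono_neutral_right)
    show "\<forall>S\<in>Pow Z - {S \<in> Pow Z. S \<inter> Z' = T \<inter> Z}. saddle_coeff Z Z' S T * f S = 0"
    proof
      fix S assume "S \<in> Pow Z - {S \<in> Pow Z. S \<inter> Z' = T \<inter> Z}"
      then have "S \<inter> Z' \<noteq> T \<inter> Z" by blast
      then show "saddle_coeff Z Z' S T * f S = 0" using z by simp
    qed
  qed (use fin in auto)
  also have "\<dots> = (\<Sum>S\<in>Pow (Z - Z'). saddle_coeff Z Z' S (T - Z) * f (T \<inter> Z \<union> S))"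
  proof (rule sum.reindex_bij_witness[of _ "\<lambda>S. T \<inter> Z \<union> S" "\<lambda>S. S - Z'"])
    fix S assume S: "S \<in> {S\<in>Pow Z. S \<inter> Z' = T \<inter> Z}"
    then show eq: "T \<inter> Z \<union> (S - Z') = S" by auto
    show "S - Z' \<in> Pow (Z - Z')" using S by auto
    have "(S - Z') \<inter> Z' = (T - Z) \<inter> Z" by auto
    then show "saddle_coeff Z Z' (S - Z') (T - Z) * f (T \<inter> Z \<union> (S - Z')) = saddle_coeff Z Z' S T * f S"
      using S unfolding eq by (simp add: saddle_coeff_def)
  qed (use T in auto)
  finally show ?thesis .
qed

text \<open>Multiplication, read at the output: the new circle carries \<open>x\<close> if exactly
  one of \<open>A\<close> and \<open>B\<close> does, and 1 if both carry 1. Inputs with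
  \<open>x\<close> on both contribute nothing.\<close>

lemma saddle_merge:
  assumes fin: "finite Z" and A: "A \<in> Z" "B \<in> Z" "A \<noteq> B" "A \<union> B \<notin> Z" "A \<notin> Z'" "B \<notin> Z'"
    and Z': "Z' = insert (A \<union> B) (Z - {A, B})"
  shows "saddle Z Z' f T = (if T \<subseteq> Z' then
    if A \<union> B \<in> T then f (insert A (T - {A \<union> B})) + f (insert B (T - {A \<union> B})) else f T else 0)"
proof (cases "T \<subseteq> Z'")
  case True
  have d: "Z - Z' = {A, B}" "Z' - Z = {A \<union> B}" using A Z' by auto
  have P: "Pow (Z - Z') = {{}, {A}, {B}, {A, B}}" unfolding d by auto
  have T: "T \<inter> Z = T - {A \<union> B}" "T - Z = (if A \<union> B \<in> T then {A \<union> B} else {})"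
    using True Z' A by auto
  have d': "{A} - Z' = {A}" "{B} - Z' = {B}" "{A, B} - Z' = {A, B}" "{A \<union> B} - Z = {A \<union> B}"
    "{A} \<inter> Z' = {}" "{B} \<inter> Z' = {}" "{A, B} \<inter> Z' = {}" "{A \<union> B} \<inter> Z = {}"
    using A by auto
  have dist: "{A} \<noteq> {B}" "{A} \<noteq> {A, B}" "{B} \<noteq> {A, B}" using A(3) by auto
  have "saddle Z Z' f T = (\<Sum>S\<in>{{}, {A}, {B}, {A, B}}. saddle_coeff Z Z' S (T - Z) * f (T \<inter> Z \<union> S))"
    by (simp add: saddle_expand[OF fin True] P)
  also have "\<dots> = (if A \<union> B \<in> T then f (insert A (T - {A \<union> B})) + f (insert B (T - {A \<union> B})) else f T)"
    using A(3) dist by (simp add: T saddle_coeff_def d d' Let_def)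
  finally show ?thesis using True by simp
qed (simp add: saddle_def)

text \<open>Comultiplication, read at the output: \<open>x\<close> on both new circles comes from
  \<open>x\<close>, \<open>x\<close> on just one of them from 1, and 1 on both from nothing.\<close>

lemma saddle_split:
  assumes fin: "finite Z" and A: "A \<in> Z'" "B \<in> Z'" "A \<noteq> B" "A \<union> B \<notin> Z'" "A \<notin> Z" "B \<notin> Z"
    and Z: "Z = insert (A \<union> B) (Z' - {A, B})"
  shows "saddle Z Z' f T = (if T \<subseteq> Z' then
    if A \<in> T \<and> B \<in> T then f (insert (A \<union> B) (T - {A, B}))
    else if A \<in> T \<or> B \<in> T then f (T - {A, B}) else 0 else 0)"
proof (cases "T \<subseteq> Z'")
  case True
  have d: "Z' - Z = {A, B}" "Z - Z' = {A \<union> B}" using A Z by auto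
  have P: "Pow (Z - Z') = {{}, {A \<union> B}}" unfolding d by auto
  have T: "T \<inter> Z = T - {A, B}" "T - Z = T \<inter> {A, B}"
    using True Z A by auto
  have d': "{A \<union> B} - Z' = {A \<union> B}" "{A \<union> B} \<inter> Z' = {}" "T \<inter> {A, B} - Z = T \<inter> {A, B}" "T \<inter> {A, B} \<inter> Z = {}"
    using A by auto
  have c: "card (T \<inter> {A, B}) = (if A \<in> T \<and> B \<in> T then 2 else if A \<in> T \<or> B \<in> T then 1 else 0)"
  proof -
    have "T \<inter> {A, B} = (if A \<in> T then {A} else {}) \<union> (if B \<in> T then {B} else {})" by auto
    then show ?thesis using A(3) by simp
  qed
  have "saddle Z Z' f T = (\<Sum>S\<in>{{}, {A \<union> B}}. saddle_coeff Z Z' S (T - Z) * f (T \<inter> Z \<union> S))"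
    by (simp add: saddle_expand[OF fin True] P)
  also have "\<dots> = (if A \<in> T \<and> B \<in> T then f (insert (A \<union> B) (T - {A, B}))
    else if A \<in> T \<or> B \<in> T then f (T - {A, B}) else 0)"
    using A(3) unfolding T saddle_coeff_def d d' Let_def by (simp add: c d')
  finally show ?thesis using True by simp
qed (simp add: saddle_def)

lemma saddle_same: "saddle Z Z f T = 0"
  by (auto simp: saddle_def saddle_coeff_def Let_def intro!: sum.neutral)

text \<open>Multiplication and comultiplication of \<open>R[x]/(x^2)\<close> are linear over that
  algebra. If the circle through \<open>e\<close> takes part in the saddle, this is checked on
  coefficients; otherwise the dot acts on a circle common to \<open>Z\<close> and
  \<open>Z'\<close>.\<close>

lemma saddle_dot:
  assumes fin: "finite Z" and Z: "partition_on E Z" and Z': "partition_on E Z'" and pq: "p \<in> E" "q \<in> E"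
    and s: "surgery p q Z Z'" and e: "e \<in> E"
  shows "saddle Z Z' (dot Z e f) = dot Z' e (saddle Z Z' f)"
proof
  fix T
  obtain D where D: "D \<in> Z" "e \<in> D" using e Z by (auto simp: partition_on_def)
  obtain D' where D': "D' \<in> Z'" "e \<in> D'" using e Z' by (auto simp: partition_on_def)
  note X = dot_block[OF Z D] and X' = dot_block[OF Z' D']
  have un: "D1 = D2" if "D1 \<in> Y" "D2 \<in> Y" "e \<in> D1" "e \<in> D2" "partition_on E Y" for D1 D2 Y
    using that unfolding partition_on_def disjoint_def by blast
  consider "merges p q Z Z'" | "merges p q Z' Z" | "Z = Z'" using s by (auto simp: surgery_def)
  then show "saddle Z Z' (dot Z e f) T = dot Z' e (saddle Z Z' f) T"
  proof cases
    case 1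
    obtain A B where AB: "A \<in> Z" "B \<in> Z" "A \<noteq> B" "Z' = insert (A \<union> B) (Z - {A, B})"
      "A \<union> B \<notin> Z" "A \<notin> Z'" "B \<notin> Z'" by (rule mergesE[OF Z Z' pq 1])
    note sm = saddle_merge[OF fin AB(1-3,5-7,4)]
    show ?thesis
    proof (cases "D = A \<or> D = B")
      case True
      then have D'eq: "D' = A \<union> B" using D D' AB by (intro un[OF _ _ _ _ Z']) auto
      have eqs: "insert A (T - {A \<union> B}) - {A} = T - {A \<union> B}"
        "insert B (T - {A \<union> B}) - {B} = T - {A \<union> B}"
        "insert A (T - {A \<union> B}) \<subseteq> Z" "insert B (T - {A \<union> B}) \<subseteq> Z"
        "A \<notin> T" "B \<notin> T" "T - {A \<union> B} \<subseteq> Z'" if "T \<subseteq> Z'"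
        using that AB by auto
      show ?thesis
      proof (cases "T \<subseteq> Z'")
        case T: True
        show ?thesis
          using True AB(3) eqs[OF T] T by (elim disjE) (simp_all add: X X' sm D'eq)
      qed (simp add: X' sm)
    next
      case False
      then have D'eq: "D' = D" using D D' AB by (intro un[OF _ _ _ _ Z']) auto
      have ne: "D \<noteq> A \<union> B" using AB D by auto
      have eqs: "insert A (T - {A \<union> B}) - {D} = insert A (T - {D} - {A \<union> B})"
        "insert B (T - {A \<union> B}) - {D} = insert B (T - {D} - {A \<union> B})" using False by auto
      have sub: "insert A (T - {A \<union> B}) \<subseteq> Z" "insert B (T - {A \<union> B}) \<subseteq> Z" if "T \<subseteq> Z'"
        using that AB by auto
      have sub': "T \<subseteq> Z" if "T \<subseteq> Z'" "A \<union> B \<notin> T" using that AB by auto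
      show ?thesis
        using False ne sub sub' by (auto simp: X X' sm D'eq eqs)
    qed
  next
    case 2
    obtain A B where AB: "A \<in> Z'" "B \<in> Z'" "A \<noteq> B" "Z = insert (A \<union> B) (Z' - {A, B})"
      "A \<union> B \<notin> Z'" "A \<notin> Z" "B \<notin> Z" by (rule mergesE[OF Z' Z pq 2])
    note sm = saddle_split[OF fin AB(1-3,5-7,4)]
    show ?thesis
    proof (cases "D' = A \<or> D' = B")
      case True
      then have Deq: "D = A \<union> B" using D D' AB by (intro un[OF _ _ _ _ Z]) auto
      have eqs: "insert (A \<union> B) (T - {A, B}) - {A \<union> B} = T - {A, B}" "A \<union> B \<notin> T"
        "insert (A \<union> B) (T - {A, B}) \<subseteq> Z" "T - {A} \<subseteq> Z'" "T - {B} \<subseteq> Z'" "T - {A, B} \<subseteq> Z"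
        if "T \<subseteq> Z'" using that AB by auto
      have eqs': "T - {A} - {A, B} = T - {A, B}" "T - {B} - {A, B} = T - {A, B}"
        "T - {A} - {B} = T - {A, B}" "T - {B} - {A} = T - {A, B}" by auto
      show ?thesis
      proof (cases "T \<subseteq> Z'")
        case T: True
        show ?thesis
          using True AB(3) eqs[OF T] T by (elim disjE) (simp_all add: X X' sm Deq eqs')
      qed (simp add: X' sm)
    next
      case False
      then have Deq: "D = D'" using D D' AB by (intro un[OF _ _ _ _ Z]) auto
      have ne: "D' \<noteq> A \<union> B" using AB D' by auto
      have eqs: "insert (A \<union> B) (T - {A, B}) - {D'} = insert (A \<union> B) (T - {D'} - {A, B})"
        "T - {A, B} - {D'} = T - {D'} - {A, B}" using ne by auto
      have sub: "insert (A \<union> B) (T - {A, B}) \<subseteq> Z" "T - {A, B} \<subseteq> Z" if "T \<subseteq> Z'" using that AB by auto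
      show ?thesis
      proof (cases "T \<subseteq> Z'")
        case T: True
        then have "T - {D'} \<subseteq> Z'" "A \<noteq> D'" "B \<noteq> D'" using False by auto
        then show ?thesis
          using False ne sub[OF T] T by (simp add: X X' sm Deq eqs)
      qed (simp add: X' sm)
    qed
  next
    case 3
    then show ?thesis by (simp add: saddle_same dot_def)
  qed
qed

text \<open>The tensor \<open>1 \<otimes> ... \<otimes> 1\<close>, from which the dots generate the
  tensor power.\<close>

definition unit :: "'e set set \<Rightarrow> 'r::comm_ring_1" where
  "unit = (\<lambda>T. of_bool (T = {}))"

lemma saddle_unit:
  assumes fin: "finite Z" and Z: "partition_on E Z" and Z': "partition_on E Z'" and pq: "p \<in> E" "q \<in> E"
    and s: "surgery p q Z Z'" and char: "\<And>r::'r::comm_ring_1. r + r = 0"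
  shows "saddle Z Z' unit = (if same_block Z p q then (\<lambda>T. dot Z' p unit T + dot Z' q unit T) else (unit :: 'e set set \<Rightarrow> 'r))"
    (is "_ = ?r")
proof
  fix T
  consider "merges p q Z Z'" | "merges p q Z' Z" | "Z = Z'" "same_block Z p q"
    using s by (auto simp: surgery_def)
  then show "saddle Z Z' unit T = ?r T"
  proof cases
    case 1
    obtain A B where AB: "A \<in> Z" "B \<in> Z" "A \<noteq> B" "Z' = insert (A \<union> B) (Z - {A, B})"
      "A \<union> B \<notin> Z" "A \<notin> Z'" "B \<notin> Z'" by (rule mergesE[OF Z Z' pq 1])
    have "\<not> same_block Z p q" using 1 by (simp add: merges_def)
    then show ?thesis by (auto simp: saddle_merge[OF fin AB(1-3,5-7,4)] unit_def)
  next
    case 2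
    obtain A B where AB: "A \<in> Z'" "B \<in> Z'" "A \<noteq> B" "p \<in> A" "q \<in> B" "Z = insert (A \<union> B) (Z' - {A, B})"
      "A \<union> B \<notin> Z'" "A \<notin> Z" "B \<notin> Z" by (rule mergesE[OF Z' Z pq 2])
    have "same_block Z p q" using AB by (auto simp: same_block_def)
    then show ?thesis
      using AB(1-3) by (auto simp: saddle_split[OF fin AB(1-3,7-9,6)] unit_def
          dot_block[OF Z' AB(1,4)] dot_block[OF Z' AB(2,5)])
  next
    \<comment> \<open>The saddle is zero, and \<open>p\<close> and \<open>q\<close> lie on one
      circle, so the sum of their dots is \<open>2 x = 0\<close>.\<close>
    case 3
    then obtain A where A: "A \<in> Z" "p \<in> A" "q \<in> A" by (auto simp: same_block_def)
    show ?thesis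
      using 3 char unfolding 3(1)[symmetric]
      by (auto simp: saddle_same dot_block[OF Z A(1,2)] dot_block[OF Z A(1,3)])
  qed
qed

text \<open>The tensor power is a cyclic module over the ring generated by the dots, so a map commuting
  with all dots is determined by the image of the unit.\<close>

lemma dot_linear_eqI:
  assumes fin: "finite Z" and Z: "partition_on E Z"
    and F: "linear_op F" "\<And>e f. e \<in> E \<Longrightarrow> F (dot Z e f) = dot Z' e (F f)"
    and G: "linear_op G" "\<And>e f. e \<in> E \<Longrightarrow> G (dot Z e f) = dot Z' e (G f)"
    and unit: "F unit = G unit" and supp: "\<And>S. \<not> S \<subseteq> Z \<Longrightarrow> f S = 0"
  shows "F f = G f"
proof -
  \<comment> \<open>\<open>\<delta> S\<close> is the monomial with \<open>x\<close> on the circles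
    of \<open>S\<close>; it arises from the unit by placing one dot on each of these
    circles.\<close>
  define \<delta> :: "'a set set \<Rightarrow> 'a set set \<Rightarrow> 'b" where "\<delta> S T = of_bool (T = S)" for S T
  have basis: "F (\<delta> S) = G (\<delta> S)" if "finite S" "S \<subseteq> Z" for S
    using that
  proof (induction S rule: finite_induct)
    case empty
    have "\<delta> {} = unit" by (simp add: \<delta>_def unit_def fun_eq_iff)
    then show ?case using unit by simp
  next
    case (insert A S)
    then have A: "A \<in> Z" by simp
    then obtain e where e: "e \<in> A" using Z unfolding partition_on_def by (metis ex_in_conv)
    then have eE: "e \<in> E" using A Z by (auto simp: partition_on_def)
    have "\<delta> (insert A S) = dot Z e (\<delta> S)"
      using insert by (auto simp: fun_eq_iff dot_block[OF Z A e] \<delta>_def)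
    then show ?case using insert F(2)[OF eE] G(2)[OF eE] by simp
  qed
  have f: "f = (\<lambda>T. \<Sum>S\<in>Pow Z. f S * \<delta> S T)"
  proof
    fix T
    have "(\<Sum>S\<in>Pow Z. f S * \<delta> S T) = (\<Sum>S\<in>Pow Z. if T = S then f S else 0)"
      by (intro sum.cong) (auto simp: \<delta>_def)
    also have "\<dots> = f T" using fin supp[of T] by (auto simp: sum.delta')
    finally show "f T = (\<Sum>S\<in>Pow Z. f S * \<delta> S T)" by simp
  qed
  have "F f = (\<lambda>T. \<Sum>S\<in>Pow Z. f S * F (\<delta> S) T)"
    using linear_op_sum[OF F(1), of "Pow Z" f \<delta>] fin f by simp
  also have "\<dots> = (\<lambda>T. \<Sum>S\<in>Pow Z. f S * G (\<delta> S) T)"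
    using basis finite_subset[OF _ fin] by (intro ext sum.cong) auto
  also have "\<dots> = G f"
    using linear_op_sum[OF G(1), of "Pow Z" f \<delta>] fin f by simp
  finally show ?thesis .
qed

lemma dot_same_block:
  assumes "partition_on E Z" "same_block Z e e'"
  shows "dot Z e f = dot Z e' f"
proof -
  obtain A where "A \<in> Z" "e \<in> A" "e' \<in> A" using assms(2) by (auto simp: same_block_def)
  then show ?thesis by (simp add: fun_eq_iff dot_block[OF assms(1)])
qed

lemma dot_commute:
  assumes Z: "partition_on E Z" and "e \<in> E" "e' \<in> E"
  shows "dot Z e (dot Z e' f) = dot Z e' (dot Z e f)"
proof -
  obtain A B where AB: "A \<in> Z" "e \<in> A" "B \<in> Z" "e' \<in> B" using assms by (auto simp: partition_on_def)
  have eq: "T - {B} - {A} = T - {A} - {B}" for T by auto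
  show ?thesis
  proof (cases "A = B")
    case True
    show ?thesis
      unfolding fun_eq_iff dot_block[OF Z AB(1,2)] dot_block[OF Z AB(3,4)] True by simp
  next
    case False
    then show ?thesis
      by (auto simp: fun_eq_iff dot_block[OF Z AB(1,2)] dot_block[OF Z AB(3,4)] eq)
  qed
qed

lemma dot_dot:
  assumes Z: "partition_on E Z" and "e \<in> E"
  shows "dot Z e (dot Z e f) = (\<lambda>T. 0)"
proof -
  obtain A where A: "A \<in> Z" "e \<in> A" using assms by (auto simp: partition_on_def)
  show ?thesis by (auto simp: fun_eq_iff dot_block[OF Z A])
qed

lemma dot_add: "dot Z e (\<lambda>T. f T + g T) = (\<lambda>T. dot Z e f T + dot Z e g T)"
  using linear_op_dot[of Z e] unfolding linear_op_def by blast

lemma saddle_add: "saddle Z Z' (\<lambda>T. f T + g T) = (\<lambda>T. saddle Z Z' f T + saddle Z Z' g T)"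
  using linear_op_saddle[of Z Z'] unfolding linear_op_def by blast

text \<open>If \<open>p\<close> and \<open>q\<close> share a circle, a saddle between them can only
  refine the circles; otherwise it only coarsens them. These facts drive the comparison of the four
  resolutions of two crossings.\<close>

lemma surgery_cases:
  assumes Z: "partition_on E Z" and Z': "partition_on E Z'" and pq: "p \<in> E" "q \<in> E"
    and s: "surgery p q Z Z'"
  shows surgery_refines: "same_block Z p q \<Longrightarrow> same_block Z' a b \<Longrightarrow> same_block Z a b"
    and surgery_coarsens: "\<not> same_block Z p q \<Longrightarrow> same_block Z a b \<Longrightarrow> same_block Z' a b"
    and surgery_joins: "\<not> same_block Z p q \<Longrightarrow> same_block Z' p q"
    and surgery_join_cases: "\<not> same_block Z p q \<Longrightarrow> same_block Z' a b \<Longrightarrow> same_block Z a b \<or>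
      (same_block Z a p \<and> same_block Z b q) \<or> (same_block Z a q \<and> same_block Z b p)"
    and surgery_iff: "same_block Z p q \<Longrightarrow> same_block Z' p q \<Longrightarrow> Z = Z'"
proof -
  have refl: "same_block Z p p" "same_block Z q q" "same_block Z' p p" "same_block Z' q q"
    using same_block_equiv(1)[OF Z] same_block_equiv(1)[OF Z'] pq by auto
  have joined: "same_block Z2 p q" if "merges p q Z1 Z2" "same_block Z1 p p" "same_block Z1 q q" for Z1 Z2
    using that by (auto simp: merges_def)
  show "same_block Z p q \<Longrightarrow> same_block Z' a b \<Longrightarrow> same_block Z a b"
    using s by (auto simp: surgery_def merges_def)
  show "\<not> same_block Z p q \<Longrightarrow> same_block Z a b \<Longrightarrow> same_block Z' a b"
    and "\<not> same_block Z p q \<Longrightarrow> same_block Z' p q"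
    and "\<not> same_block Z p q \<Longrightarrow> same_block Z' a b \<Longrightarrow> same_block Z a b \<or>
      (same_block Z a p \<and> same_block Z b q) \<or> (same_block Z a q \<and> same_block Z b p)"
    using s joined[of Z' Z] refl unfolding surgery_def merges_def by blast+
  show "same_block Z p q \<Longrightarrow> same_block Z' p q \<Longrightarrow> Z = Z'"
    using s by (auto simp: surgery_def merges_def)
qed

text \<open>The sum \<open>x_p + x_q\<close>: the image of the unit under a split and, by
  neck-cutting, the value of a tube.\<close>

definition dots :: "'e set set \<Rightarrow> 'e \<Rightarrow> 'e \<Rightarrow> ('e set set \<Rightarrow> 'r::comm_ring_1) \<Rightarrow> 'e set set \<Rightarrow> 'r" where
  "dots Z p q f = (\<lambda>T. dot Z p f T + dot Z q f T)"

lemma linear_op_dots: "linear_op (dots Z p q)"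
  unfolding dots_def by (intro linear_op_add linear_op_dot)

lemma dots_same_block:
  fixes f :: "'e set set \<Rightarrow> 'r::comm_ring_1"
  assumes "partition_on E Z" "same_block Z p q" and char: "\<And>r::'r. r + r = 0"
  shows "dots Z p q f = (\<lambda>T. 0)"
  using dot_same_block[OF assms(1,2), of f] char by (simp add: dots_def)

lemma dots_commute:
  assumes "partition_on E Z" "p \<in> E" "q \<in> E" "p' \<in> E" "q' \<in> E"
  shows "dots Z p q (dots Z p' q' f) = dots Z p' q' (dots Z p q f)"
  unfolding dots_def dot_add by (simp add: assms dot_commute[OF assms(1)] algebra_simps)

lemma dot_dots:
  assumes "partition_on E Z" "p \<in> E" "q \<in> E" "e \<in> E"
  shows "dot Z e (dots Z p q f) = dots Z p q (dot Z e f)"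
  unfolding dots_def dot_add by (simp add: assms dot_commute[OF assms(1)] algebra_simps)

text \<open>The square of each dot vanishes and the mixed product occurs twice.\<close>

lemma dots_dots:
  fixes f :: "'e set set \<Rightarrow> 'r::comm_ring_1"
  assumes "partition_on E Z" "p \<in> E" "q \<in> E" and char: "\<And>r::'r. r + r = 0"
  shows "dots Z p q (dots Z p q f) = (\<lambda>T. 0)"
  unfolding dots_def dot_add
  by (simp add: assms dot_commute[OF assms(1-3)] dot_dot[OF assms(1)] fun_eq_iff)

lemma saddle_dots:
  assumes "finite Z" "partition_on E Z" "partition_on E Z'" "p \<in> E" "q \<in> E" "surgery p q Z Z'"
    and "p' \<in> E" "q' \<in> E"
  shows "saddle Z Z' (dots Z p' q' f) = dots Z' p' q' (saddle Z Z' f)"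
  unfolding dots_def saddle_add by (simp add: saddle_dot[OF assms(1-6)] assms(7,8))

text \<open>Each saddle contributes the sum of the dots at its ends if these share a circle at that
  stage, and 1 otherwise; the first factor slides through the second saddle.\<close>

lemma saddle_saddle_unit:
  assumes fin: "finite E"
    and Z: "partition_on E Z" "partition_on E Z1" "partition_on E Z2"
    and E: "p \<in> E" "q \<in> E" "p' \<in> E" "q' \<in> E"
    and s: "surgery p q Z Z1" "surgery p' q' Z1 Z2" and char: "\<And>r::'r::comm_ring_1. r + r = 0"
  shows "saddle Z1 Z2 (saddle Z Z1 (unit :: 'e set set \<Rightarrow> 'r)) =
    (let u = if same_block Z1 p' q' then dots Z2 p' q' unit else unit
     in if same_block Z p q then dots Z2 p q u else u)"
  by (simp add: Let_def saddle_unit[OF finite_elements[OF fin Z(1)] Z(1,2) E(1,2) s(1) char, folded dots_def]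
    saddle_unit[OF finite_elements[OF fin Z(2)] Z(2,3) E(3,4) s(2) char, folded dots_def]
    saddle_dots[OF finite_elements[OF fin Z(2)] Z(2,3) E(3,4) s(2) E(1,2)])

text \<open>Two saddles in either order. The first digit of an index tells whether the one at
  \<open>p\<close>, \<open>q\<close> has been performed, the second digit does so for
  \<open>p'\<close>, \<open>q'\<close>.\<close>

locale saddle_square =
  fixes E :: "'e set" and p q p' q' Z00 Z10 Z01 Z11
  assumes fin: "finite E" and E: "p \<in> E" "q \<in> E" "p' \<in> E" "q' \<in> E"
    and Z: "partition_on E Z00" "partition_on E Z10" "partition_on E Z01" "partition_on E Z11"
    and s: "surgery p q Z00 Z10" "surgery p' q' Z00 Z01" "surgery p q Z01 Z11" "surgery p' q' Z10 Z11"
begin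

lemma flip: "saddle_square E p' q' p q Z00 Z01 Z10 Z11"
  by unfold_locales (use fin E Z s in auto)

text \<open>A saddle between ends of one circle only refines the circles, so it cannot bring
  \<open>p'\<close> and \<open>q'\<close> together.\<close>

lemma no_split_merge: "same_block Z00 p q \<Longrightarrow> same_block Z10 p' q' \<Longrightarrow> same_block Z00 p' q'"
  by (rule surgery_refines[OF Z(1,2) E(1,2) s(1)])

text \<open>If the saddle at \<open>p'\<close>, \<open>q'\<close> joined \<open>p\<close> to
  \<open>q\<close>, then \<open>p\<close> and \<open>q\<close> would lie on the circles through
  \<open>p'\<close> and \<open>q'\<close>, one on each. Joining \<open>p\<close> to \<open>q\<close>
  first would then already join \<open>p'\<close> to \<open>q'\<close>.\<close>

lemma merge_merge:
  assumes "\<not> same_block Z00 p q" "\<not> same_block Z10 p' q'"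
  shows "\<not> same_block Z00 p' q' \<and> \<not> same_block Z01 p q"
proof
  show a': "\<not> same_block Z00 p' q'"
    using assms surgery_coarsens[OF Z(1,2) E(1,2) s(1)] by blast
  show "\<not> same_block Z01 p q"
  proof
    assume "same_block Z01 p q"
    then have "same_block Z00 p p' \<and> same_block Z00 q q' \<or> same_block Z00 p q' \<and> same_block Z00 q p'"
      using surgery_join_cases[OF Z(1,3) E(3,4) s(2) a'] assms(1) by blast
    then have "same_block Z10 p p' \<and> same_block Z10 q q' \<or> same_block Z10 p q' \<and> same_block Z10 q p'"
      using surgery_coarsens[OF Z(1,2) E(1,2) s(1) assms(1)] by blast
    then have "same_block Z10 p' q'"
      using surgery_joins[OF Z(1,2) E(1,2) s(1) assms(1)] same_block_equiv(2,3)[OF Z(2)] by blast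
    then show False using assms by simp
  qed
qed

text \<open>The saddle at \<open>p'\<close>, \<open>q'\<close> separates \<open>p\<close> from
  \<open>q\<close>, and the next one joins them again. As both pairs share a circle in the end, both
  sums of dots vanish there in characteristic 2.\<close>

lemma split_split_merge:
  assumes "same_block Z00 p q" "same_block Z00 p' q'" "\<not> same_block Z01 p q"
  shows "same_block Z11 p q" "same_block Z11 p' q'"
proof -
  show pq: "same_block Z11 p q"
    by (rule surgery_joins[OF Z(3,4) E(1,2) s(3) assms(3)])
  have co: "same_block Z01 a b \<Longrightarrow> same_block Z11 a b" for a b
    by (rule surgery_coarsens[OF Z(3,4) E(1,2) s(3) assms(3)])
  show "same_block Z11 p' q'"
  proof (cases "same_block Z01 p' q'")
    case False
    \<comment> \<open>Undoing the saddle at \<open>p'\<close>, \<open>q'\<close> joins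
      \<open>p\<close> to \<open>q\<close>, so each of these shares a circle of \<open>Z01\<close>
      with one of \<open>p'\<close>, \<open>q'\<close>. Joining \<open>p\<close> to \<open>q\<close>
      therefore joins \<open>p'\<close> to \<open>q'\<close>.\<close>
    note j = surgery_join_cases[OF Z(3,1) E(3,4) surgery_sym[OF s(2)] False]
    have "same_block Z01 p p' \<and> same_block Z01 q q' \<or> same_block Z01 p q' \<and> same_block Z01 q p'"
      using j[OF assms(1)] assms(3) by blast
    then show ?thesis using co pq same_block_equiv(2,3)[OF Z(4)] by blast
  qed (rule co)
qed

text \<open>Both saddles run between the same two circles. A merge followed by a genuine split
  leaves two circles, each containing one end of each saddle.\<close>

lemma merge_split_blocks:
  assumes "\<not> same_block Z00 p q" "\<not> same_block Z00 p' q'" "same_block Z10 p' q'" "same_block Z01 p q"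
    and ne: "\<not> same_block Z11 p q"
  shows "same_block Z11 p p' \<and> same_block Z11 q q' \<or> same_block Z11 p q' \<and> same_block Z11 q p'"
proof -
  have "\<not> same_block Z11 p' q'"
  proof
    assume "same_block Z11 p' q'"
    \<comment> \<open>A saddle whose ends share a circle before and after changes nothing, but
      \<open>p\<close> and \<open>q\<close> share a circle of \<open>Z10\<close> and none of
      \<open>Z11\<close>.\<close>
    then have "Z10 = Z11" by (rule surgery_iff[OF Z(2,4) E(3,4) s(4) assms(3)])
    then show False using surgery_joins[OF Z(1,2) E(1,2) s(1) assms(1)] ne by simp
  qed
  moreover have "same_block Z01 p' q'" by (rule surgery_joins[OF Z(1,3) E(3,4) s(2) assms(2)])
  ultimately show ?thesis
    using surgery_join_cases[OF Z(4,3) E(1,2) surgery_sym[OF s(3)] ne, of p' q']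
      same_block_equiv(2)[OF Z(4)] by blast
qed

lemma merge_split_dots:
  fixes f :: "'e set set \<Rightarrow> 'r::comm_ring_1"
  assumes "\<not> same_block Z00 p q" "\<not> same_block Z00 p' q'" "same_block Z10 p' q'" "same_block Z01 p q"
    and ne: "\<not> same_block Z11 p q"
  shows "dots Z11 p q f = dots Z11 p' q' f"
  using merge_split_blocks[OF assms]
proof (elim disjE conjE)
  assume "same_block Z11 p p'" "same_block Z11 q q'"
  then show ?thesis by (simp add: dots_def dot_same_block[OF Z(4)])
next
  assume "same_block Z11 p q'" "same_block Z11 q p'"
  then show ?thesis by (simp add: dots_def dot_same_block[OF Z(4)] add.commute)
qed

text \<open>Each composite is a product of sums of two dots, one for every saddle whose ends share a
  circle when it is performed. Refinement and coarsening leave six patterns for which saddles these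
  are.\<close>

lemma saddle_commute_unit:
  assumes char: "\<And>r::'r::comm_ring_1. r + r = 0"
  shows "saddle Z10 Z11 (saddle Z00 Z10 (unit :: 'e set set \<Rightarrow> 'r)) = saddle Z01 Z11 (saddle Z00 Z01 unit)"
proof -
  interpret flip: saddle_square E p' q' p q Z00 Z01 Z10 Z11 by (rule flip)
  note 1 = saddle_saddle_unit[OF fin Z(1,2,4) E(1-4) s(1,4) char]
  note 2 = saddle_saddle_unit[OF fin Z(1,3,4) E(3,4,1,2) s(2,3) char]
  have z: "dots Z11 p q f = (\<lambda>T. 0)" if "same_block Z11 p q" for f :: "'e set set \<Rightarrow> 'r"
    by (rule dots_same_block[OF Z(4) that char])
  have z': "dots Z11 p' q' f = (\<lambda>T. 0)" if "same_block Z11 p' q'" for f :: "'e set set \<Rightarrow> 'r"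
    by (rule dots_same_block[OF Z(4) that char])
  have z0: "dots Z11 a b (\<lambda>T. 0) = (\<lambda>T. 0 :: 'r)" for a b
    by (rule linear_op_zero[OF linear_op_dots])
  note if_simps = if_True if_False simp_thms
  consider
    "same_block Z00 p q" "same_block Z00 p' q'" "same_block Z10 p' q'" "same_block Z01 p q"
    | "same_block Z00 p q" "same_block Z00 p' q'" "\<not> (same_block Z10 p' q' \<and> same_block Z01 p q)"
    | "same_block Z00 p q" "\<not> same_block Z00 p' q'" "\<not> same_block Z10 p' q'" "same_block Z01 p q"
    | "\<not> same_block Z00 p q" "same_block Z00 p' q'" "same_block Z10 p' q'" "\<not> same_block Z01 p q"
    | "\<not> same_block Z00 p q" "\<not> same_block Z00 p' q'" "same_block Z10 p' q'" "same_block Z01 p q"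
    | "\<not> same_block Z00 p q" "\<not> same_block Z00 p' q'" "\<not> same_block Z10 p' q'" "\<not> same_block Z01 p q"
    using no_split_merge merge_merge flip.no_split_merge flip.merge_merge by blast
  then show ?thesis
  proof cases
    case c: 1
    show ?thesis unfolding 1 2 Let_def by (simp only: c if_simps dots_commute[OF Z(4) E(1-4)])
  next
    \<comment> \<open>In either order the factor of the first saddle is zero on \<open>Z11\<close>,
      since its ends share a circle there.\<close>
    case c: 2
    then have "same_block Z11 p q \<and> same_block Z11 p' q'"
      using split_split_merge flip.split_split_merge by blast
    then show ?thesis unfolding 1 2 Let_def using c by (simp only: if_simps z z' split: if_split)
  next
    \<comment> \<open>A merge comes first in either order. The factors \<open>x_p + x_q\<close> and
      \<open>x_p' + x_q'\<close> agree, because the ends lie pairwise on the same circles of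
      \<open>Z11\<close> or both sums vanish.\<close>
    case c: 5
    have "dots Z11 p q unit = dots Z11 p' q' (unit :: 'e set set \<Rightarrow> 'r)"
    proof (cases "same_block Z11 p q \<and> same_block Z11 p' q'")
      case True
      then show ?thesis by (simp only: z z')
    next
      case False
      then show ?thesis
        by (metis merge_split_dots[OF c] flip.merge_split_dots[OF c(2,1,4,3)])
    qed
    then show ?thesis unfolding 1 2 Let_def by (simp only: c if_simps)
  \<comment> \<open>In the remaining patterns the same pair of ends contributes a factor in both
    orders, or none does.\<close>
  qed (unfold 1 2 Let_def, simp_all only: if_simps)
qed

lemma saddle_commute:
  fixes f :: "'e set set \<Rightarrow> 'r::comm_ring_1"
  assumes char: "\<And>r::'r. r + r = 0" and supp: "\<And>S. \<not> S \<subseteq> Z00 \<Longrightarrow> f S = 0"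
  shows "saddle Z10 Z11 (saddle Z00 Z10 f) = saddle Z01 Z11 (saddle Z00 Z01 f)"
proof (rule dot_linear_eqI[OF finite_elements[OF fin Z(1)] Z(1), where f = f and Z' = Z11])
  note zf = finite_elements[OF fin]
  note d = saddle_dot[OF zf[OF Z(1)] Z(1,2) E(1,2) s(1)] saddle_dot[OF zf[OF Z(1)] Z(1,3) E(3,4) s(2)]
    saddle_dot[OF zf[OF Z(3)] Z(3,4) E(1,2) s(3)] saddle_dot[OF zf[OF Z(2)] Z(2,4) E(3,4) s(4)]
  show "linear_op (\<lambda>f. saddle Z10 Z11 (saddle Z00 Z10 f))" "linear_op (\<lambda>f. saddle Z01 Z11 (saddle Z00 Z01 f))"
    by (rule linear_op_comp[OF linear_op_saddle linear_op_saddle])+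
  show "saddle Z10 Z11 (saddle Z00 Z10 unit) = saddle Z01 Z11 (saddle Z00 Z01 (unit :: 'e set set \<Rightarrow> 'r))"
    by (rule saddle_commute_unit[OF char])
  fix e and g :: "'e set set \<Rightarrow> 'r" assume "e \<in> E"
  then show "saddle Z10 Z11 (saddle Z00 Z10 (dot Z00 e g)) = dot Z11 e (saddle Z10 Z11 (saddle Z00 Z10 g))"
    "saddle Z01 Z11 (saddle Z00 Z01 (dot Z00 e g)) = dot Z11 e (saddle Z01 Z11 (saddle Z00 Z01 g))"
    by (simp_all add: d)
qed (rule supp)

end

text \<open>A saddle followed by the reverse saddle is a tube, to which the neck-cutting relation
  applies.\<close>

lemma saddle_reverse:
  fixes f :: "'e set set \<Rightarrow> 'r::comm_ring_1"
  assumes fin: "finite E" and Z: "partition_on E Z" "partition_on E Z'" and E: "p \<in> E" "q \<in> E"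
    and s: "surgery p q Z Z'" and char: "\<And>r::'r. r + r = 0" and supp: "\<And>S. \<not> S \<subseteq> Z \<Longrightarrow> f S = 0"
  shows "saddle Z' Z (saddle Z Z' f) = dots Z p q f"
proof (rule dot_linear_eqI[OF finite_elements[OF fin Z(1)] Z(1), where f = f and Z' = Z])
  note zf = finite_elements[OF fin]
  note d = saddle_dot[OF zf[OF Z(1)] Z(1,2) E(1,2) s(1)] saddle_dot[OF zf[OF Z(2)] Z(2,1) E(1,2) surgery_sym[OF s(1)]]
  show "linear_op (\<lambda>f. saddle Z' Z (saddle Z Z' f))" "linear_op (dots Z p q)"
    by (rule linear_op_comp[OF linear_op_saddle linear_op_saddle], rule linear_op_dots)
  show "saddle Z' Z (saddle Z Z' unit) = dots Z p q (unit :: 'e set set \<Rightarrow> 'r)"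
    \<comment> \<open>If the circles change, exactly one of the two saddles is a split and
      contributes \<open>x_p + x_q\<close>. If they do not, both sides vanish.\<close>
    unfolding saddle_saddle_unit[OF fin Z Z(1) E E s surgery_sym[OF s] char] Let_def
    using dots_dots[OF Z(1) E char] dots_same_block[OF Z(1) _ char, of p q]
      surgery_joins[OF Z E s] by auto
  fix e and g :: "'e set set \<Rightarrow> 'r" assume "e \<in> E"
  then show "saddle Z' Z (saddle Z Z' (dot Z e g)) = dot Z e (saddle Z' Z (saddle Z Z' g))"
    "dots Z p q (dot Z e g) = dot Z e (dots Z p q g)"
    by (simp_all add: d dot_dots[OF Z(1) E])
qed (rule supp)

text \<open>After a merge \<open>p\<close> and \<open>q\<close> share a circle, so
  \<open>x_p + x_q = 2 x = 0\<close>. A split of the unit already gives \<open>x_p + x_q\<close>,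
  whose square is zero.\<close>

lemma dots_saddle:
  fixes f :: "'e set set \<Rightarrow> 'r::comm_ring_1"
  assumes fin: "finite E" and Z: "partition_on E Z" "partition_on E Z'" and E: "p \<in> E" "q \<in> E"
    and s: "surgery p q Z Z'" and char: "\<And>r::'r. r + r = 0" and supp: "\<And>S. \<not> S \<subseteq> Z \<Longrightarrow> f S = 0"
  shows "dots Z' p q (saddle Z Z' f) = (\<lambda>T. 0)"
proof (rule dot_linear_eqI[OF finite_elements[OF fin Z(1)] Z(1), where f = f and Z' = Z'
    and G = "\<lambda>f T. 0"])
  note zf = finite_elements[OF fin]
  note d = saddle_dot[OF zf[OF Z(1)] Z(1,2) E(1,2) s(1)]
  show "linear_op (\<lambda>f. dots Z' p q (saddle Z Z' f))"
    by (rule linear_op_comp[OF linear_op_dots linear_op_saddle])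
  show "linear_op (\<lambda>f T. 0)" by (simp add: linear_op_def)
  show "dots Z' p q (saddle Z Z' unit) = (\<lambda>T. 0 :: 'r)"
    unfolding saddle_unit[OF zf[OF Z(1)] Z E s char]
    using dots_dots[OF Z(2) E char] dots_same_block[OF Z(2) _ char, of p q]
      surgery_joins[OF Z E s] by (auto simp flip: dots_def)
  fix e and g :: "'e set set \<Rightarrow> 'r" assume "e \<in> E"
  then show "dots Z' p q (saddle Z Z' (dot Z e g)) = dot Z' e (dots Z' p q (saddle Z Z' g))"
    "(\<lambda>T. 0) = dot Z' e (\<lambda>T. 0 :: 'r)"
    by (simp_all add: d dot_dots[OF Z(2) E] linear_op_zero[OF linear_op_dot])
qed (rule supp)

section \<open>Circles of a resolution\<close>

abbreviation gen_equiv :: "('a \<times> 'a) set \<Rightarrow> ('a \<times> 'a) set" where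
  "gen_equiv r \<equiv> (r \<union> r\<inverse>)\<^sup>*"

lemma gen_equiv_sym: "(a, b) \<in> gen_equiv r \<Longrightarrow> (b, a) \<in> gen_equiv r"
  using sym_rtrancl[OF sym_Un_converse[of r]] by (rule symD)

lemma gen_equiv_subset: "r \<subseteq> gen_equiv r' \<Longrightarrow> gen_equiv r \<subseteq> gen_equiv r'"
proof -
  assume "r \<subseteq> gen_equiv r'"
  then have "r \<union> r\<inverse> \<subseteq> gen_equiv r'" by (auto intro: gen_equiv_sym[of _ _ r'])
  then show ?thesis using rtrancl_subset_rtrancl by blast
qed

lemma gen_equiv_restrict:
  assumes "r \<subseteq> A \<times> A" "(a, b) \<in> gen_equiv r" "a \<in> A"
  shows "b \<in> A"
  using assms(2,3) by (induction rule: rtrancl_induct) (use assms(1) in auto)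

text \<open>\<open>gen_classes\<close> divides by a relation that is reflexive on the whole type;
  restricted to \<open>A\<close> it is an equivalence on \<open>A\<close> with the same
  classes.\<close>

lemma
  assumes r: "r \<subseteq> A \<times> A"
  shows partition_on_gen_classes: "partition_on A (gen_classes A r)"
    and same_block_gen_classes: "same_block (gen_classes A r) a b \<longleftrightarrow> a \<in> A \<and> (a, b) \<in> gen_equiv r"
proof -
  let ?R = "gen_equiv r \<inter> A \<times> A"
  have "equiv A ?R"
  proof (rule equivI)
    show "refl_on A ?R" by (auto simp: refl_on_def)
    show "sym ?R" using gen_equiv_sym by (auto simp: sym_def)
    show "trans ?R" by (auto simp: trans_def intro: rtrancl_trans)
  qed auto
  moreover have eq: "gen_classes A r = A // ?R"
    using gen_equiv_restrict[OF r] unfolding gen_classes_def quotient_def by auto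
  ultimately show p: "partition_on A (gen_classes A r)" by (simp add: partition_on_quotient)
  show "same_block (gen_classes A r) a b \<longleftrightarrow> a \<in> A \<and> (a, b) \<in> gen_equiv r"
  proof
    assume "same_block (gen_classes A r) a b"
    then obtain x where x: "x \<in> A" "(x, a) \<in> gen_equiv r" "(x, b) \<in> gen_equiv r"
      by (auto simp: same_block_def gen_classes_def quotient_def)
    then show "a \<in> A \<and> (a, b) \<in> gen_equiv r"
      using gen_equiv_restrict[OF r x(2,1)] gen_equiv_sym[OF x(2)] by (meson rtrancl_trans)
  next
    assume "a \<in> A \<and> (a, b) \<in> gen_equiv r"
    then show "same_block (gen_classes A r) a b"
      unfolding same_block_def gen_classes_def by (intro bexI[OF _ quotientI[of a]]) auto
  qed
qed

text \<open>The parity hypothesis on \<open>G\<close> holds for the rest of a diagram outside a crossing with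
  ends \<open>p\<close>, \<open>y\<close>, \<open>q\<close>, \<open>z\<close>: every arc there has two ends.\<close>

lemma gen_equiv_merge:
  assumes parity: "\<And>K. (\<And>x y. (x, y) \<in> G \<Longrightarrow> x \<in> K \<longleftrightarrow> y \<in> K) \<Longrightarrow>
      even (of_bool (p \<in> K) + of_bool (y \<in> K) + of_bool (q \<in> K) + of_bool (z \<in> K) :: nat)"
    and ne: "(p, q) \<notin> gen_equiv (G \<union> {(p, y), (z, q)})" (is "_ \<notin> ?R")
  shows "(a, b) \<in> gen_equiv (G \<union> {(p, z), (y, q)}) \<longleftrightarrow>
    (a, b) \<in> ?R \<or> ((a, p) \<in> ?R \<and> (b, q) \<in> ?R) \<or> ((a, q) \<in> ?R \<and> (b, p) \<in> ?R)" (is "_ \<in> ?R' \<longleftrightarrow> ?M a b")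
proof -
  have GR: "gen_equiv G \<subseteq> ?R" by (intro gen_equiv_subset) auto
  have sym: "(v, u) \<in> ?R" if "(u, v) \<in> ?R" for u v using that by (rule gen_equiv_sym)
  have tr: "(u, w) \<in> ?R" if "(u, v) \<in> ?R" "(v, w) \<in> ?R" for u v w
    using that by (rule rtrancl_trans)
  have arcs: "(p, y) \<in> ?R" "(z, q) \<in> ?R" by auto
  have closed: "x \<in> gen_equiv G `` {t} \<longleftrightarrow> x' \<in> gen_equiv G `` {t}" if "(x, x') \<in> G" for x x' t
    using that by (auto intro: rtrancl_into_rtrancl)
  \<comment> \<open>Take for \<open>K\<close> the class of \<open>p\<close> in \<open>G\<close>. It
    contains neither \<open>q\<close> nor \<open>z\<close>, either of which would connect
    \<open>p\<close> to \<open>q\<close> in \<open>?R\<close>, so parity forces \<open>y\<close>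
    into it: the circle through \<open>p\<close> closes up outside the crossing.\<close>
  have "q \<notin> gen_equiv G `` {p}" "z \<notin> gen_equiv G `` {p}"
    using ne GR arcs tr by blast+
  then have py: "(p, y) \<in> gen_equiv G"
    using parity[of "gen_equiv G `` {p}", OF closed] by (cases "y \<in> gen_equiv G `` {p}") auto
  have "p \<notin> gen_equiv G `` {q}" "y \<notin> gen_equiv G `` {q}"
    using ne GR arcs tr sym by blast+
  then have qz: "(q, z) \<in> gen_equiv G"
    using parity[of "gen_equiv G `` {q}", OF closed] by (cases "z \<in> gen_equiv G `` {q}") auto
  \<comment> \<open>Both arcs of \<open>?R\<close> connect points already connected in
    \<open>G\<close>. Replacing them by the arcs of \<open>?R'\<close> thus loses nothing and adds
    the connection from \<open>p\<close> to \<open>q\<close>.\<close>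
  have "?R \<subseteq> gen_equiv G"
    using py gen_equiv_sym[OF qz] by (intro gen_equiv_subset) auto
  moreover have "gen_equiv G \<subseteq> ?R'" by (intro gen_equiv_subset) auto
  ultimately have sub: "?R \<subseteq> ?R'" by blast
  have "(p, z) \<in> ?R'" by auto
  then have pq: "(p, q) \<in> ?R'" using sub arcs(2) by (meson rtrancl_trans subsetD)
  have "?M a b" if "(a, b) \<in> ?R'"
    using that
  proof (induction rule: rtrancl_induct)
    case (step b c)
    have cases: "(b, c) \<in> ?R \<or> (b, p) \<in> ?R \<and> (c, q) \<in> ?R \<or> (b, q) \<in> ?R \<and> (c, p) \<in> ?R"
    proof -
      have "(b, c) \<in> G \<or> (c, b) \<in> G \<Longrightarrow> (b, c) \<in> ?R" by auto
      moreover have "(p, p) \<in> ?R" "(q, q) \<in> ?R" "(y, p) \<in> ?R" using sym arcs by auto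
      ultimately show ?thesis using step(2) arcs by auto
    qed
    from step(3) cases show ?case by (elim disjE conjE) (meson tr sym)+
  qed auto
  moreover have "(a, b) \<in> ?R'" if "?M a b"
  proof -
    have sub': "(u, v) \<in> ?R'" "(v, u) \<in> ?R'" if "(u, v) \<in> ?R" for u v
      using subsetD[OF sub that] gen_equiv_sym[OF subsetD[OF sub that]] by auto
    have qp: "(q, p) \<in> ?R'" by (rule gen_equiv_sym[OF pq])
    have tr': "(u, x) \<in> ?R'" if "(u, v) \<in> ?R'" "(v, w) \<in> ?R'" "(w, x) \<in> ?R'" for u v w x
      using that rtrancl_trans by metis
    from that show ?thesis
    proof (elim disjE conjE)
      assume "(a, p) \<in> ?R" "(b, q) \<in> ?R"
      then show ?thesis using sub' pq tr'[of a p q b] by simp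
    next
      assume "(a, q) \<in> ?R" "(b, p) \<in> ?R"
      then show ?thesis using sub' qp tr'[of a q p b] by simp
    qed (use sub' in simp)
  qed
  ultimately show ?thesis by blast
qed

text \<open>The set \<open>U\<close> allows one crossing to be left out, so that its two resolutions
  are compared over the same remainder.\<close>

definition arcs :: "('c, 'e) diagram \<Rightarrow> 'c set \<Rightarrow> 'c set \<Rightarrow> ('e \<times> 'e) set" where
  "arcs D U I = {(edge_at D c s, edge_at D c t) | c s t. c \<in> U \<and> (s, t) \<in> resolution D I c}"

lemma circles_arcs: "circles D I = gen_classes (edges D) (arcs D (crossings D) I)"
  by (simp add: circles_def arcs_def)

text \<open>The sign only decides which smoothing is called oriented. In terms of the numbered ends,
  the source of the saddle is the same smoothing at positive and negative crossings.\<close>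

lemma resolution_eq: "resolution D I c = (if c \<in> I then {(0, 3), (1, 2)} else {(0, 1), (3, 2)})"
  by (auto simp: resolution_def oriented_resolution_def other_resolution_def)

lemma arcs_insert:
  "arcs D (insert c U) I = arcs D U I \<union> (if c \<in> I
    then {(edge_at D c 0, edge_at D c 3), (edge_at D c 1, edge_at D c 2)}
    else {(edge_at D c 0, edge_at D c 1), (edge_at D c 3, edge_at D c 2)})"
  unfolding arcs_def resolution_eq by auto

lemma arcs_cong: "(\<And>c. c \<in> U \<Longrightarrow> c \<in> I \<longleftrightarrow> c \<in> J) \<Longrightarrow> arcs D U I = arcs D U J"
  unfolding arcs_def resolution_eq by auto

lemma edge_at_edges:
  assumes "link_diagram D" "c \<in> crossings D" "s < 4"
  shows "edge_at D c s \<in> edges D"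
proof -
  have "s \<in> {0, 1, 2, 3}" using assms(3) by auto
  then have "(c, s) \<in> in_ends D \<or> (c, s) \<in> out_ends D"
    using assms(2) by (auto simp: in_ends_def out_ends_def)
  moreover have "edge_at D c s = case_prod (edge_at D) (c, s)" by simp
  ultimately have "edge_at D c s \<in> case_prod (edge_at D) ` in_ends D \<union> case_prod (edge_at D) ` out_ends D"
    by (metis UnCI imageI)
  then have "edge_at D c s \<in> case_prod (edge_at D) ` in_ends D"
    using assms(1) unfolding link_diagram_def by blast
  then show ?thesis using assms(1) unfolding link_diagram_def by blast
qed

lemma arcs_subset:
  assumes "link_diagram D"
  shows "arcs D (crossings D) I \<subseteq> edges D \<times> edges D"
  using edge_at_edges[OF assms] by (auto simp: arcs_def resolution_eq split: if_splits)

lemma circles_partition: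
  assumes "link_diagram D"
  shows "partition_on (edges D) (circles D I)"
  unfolding circles_arcs by (rule partition_on_gen_classes[OF arcs_subset[OF assms]])

lemma same_circle_iff:
  assumes "link_diagram D"
  shows "same_block (circles D I) a b \<longleftrightarrow> a \<in> edges D \<and> (a, b) \<in> gen_equiv (arcs D (crossings D) I)"
  unfolding circles_arcs by (rule same_block_gen_classes[OF arcs_subset[OF assms]])

text \<open>Each edge that meets a crossing has one incoming and one outgoing end, and each crossing other
  than \<open>c\<close> contributes its ends in pairs.\<close>

lemma ends_parity:
  assumes D: "link_diagram D" and c: "c \<in> crossings D"
    and K: "\<And>x y. (x, y) \<in> arcs D (crossings D - {c}) I \<Longrightarrow> x \<in> K \<longleftrightarrow> y \<in> K"
  shows "even (of_bool (edge_at D c 0 \<in> K) + of_bool (edge_at D c 1 \<in> K)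
    + of_bool (edge_at D c 2 \<in> K) + of_bool (edge_at D c 3 \<in> K) :: nat)"
proof -
  define h :: "'a \<Rightarrow> nat \<Rightarrow> nat" where "h c s = of_bool (edge_at D c s \<in> K)" for c s
  define n where "n c = h c 0 + h c 1 + h c 2 + h c 3" for c
  have fin: "finite (crossings D)" and inj: "inj_on (case_prod (edge_at D)) (in_ends D)"
    "inj_on (case_prod (edge_at D)) (out_ends D)"
    and img: "case_prod (edge_at D) ` in_ends D = case_prod (edge_at D) ` out_ends D"
    using D by (auto simp: link_diagram_def)
  have "(\<Sum>(c, s)\<in>in_ends D. h c s) = (\<Sum>e\<in>case_prod (edge_at D) ` in_ends D. of_bool (e \<in> K))"
    by (subst sum.reindex[OF inj(1)]) (auto simp: h_def intro!: sum.cong)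
  also have "\<dots> = (\<Sum>(c, s)\<in>out_ends D. h c s)"
    unfolding img by (subst sum.reindex[OF inj(2)]) (auto simp: h_def intro!: sum.cong)
  finally have "even ((\<Sum>(c, s)\<in>in_ends D. h c s) + (\<Sum>(c, s)\<in>out_ends D. h c s))" by simp
  moreover have "(\<Sum>(c, s)\<in>in_ends D. h c s) = (\<Sum>c\<in>crossings D. h c 0 + (if positive D c then h c 3 else h c 1))"
    unfolding in_ends_def by (subst sum.Sigma[symmetric]) (auto simp: fin intro!: sum.cong)
  moreover have "(\<Sum>(c, s)\<in>out_ends D. h c s) = (\<Sum>c\<in>crossings D. h c 2 + (if positive D c then h c 1 else h c 3))"
    unfolding out_ends_def by (subst sum.Sigma[symmetric]) (auto simp: fin intro!: sum.cong)
  ultimately have "even (\<Sum>c\<in>crossings D. n c)"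
    unfolding n_def by (simp add: sum.distrib[symmetric] algebra_simps if_distrib cong: if_cong)
  moreover have "(\<Sum>c\<in>crossings D. n c) = n c + (\<Sum>c\<in>crossings D - {c}. n c)"
    by (rule sum.remove[OF fin c])
  moreover have "even (\<Sum>c\<in>crossings D - {c}. n c)"
  proof (rule dvd_sum)
    fix b assume b: "b \<in> crossings D - {c}"
    have "insert b (crossings D - {c}) = crossings D - {c}" using b by auto
    then have "(if b \<in> I
        then {(edge_at D b 0, edge_at D b 3), (edge_at D b 1, edge_at D b 2)}
        else {(edge_at D b 0, edge_at D b 1), (edge_at D b 3, edge_at D b 2)}) \<subseteq>
        arcs D (crossings D - {c}) I"
      using arcs_insert[of D b "crossings D - {c}" I] by (metis Un_upper2)
    then show "even (n b)" using K by (auto simp: n_def h_def split: if_splits)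
  qed
  ultimately show ?thesis by (simp add: n_def h_def)
qed

text \<open>Stands for adding as well as removing \<open>c\<close>, so that a saddle and its reverse
  are treated alike.\<close>

definition toggle :: "'a \<Rightarrow> 'a set \<Rightarrow> 'a set" where
  "toggle c I = (if c \<in> I then I - {c} else insert c I)"

text \<open>One resolution joins end 0 to 1 and 2 to 3, the other 0 to 3 and 2 to 1. Hence
  \<open>gen_equiv_merge\<close> applies with the ends 0 and 2 as \<open>p\<close> and
  \<open>q\<close> whenever one of the resolutions separates them.\<close>

lemma circles_surgery:
  assumes D: "link_diagram D" and c: "c \<in> crossings D"
  shows "surgery (edge_at D c 0) (edge_at D c 2) (circles D I) (circles D (toggle c I))"
proof -
  let ?e = "edge_at D c"
  let ?G = "arcs D (crossings D - {c}) I"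
  let ?P = "\<lambda>y z. ?G \<union> {(?e 0, y), (z, ?e 2)}"
  have ins: "insert c (crossings D - {c}) = crossings D" using c by auto
  have cong: "arcs D (crossings D - {c}) (toggle c I) = ?G"
    by (rule arcs_cong) (auto simp: toggle_def)
  obtain y z where yz: "(y, z) = (?e 1, ?e 3) \<or> (y, z) = (?e 3, ?e 1)"
    and A: "arcs D (crossings D) I = ?P y z" and A': "arcs D (crossings D) (toggle c I) = ?P z y"
  proof (cases "c \<in> I")
    case True
    then show ?thesis
      using cong arcs_insert[of D c "crossings D - {c}", unfolded ins]
      by (intro that[of "?e 3" "?e 1"]) (auto simp: toggle_def)
  next
    case False
    then show ?thesis
      using cong arcs_insert[of D c "crossings D - {c}", unfolded ins]
      by (intro that[of "?e 1" "?e 3"]) (auto simp: toggle_def)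
  qed
  have parity: "even (of_bool (?e 0 \<in> K) + of_bool (y \<in> K) + of_bool (?e 2 \<in> K) + of_bool (z \<in> K) :: nat)"
    and parity': "even (of_bool (?e 0 \<in> K) + of_bool (z \<in> K) + of_bool (?e 2 \<in> K) + of_bool (y \<in> K) :: nat)"
    if "\<And>x y. (x, y) \<in> ?G \<Longrightarrow> x \<in> K \<longleftrightarrow> y \<in> K" for K
    using ends_parity[OF D c that] yz by auto
  have E: "?e 0 \<in> edges D" "?e 2 \<in> edges D" using edge_at_edges[OF D c] by auto
  let ?Z = "circles D I" and ?Z' = "circles D (toggle c I)"
  note Z = circles_partition[OF D, of I] and Z' = circles_partition[OF D, of "toggle c I"]
  have sb: "same_block ?Z a b \<longleftrightarrow> a \<in> edges D \<and> (a, b) \<in> gen_equiv (?P y z)"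
    and sb': "same_block ?Z' a b \<longleftrightarrow> a \<in> edges D \<and> (a, b) \<in> gen_equiv (?P z y)" for a b
    using same_circle_iff[OF D] A A' by auto
  have inE: "a \<in> edges D" if "b \<in> edges D" "(b, a) \<in> gen_equiv (?P y z) \<or> (b, a) \<in> gen_equiv (?P z y)" for a b
    using that gen_equiv_restrict[OF arcs_subset[OF D]] A A' by metis
  consider "\<not> same_block ?Z (?e 0) (?e 2)" | "\<not> same_block ?Z' (?e 0) (?e 2)"
    | "same_block ?Z (?e 0) (?e 2)" "same_block ?Z' (?e 0) (?e 2)" by blast
  then show ?thesis
  proof cases
    case 1
    then have ne: "(?e 0, ?e 2) \<notin> gen_equiv (?P y z)" using sb E by auto
    have m: "(a, b) \<in> gen_equiv (?P z y) \<longleftrightarrow> (a, b) \<in> gen_equiv (?P y z) \<or>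
      ((a, ?e 0) \<in> gen_equiv (?P y z) \<and> (b, ?e 2) \<in> gen_equiv (?P y z)) \<or>
      ((a, ?e 2) \<in> gen_equiv (?P y z) \<and> (b, ?e 0) \<in> gen_equiv (?P y z))" for a b
      by (rule gen_equiv_merge[OF parity ne])
    have bE: "b \<in> edges D" if "(b, t) \<in> gen_equiv (?P y z)" "t \<in> edges D" for b t
      using inE[OF that(2)] gen_equiv_sym[OF that(1)] by blast
    have "same_block ?Z' a b \<longleftrightarrow> same_block ?Z a b \<or>
      (same_block ?Z a (?e 0) \<and> same_block ?Z b (?e 2)) \<or> (same_block ?Z a (?e 2) \<and> same_block ?Z b (?e 0))" for a b
      unfolding sb sb' using m[of a b] bE[of b, OF _ E(1)] bE[of b, OF _ E(2)] by argo
    with 1 have "merges (?e 0) (?e 2) ?Z ?Z'" unfolding merges_def by blast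
    then show ?thesis by (simp add: surgery_def)
  next
    case 2
    then have ne: "(?e 0, ?e 2) \<notin> gen_equiv (?P z y)" using sb' E by auto
    have m: "(a, b) \<in> gen_equiv (?P y z) \<longleftrightarrow> (a, b) \<in> gen_equiv (?P z y) \<or>
      ((a, ?e 0) \<in> gen_equiv (?P z y) \<and> (b, ?e 2) \<in> gen_equiv (?P z y)) \<or>
      ((a, ?e 2) \<in> gen_equiv (?P z y) \<and> (b, ?e 0) \<in> gen_equiv (?P z y))" for a b
      by (rule gen_equiv_merge[OF parity' ne])
    have bE: "b \<in> edges D" if "(b, t) \<in> gen_equiv (?P z y)" "t \<in> edges D" for b t
      using inE[OF that(2)] gen_equiv_sym[OF that(1)] by blast
    have "same_block ?Z a b \<longleftrightarrow> same_block ?Z' a b \<or>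
      (same_block ?Z' a (?e 0) \<and> same_block ?Z' b (?e 2)) \<or> (same_block ?Z' a (?e 2) \<and> same_block ?Z' b (?e 0))" for a b
      unfolding sb sb' using m[of a b] bE[of b, OF _ E(1)] bE[of b, OF _ E(2)] by argo
    with 2 have "merges (?e 0) (?e 2) ?Z' ?Z" unfolding merges_def by blast
    then show ?thesis by (simp add: surgery_def)
  next
    case 3
    \<comment> \<open>Once 0 and 2 are connected, the arcs of one resolution connect all four ends,
      so the arcs of the other one join connected edges.\<close>
    have "gen_equiv (?P y z) \<subseteq> gen_equiv (?P z y)" if "(?e 0, ?e 2) \<in> gen_equiv (?P z y)" for y z
    proof (rule gen_equiv_subset)
      have "(?e 0, z) \<in> gen_equiv (?P z y)" "(y, ?e 2) \<in> gen_equiv (?P z y)" by auto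
      then have "(?e 0, y) \<in> gen_equiv (?P z y)" "(z, ?e 2) \<in> gen_equiv (?P z y)"
        using that gen_equiv_sym by (meson rtrancl_trans)+
      then show "?P y z \<subseteq> gen_equiv (?P z y)" by auto
    qed
    then have "gen_equiv (?P y z) = gen_equiv (?P z y)" using 3 sb sb' by blast
    then have "?Z = ?Z'" unfolding circles_arcs gen_classes_def A A' by simp
    then show ?thesis using 3 by (simp add: surgery_def)
  qed
qed

section \<open>Operators on the twisted complex\<close>

definition supported :: "('c, 'e) diagram \<Rightarrow> ('c set \<times> 'e set set \<Rightarrow> 'r::comm_ring_1) set" where
  "supported D = {f. \<forall>g. g \<notin> generators D \<longrightarrow> f g = 0}"

text \<open>\<open>b\<close> tells whether the target state contains \<open>c\<close>:
  \<open>True\<close> gives the saddle at \<open>c\<close>, \<open>False\<close> the reverse saddle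
  \<open>H\<close>.\<close>

definition edge_map ::
  "('c, 'e) diagram \<Rightarrow> 'c \<Rightarrow> bool \<Rightarrow> ('c set \<times> 'e set set \<Rightarrow> 'r) \<Rightarrow> 'c set \<times> 'e set set \<Rightarrow> 'r::comm_ring_1" where
  "edge_map D c b f = (\<lambda>(J, T). if J \<subseteq> crossings D \<and> (c \<in> J \<longleftrightarrow> b)
    then saddle (circles D (toggle c J)) (circles D J) (\<lambda>S. f (toggle c J, S)) T else 0)"

lemma saddle_map_eq: "saddle_map D c = edge_map D c True"
  by (auto simp: saddle_map_def edge_map_def saddle_def generators_def toggle_def fun_eq_iff)

lemma dot_map_eq:
  "dot_map D e f = (\<lambda>(J, T). if J \<subseteq> crossings D then dot (circles D J) e (\<lambda>S. f (J, S)) T else 0)"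
  by (auto simp: dot_map_def dot_def generators_def fun_eq_iff)

lemma supported_edge_map: "edge_map D c b f \<in> supported D"
  by (auto simp: supported_def edge_map_def saddle_def generators_def)

lemma supported_dot_map: "dot_map D e f \<in> supported D"
  by (auto simp: supported_def dot_map_def)

lemma supported_add: "f \<in> supported D \<Longrightarrow> g \<in> supported D \<Longrightarrow> (\<lambda>x. f x + g x) \<in> supported D"
  by (auto simp: supported_def)

lemma supported_smult: "f \<in> supported D \<Longrightarrow> (\<lambda>x. r * f x) \<in> supported D"
  by (auto simp: supported_def)

lemma supported_slice:
  "f \<in> supported D \<Longrightarrow> \<not> S \<subseteq> circles D J \<Longrightarrow> f (J, S) = 0"
  by (auto simp: supported_def generators_def)

lemma linear_op_edge_map: "linear_op (edge_map D c b)"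
  unfolding linear_op_def edge_map_def
  by (auto simp: fun_eq_iff saddle_def sum.distrib sum_distrib_left algebra_simps)

lemma linear_op_dot_map: "linear_op (dot_map D e)"
  unfolding linear_op_def dot_map_def
  by (auto simp: fun_eq_iff sum.distrib sum_distrib_left)

lemma toggle_toggle: "toggle c (toggle c J) = J"
  by (auto simp: toggle_def)

lemma toggle_commute: "toggle c (toggle c' J) = toggle c' (toggle c J)"
  by (auto simp: toggle_def)

lemma mem_toggle: "c' \<in> toggle c J \<longleftrightarrow> (if c' = c then c \<notin> J else c' \<in> J)"
  by (auto simp: toggle_def)

lemma toggle_subset: "c \<in> U \<Longrightarrow> toggle c J \<subseteq> U \<longleftrightarrow> J \<subseteq> U"
  by (auto simp: toggle_def)

text \<open>Over a fixed state the operators become \<open>saddle\<close> and \<open>dot\<close>, to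
  which the relations proved for partitions apply.\<close>

lemma edge_map_slice:
  "(\<lambda>S. edge_map D c b f (J, S)) = (if J \<subseteq> crossings D \<and> (c \<in> J \<longleftrightarrow> b)
    then saddle (circles D (toggle c J)) (circles D J) (\<lambda>S. f (toggle c J, S)) else (\<lambda>S. 0))"
  by (rule ext) (simp add: edge_map_def)

lemma dot_map_slice:
  "(\<lambda>S. dot_map D e f (J, S)) = (if J \<subseteq> crossings D then dot (circles D J) e (\<lambda>S. f (J, S)) else (\<lambda>S. 0))"
  by (rule ext) (simp add: dot_map_eq)

lemma slice_eqI: "(\<And>J. (\<lambda>S. f (J, S)) = (\<lambda>S. g (J, S))) \<Longrightarrow> f = g"
  by (auto simp: fun_eq_iff)

text \<open>Two steps in the same direction at one crossing do not compose: the outer map reads its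
  value at \<open>toggle c J\<close>, where the inner one is zero.\<close>

lemma edge_map_square: "edge_map D c b (edge_map D c b f) = (\<lambda>g. 0)"
  by (intro slice_eqI) (auto simp: edge_map_slice mem_toggle linear_op_zero[OF linear_op_saddle])

context
  fixes D :: "('c, 'e) diagram"
  assumes D: "link_diagram D"
begin

lemma finite_edges: "finite (edges D)"
  using D by (simp add: link_diagram_def)

lemma finite_crossings: "finite (crossings D)"
  using D by (simp add: link_diagram_def)

lemma finite_circles: "finite (circles D J)"
  by (rule finite_elements[OF finite_edges circles_partition[OF D]])

lemma circles_surgery':
  "c \<in> crossings D \<Longrightarrow>
    surgery (edge_at D c 0) (edge_at D c 2) (circles D (toggle c J)) (circles D J)"
  by (rule surgery_sym[OF circles_surgery[OF D]])

lemma edge_map_dot_map: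
  fixes f :: "'c set \<times> 'e set set \<Rightarrow> 'r::comm_ring_1"
  assumes "c \<in> crossings D" "e \<in> edges D"
  shows "edge_map D c b (dot_map D e f) = dot_map D e (edge_map D c b f)"
proof (rule slice_eqI)
  fix J
  have "saddle (circles D (toggle c J)) (circles D J) (dot (circles D (toggle c J)) e f) =
      dot (circles D J) e (saddle (circles D (toggle c J)) (circles D J) f)" for f :: "'e set set \<Rightarrow> 'r"
    by (rule saddle_dot[OF finite_circles circles_partition[OF D] circles_partition[OF D]
        edge_at_edges[OF D assms(1)] edge_at_edges[OF D assms(1)] circles_surgery'[OF assms(1)] assms(2)])
      auto
  then show "(\<lambda>S. edge_map D c b (dot_map D e f) (J, S)) = (\<lambda>S. dot_map D e (edge_map D c b f) (J, S))"
    by (simp add: edge_map_slice dot_map_slice toggle_subset[OF assms(1)] linear_op_zero[OF linear_op_dot])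
qed

lemma dot_map_commute:
  assumes "e \<in> edges D" "e' \<in> edges D"
  shows "dot_map D e (dot_map D e' f) = dot_map D e' (dot_map D e f)"
  by (rule slice_eqI) (simp add: dot_map_slice dot_commute[OF circles_partition[OF D] assms])

lemma dot_map_square:
  assumes "e \<in> edges D"
  shows "dot_map D e (dot_map D e f) = (\<lambda>g. 0)"
  by (rule slice_eqI) (simp add: dot_map_slice dot_dot[OF circles_partition[OF D] assms])

text \<open>With both directions free, one square of saddles yields \<open>d\<close> squared zero as
  well as the commutation of \<open>H\<close> with saddles at other crossings. \<open>J\<close> is
  the final state, \<open>?J0\<close> the initial one.\<close>

lemma edge_map_commute:
  fixes f :: "'c set \<times> 'e set set \<Rightarrow> 'r::comm_ring_1"
  assumes char: "\<And>r::'r. r + r = 0" and c: "c \<in> crossings D" "c' \<in> crossings D" "c \<noteq> c'"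
    and f: "f \<in> supported D"
  shows "edge_map D c b (edge_map D c' b' f) = edge_map D c' b' (edge_map D c b f)"
proof (rule slice_eqI)
  fix J
  note P = circles_partition[OF D] and E = edge_at_edges[OF D c(1)] edge_at_edges[OF D c(2)]
  let ?J0 = "toggle c (toggle c' J)"
  have "saddle_square (edges D) (edge_at D c 0) (edge_at D c 2) (edge_at D c' 0) (edge_at D c' 2)
      (circles D ?J0) (circles D (toggle c' J)) (circles D (toggle c J)) (circles D J)"
    using finite_edges P E circles_surgery'[OF c(1), of "toggle c' J"] circles_surgery'[OF c(2), of "toggle c J"]
      circles_surgery'[OF c(1), of J] circles_surgery'[OF c(2), of J]
    by (auto simp: saddle_square_def toggle_commute[of c' c])
  then have "saddle (circles D (toggle c' J)) (circles D J)
        (saddle (circles D ?J0) (circles D (toggle c' J)) (\<lambda>S. f (?J0, S))) =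
      saddle (circles D (toggle c J)) (circles D J)
        (saddle (circles D ?J0) (circles D (toggle c J)) (\<lambda>S. f (?J0, S)))"
    by (rule saddle_square.saddle_commute[OF _ char supported_slice[OF f]])
  then show "(\<lambda>S. edge_map D c b (edge_map D c' b' f) (J, S)) = (\<lambda>S. edge_map D c' b' (edge_map D c b f) (J, S))"
    by (auto simp: edge_map_slice toggle_subset c c(3)[symmetric] mem_toggle toggle_commute[of c' c]
        linear_op_zero[OF linear_op_saddle])
qed

text \<open>At a given state only one summand can be nonzero, depending on whether the state
  contains \<open>c\<close>. It goes to the neighbouring state and back, which is a tube.\<close>

lemma edge_map_homotopy:
  fixes f :: "'c set \<times> 'e set set \<Rightarrow> 'r::comm_ring_1"
  assumes char: "\<And>r::'r. r + r = 0" and c: "c \<in> crossings D" and f: "f \<in> supported D"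
  shows "edge_map D c True (edge_map D c False f) g + edge_map D c False (edge_map D c True f) g =
    dot_map D (edge_at D c 0) f g + dot_map D (edge_at D c 2) f g"
proof -
  obtain J T where g: "g = (J, T)" by fastforce
  have "saddle (circles D (toggle c J)) (circles D J) (saddle (circles D J) (circles D (toggle c J)) (\<lambda>S. f (J, S))) =
      dots (circles D J) (edge_at D c 0) (edge_at D c 2) (\<lambda>S. f (J, S))"
    by (rule saddle_reverse[OF finite_edges circles_partition[OF D] circles_partition[OF D]
        edge_at_edges[OF D c] edge_at_edges[OF D c] circles_surgery[OF D c] char supported_slice[OF f]]) auto
  then show ?thesis
    unfolding g
    by (auto simp: edge_map_def[of D c _ "edge_map D c _ f"] edge_map_slice toggle_toggle toggle_subset[OF c]
        mem_toggle dot_map_eq dots_def linear_op_zero[OF linear_op_saddle])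
qed

lemma dot_map_edge_map:
  fixes f :: "'c set \<times> 'e set set \<Rightarrow> 'r::comm_ring_1"
  assumes char: "\<And>r::'r. r + r = 0" and c: "c \<in> crossings D" and f: "f \<in> supported D"
  shows "dot_map D (edge_at D c 0) (edge_map D c b f) g + dot_map D (edge_at D c 2) (edge_map D c b f) g = 0"
proof -
  obtain J T where g: "g = (J, T)" by fastforce
  have "dots (circles D J) (edge_at D c 0) (edge_at D c 2)
      (saddle (circles D (toggle c J)) (circles D J) (\<lambda>S. f (toggle c J, S))) = (\<lambda>T. 0)"
    by (rule dots_saddle[OF finite_edges circles_partition[OF D] circles_partition[OF D]
        edge_at_edges[OF D c] edge_at_edges[OF D c] circles_surgery'[OF c] char supported_slice[OF f]]) auto
  then show ?thesis
    unfolding g dot_map_eq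
    by (auto simp: edge_map_slice dots_def linear_op_zero[OF linear_op_dot] fun_eq_iff)
qed

text \<open>Either resolution joins the ends 1 and 3 to the ends 0 and 2 in some order. Thus one
  homotopy at a crossing serves both of its strands.\<close>

lemma dot_map_upper_strand:
  fixes f :: "'c set \<times> 'e set set \<Rightarrow> 'r::comm_ring_1"
  assumes c: "c \<in> crossings D"
  shows "dot_map D (edge_at D c 1) f g + dot_map D (edge_at D c 3) f g =
    dot_map D (edge_at D c 0) f g + dot_map D (edge_at D c 2) f g"
proof -
  obtain J T where g: "g = (J, T)" by fastforce
  have arc: "dot (circles D J) (edge_at D c s) = (dot (circles D J) (edge_at D c t) :: ('e set set \<Rightarrow> 'r) \<Rightarrow> _)"
    if "(s, t) \<in> resolution D J c" for s t
  proof (intro ext, rule fun_cong[OF dot_same_block[OF circles_partition[OF D]]])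
    have "s < 4" using that by (auto simp: resolution_eq split: if_splits)
    moreover have "(edge_at D c s, edge_at D c t) \<in> arcs D (crossings D) J"
      using that c by (auto simp: arcs_def)
    ultimately show "same_block (circles D J) (edge_at D c s) (edge_at D c t)"
      using edge_at_edges[OF D c] by (auto simp: same_circle_iff[OF D])
  qed
  show ?thesis
  proof (cases "c \<in> J")
    case True
    then show ?thesis
      unfolding g dot_map_eq using arc[of 0 3] arc[of 1 2] by (simp add: resolution_eq add.commute)
  next
    case False
    then show ?thesis
      unfolding g dot_map_eq using arc[of 0 1] arc[of 3 2] by (simp add: resolution_eq add.commute)
  qed
qed

text \<open>The converse relation is included because a marking may have to travel against the
  orientation.\<close>

lemma strand_maps:
  assumes char: "\<And>r::'r::comm_ring_1. r + r = 0" and e: "(e, e') \<in> strands D \<union> (strands D)\<inverse>"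
  obtains c where "c \<in> crossings D" "e \<in> edges D" "e' \<in> edges D"
    and "\<And>(f :: 'c set \<times> 'e set set \<Rightarrow> 'r) g. f \<in> supported D \<Longrightarrow>
      edge_map D c True (edge_map D c False f) g + edge_map D c False (edge_map D c True f) g =
      dot_map D e f g + dot_map D e' f g"
    and "\<And>f :: 'c set \<times> 'e set set \<Rightarrow> 'r. f \<in> supported D \<Longrightarrow>
      dot_map D e (edge_map D c False f) = dot_map D e' (edge_map D c False f)"
proof -
  obtain c s where c: "c \<in> crossings D" "s = 0 \<or> s = 1"
    and ee: "e = edge_at D c s \<and> e' = edge_at D c (s + 2) \<or> e' = edge_at D c s \<and> e = edge_at D c (s + 2)"
    using e by (auto simp: strands_def)
  have sum: "dot_map D e f g + dot_map D e' f g = dot_map D (edge_at D c 0) f g + dot_map D (edge_at D c 2) f g"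
    for f :: "'c set \<times> 'e set set \<Rightarrow> 'r" and g
    using c(2) ee dot_map_upper_strand[OF c(1), of f g] by (auto simp: add.commute numeral_3_eq_3 numeral_2_eq_2)
  show ?thesis
  proof (rule that[OF c(1)])
    show "e \<in> edges D" "e' \<in> edges D" using c ee edge_at_edges[OF D c(1)] by auto
    show "edge_map D c True (edge_map D c False f) g + edge_map D c False (edge_map D c True f) g =
      dot_map D e f g + dot_map D e' f g" if "f \<in> supported D" for f :: "'c set \<times> 'e set set \<Rightarrow> 'r" and g
      using edge_map_homotopy[OF char c(1) that] sum by simp
    show "dot_map D e (edge_map D c False f) = dot_map D e' (edge_map D c False f)"
      if "f \<in> supported D" for f :: "'c set \<times> 'e set set \<Rightarrow> 'r"
    proof
      fix g
      have "dot_map D e (edge_map D c False f) g + dot_map D e' (edge_map D c False f) g = 0"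
        using sum dot_map_edge_map[OF char c(1) that] by simp
      then show "dot_map D e (edge_map D c False f) g = dot_map D e' (edge_map D c False f) g"
        using char[of "dot_map D e' (edge_map D c False f) g"] by (metis add_right_imp_eq)
    qed
  qed
qed

end

lemma linear_opD:
  assumes "linear_op F"
  shows "F (\<lambda>x. f x + g x) = (\<lambda>x. F f x + F g x)" and "F (\<lambda>x. r * f x) = (\<lambda>x. r * F f x)"
  using assms unfolding linear_op_def by blast+

section \<open>The differential as saddle part plus marking part\<close>

definition saddle_sum ::
  "('c, 'e) diagram \<Rightarrow> ('c set \<times> 'e set set \<Rightarrow> 'r) \<Rightarrow> 'c set \<times> 'e set set \<Rightarrow> 'r::comm_ring_1" where
  "saddle_sum D f = (\<lambda>g. \<Sum>c\<in>crossings D. edge_map D c True f g)"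

definition marking_sum ::
  "('c, 'e) diagram \<Rightarrow> ('e \<times> 'r) list \<Rightarrow> ('c set \<times> 'e set set \<Rightarrow> 'r) \<Rightarrow> 'c set \<times> 'e set set \<Rightarrow> 'r::comm_ring_1" where
  "marking_sum D ms f = (\<lambda>g. \<Sum>(e, w)\<leftarrow>ms. w * dot_map D e f g)"

lemma marking_sum_simps:
  "marking_sum D [] f = (\<lambda>g. 0)"
  "marking_sum D ((e, w) # ms) f = (\<lambda>g. w * dot_map D e f g + marking_sum D ms f g)"
  by (simp_all add: marking_sum_def)

lemma twisted_Kh_simps:
  "carrier (twisted_Kh D ms) = supported D"
  "zero (twisted_Kh D ms) = (\<lambda>g. 0)"
  "add (twisted_Kh D ms) = (\<lambda>f f' g. f g + f' g)"
  "module.smult (twisted_Kh D ms) = (\<lambda>r f g. r * f g)"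
  "homog (twisted_Kh D ms) k = {f. \<forall>g. \<not> (g \<in> generators D \<and> \<delta>_degree D g = k) \<longrightarrow> f g = 0}"
  "diff (twisted_Kh D ms) f = (\<lambda>g. saddle_sum D f g + marking_sum D ms f g)"
  by (simp_all add: twisted_Kh_def supported_def saddle_sum_def marking_sum_def saddle_map_eq)

lemma linear_op_saddle_sum: "linear_op (saddle_sum D)"
  by (simp add: linear_op_def saddle_sum_def linear_opD[OF linear_op_edge_map] sum.distrib sum_distrib_left)

lemma linear_op_marking_sum: "linear_op (marking_sum D ms)"
  by (induction ms)
    (auto simp: linear_op_def marking_sum_simps linear_opD[OF linear_op_dot_map] algebra_simps fun_eq_iff)

lemma supported_saddle_sum: "saddle_sum D f \<in> supported D"
  using supported_edge_map[of D _ True f] by (auto simp: supported_def saddle_sum_def)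

lemma supported_marking_sum: "marking_sum D ms f \<in> supported D"
  using supported_dot_map[of D _ f] by (induction ms) (auto simp: supported_def marking_sum_simps)

lemma linear_op_saddle_sum_commute:
  assumes "link_diagram D" "linear_op F" "\<And>c. c \<in> crossings D \<Longrightarrow> F (edge_map D c True f) = edge_map D c True (F f)"
  shows "F (saddle_sum D f) = saddle_sum D (F f)"
  using linear_op_sum[OF assms(2) finite_crossings[OF assms(1)], of "\<lambda>c. 1" "\<lambda>c. edge_map D c True f"] assms(3)
  by (simp add: saddle_sum_def)

lemma linear_op_marking_sum_commute:
  assumes "linear_op F" "\<And>e. e \<in> fst ` set ms \<Longrightarrow> F (dot_map D e f) = dot_map D e (F f)"
  shows "F (marking_sum D ms f) = marking_sum D ms (F f)"
  using assms(2)
  by (induction ms)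
    (auto simp: marking_sum_simps linear_op_zero[OF assms(1)] linear_opD[OF assms(1)])

text \<open>The diagonal vanishes and the other terms cancel in pairs.\<close>

lemma sum_symmetric_char_2:
  fixes a :: "'a \<Rightarrow> 'a \<Rightarrow> 'r::comm_ring_1"
  assumes "finite A" and char: "\<And>r::'r. r + r = 0" and "\<And>i j. i \<in> A \<Longrightarrow> j \<in> A \<Longrightarrow> a i j = a j i"
    and "\<And>i. i \<in> A \<Longrightarrow> a i i = 0"
  shows "(\<Sum>i\<in>A. \<Sum>j\<in>A. a i j) = 0"
  using assms(1,3,4)
proof (induction A rule: finite_induct)
  case (insert x A)
  have "(\<Sum>j\<in>A. a j x) = (\<Sum>j\<in>A. a x j)" using insert.prems(1) by (intro sum.cong) auto
  then show ?case using insert char by (simp add: sum.distrib)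
qed simp

section \<open>The twisted complex as a graded module\<close>

context
  fixes D :: "('c, 'e) diagram" and R :: "'r::comm_ring_1 ring"
  assumes D: "link_diagram D" and char: "\<And>r::'r. r + r = 0"
  defines "R \<equiv> ring_of_type_algebra"
begin

lemma carrier_R: "carrier R = UNIV" "add R = (+)" "monoid.mult R = (*)" "one R = 1"
  by (auto simp: R_def ring_of_type_algebra_def fun_eq_iff)

lemma twisted_Kh_module: "module R (twisted_Kh D (ms :: ('e \<times> 'r) list))"
proof (rule moduleI)
  show "cring R" unfolding R_def by (rule cring_from_type_algebra)
  show "abelian_group (twisted_Kh D ms)"
  proof (rule abelian_groupI)
    fix f assume "f \<in> carrier (twisted_Kh D ms)"
    then show "\<exists>g\<in>carrier (twisted_Kh D ms). g \<oplus>\<^bsub>twisted_Kh D ms\<^esub> f = \<zero>\<^bsub>twisted_Kh D ms\<^esub>"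
      by (intro bexI[of _ "\<lambda>x. - f x"]) (auto simp: twisted_Kh_simps supported_def)
  qed (auto simp: twisted_Kh_simps supported_def algebra_simps)
qed (auto simp: twisted_Kh_simps supported_def algebra_simps carrier_R)

lemma twisted_Kh_minus:
  assumes "f \<in> supported D" "g \<in> supported D"
  shows "f \<ominus>\<^bsub>twisted_Kh D ms\<^esub> g = (\<lambda>x. f x - g x :: 'r)"
proof -
  interpret M: module R "twisted_Kh D ms" by (rule twisted_Kh_module)
  have "(\<lambda>x. - g x) \<in> supported D" using assms by (simp add: supported_def)
  then have "\<ominus>\<^bsub>twisted_Kh D ms\<^esub> g = (\<lambda>x. - g x)"
    using assms by (intro M.minus_equality) (auto simp: twisted_Kh_simps)
  then show ?thesis by (simp add: a_minus_def twisted_Kh_simps)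
qed

lemma twisted_Kh_finsum:
  assumes "finite A" "\<And>k. k \<in> A \<Longrightarrow> y k \<in> supported D"
  shows "finsum (twisted_Kh D ms) y A = (\<lambda>x. \<Sum>k\<in>A. y k x :: 'r)"
proof -
  interpret M: module R "twisted_Kh D ms" by (rule twisted_Kh_module)
  from assms show ?thesis
  proof (induction A rule: finite_induct)
    case empty
    then show ?case by (simp add: M.finsum_empty twisted_Kh_simps)
  next
    case (insert a A)
    then have "finsum (twisted_Kh D ms) y (insert a A) = y a \<oplus>\<^bsub>twisted_Kh D ms\<^esub> finsum (twisted_Kh D ms) y A"
      by (intro M.finsum_insert) (auto simp: twisted_Kh_simps)
    then show ?case using insert by (simp add: twisted_Kh_simps)
  qed
qed

lemma finite_generators: "finite (generators D)"
  unfolding generators_def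
  by (intro finite_SigmaI) (auto simp: finite_crossings[OF D] finite_circles[OF D])

lemma twisted_Kh_graded_module: "is_graded_module R (twisted_Kh D (ms :: ('e \<times> 'r) list))"
proof (rule graded_moduleI[OF twisted_Kh_module])
  interpret M: module R "twisted_Kh D ms" by (rule twisted_Kh_module)
  show "submodule (homog (twisted_Kh D ms) k) R (twisted_Kh D ms)" for k
    by (rule M.submoduleI') (auto simp: twisted_Kh_simps supported_def)
next
  fix f assume "f \<in> carrier (twisted_Kh D ms)"
  then have f: "f g = 0" if "g \<notin> generators D" for g
    using \<open>f \<in> _\<close> that unfolding twisted_Kh_simps supported_def by blast
  define y where "y k g = (if \<delta>_degree D g = k then f g else 0)" for k g
  have y: "y k \<in> homog (twisted_Kh D ms) k" for k
    using f by (auto simp: y_def twisted_Kh_simps)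
  have ys: "y k \<in> supported D" for k using f by (auto simp: y_def supported_def)
  have "f = finsum (twisted_Kh D ms) y (\<delta>_degree D ` generators D)"
  proof
    fix g
    have "(\<Sum>k\<in>\<delta>_degree D ` generators D. y k g) = f g"
      using f[of g] finite_generators by (auto simp: y_def sum.delta)
    then show "f g = finsum (twisted_Kh D ms) y (\<delta>_degree D ` generators D) g"
      using finite_generators ys by (simp add: twisted_Kh_finsum)
  qed
  then show "\<exists>y A. finite A \<and> (\<forall>k. y k \<in> homog (twisted_Kh D ms) k) \<and> f = finsum (twisted_Kh D ms) y A"
    using y finite_generators by blast
next
  fix y A k
  assume A: "finite A" "\<And>k. y k \<in> homog (twisted_Kh D ms) k"
    "finsum (twisted_Kh D ms) y A = \<zero>\<^bsub>twisted_Kh D ms\<^esub>" "k \<in> A"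
  have h: "y j g = 0" if "\<not> (g \<in> generators D \<and> \<delta>_degree D g = j)" for j g
    using A(2)[of j] that unfolding twisted_Kh_simps by blast
  have ys: "y j \<in> supported D" for j using h by (auto simp: supported_def)
  show "y k = \<zero>\<^bsub>twisted_Kh D ms\<^esub>"
  proof
    fix g
    show "y k g = \<zero>\<^bsub>twisted_Kh D ms\<^esub> g"
    proof (cases "\<delta>_degree D g = k")
      case True
      \<comment> \<open>At a generator of degree \<open>k\<close> all other summands vanish.\<close>
      have "(\<Sum>j\<in>A. y j g) = (\<Sum>j\<in>{k}. y j g)"
        using A(1,4) True h by (intro sum.mono_neutral_right) auto
      then show ?thesis
        using fun_cong[OF A(3), of g] A(1) ys by (simp add: twisted_Kh_finsum twisted_Kh_simps)
    qed (simp add: h twisted_Kh_simps)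
  qed
qed

end

section \<open>Degrees of saddles and dots\<close>

lemma saddle_coeff_degree:
  assumes fin: "finite Z" "finite Z'" and S: "S \<subseteq> Z" "T \<subseteq> Z'"
    and nz: "saddle_coeff Z Z' S T \<noteq> (0 :: 'r::comm_ring_1)"
  shows "(\<Sum>z\<in>Z'. if z \<in> T then - 1 else 1) = (\<Sum>z\<in>Z. if z \<in> S then - 1 else 1) - (1 :: int)"
proof -
  have deg: "(\<Sum>z\<in>Y. if z \<in> U then - 1 else 1) = int (card Y) - 2 * int (card U)"
    if "finite Y" "U \<subseteq> Y" for Y U :: "'a set"
  proof -
    have "(\<Sum>z\<in>Y. if z \<in> U then - 1 else 1) = (\<Sum>z\<in>Y. 1 - 2 * (if z \<in> U then 1 else 0 :: int))"
      by (intro sum.cong) auto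
    also have "\<dots> = int (card Y) - 2 * int (card (Y \<inter> U))"
      using that(1) by (simp add: sum_subtractf sum.If_cases flip: sum_distrib_left)
    also have "Y \<inter> U = U" using that(2) by auto
    finally show ?thesis .
  qed
  have split: "card Y = card (Y \<inter> Y') + card (Y - Y')" if "finite Y" for Y Y' :: "'a set"
    using card_Int_Diff[OF that] .
  have fS: "finite S" "finite T" using fin S finite_subset by auto
  have eq: "S \<inter> Z' = T \<inter> Z" using nz by (auto simp: saddle_coeff_def Let_def split: if_splits)
  \<comment> \<open>Circles common to both sides contribute equally. On the others each of the four
    nonzero kinds of entries lowers the degree by 1, the Euler characteristic of a saddle being
    -1.\<close>
  have "int (card (Z' - Z)) - 2 * int (card (T - Z)) = int (card (Z - Z')) - 2 * int (card (S - Z')) - 1"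
    using nz by (auto simp: saddle_coeff_def Let_def split: if_splits)
  then show ?thesis
    unfolding deg[OF fin(1) S(1)] deg[OF fin(2) S(2)]
    using split[OF fin(1), of Z'] split[OF fin(2), of Z] split[OF fS(1), of Z'] split[OF fS(2), of Z] eq
    by (simp add: Int_commute)
qed

text \<open>For both signs, adding \<open>c\<close> to the state raises the homological shift by 2
  and the q-shift by 1, and removing it lowers them by as much. The saddle lowers the q-degree by 1
  in either direction, so \<delta> changes by 2 forwards and by 0 backwards.\<close>

lemma \<delta>_degree_saddle:
  assumes D: "link_diagram D" and c: "c \<in> crossings D"
    and S: "S \<subseteq> circles D (toggle c J)" "T \<subseteq> circles D J"
    and nz: "saddle_coeff (circles D (toggle c J)) (circles D J) S T \<noteq> (0 :: 'r::comm_ring_1)"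
  shows "\<delta>_degree D (J, T) = \<delta>_degree D (toggle c J, S) + (if c \<in> J then 2 else 0)"
proof -
  have rest: "(\<Sum>b\<in>crossings D - {c}. h_shift D (toggle c J) b) = (\<Sum>b\<in>crossings D - {c}. h_shift D J b)"
    "(\<Sum>b\<in>crossings D - {c}. q_shift D (toggle c J) b) = (\<Sum>b\<in>crossings D - {c}. q_shift D J b)"
    by (intro sum.cong; auto simp: h_shift_def q_shift_def mem_toggle)+
  note rem = sum.remove[OF finite_crossings[OF D] c]
  show ?thesis
    unfolding \<delta>_degree_def h_degree_def q_degree_def
    using saddle_coeff_degree[OF finite_circles[OF D] finite_circles[OF D] S nz]
    by (simp add: rem[of "h_shift D _"] rem[of "q_shift D _"] rest)
      (simp add: h_shift_def q_shift_def mem_toggle)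
qed

lemma edge_map_homog:
  assumes D: "link_diagram D" and c: "c \<in> crossings D" and f: "f \<in> homog (twisted_Kh D ms) k"
  shows "edge_map D c b f \<in> homog (twisted_Kh D ms') (k + (if b then 2 else 0))"
  unfolding twisted_Kh_simps
proof (intro CollectI allI impI, rule ccontr)
  fix g assume g: "\<not> (g \<in> generators D \<and> \<delta>_degree D g = k + (if b then 2 else 0))"
    and nz: "edge_map D c b f g \<noteq> 0"
  obtain J T where JT: "g = (J, T)" by fastforce
  have J: "J \<subseteq> crossings D" "c \<in> J \<longleftrightarrow> b" "T \<subseteq> circles D J"
    and sum: "(\<Sum>S\<in>Pow (circles D (toggle c J)).
      saddle_coeff (circles D (toggle c J)) (circles D J) S T * f (toggle c J, S)) \<noteq> 0"
    using nz unfolding JT by (auto simp: edge_map_def saddle_def split: if_splits)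
  obtain S where S: "S \<in> Pow (circles D (toggle c J))"
    and "saddle_coeff (circles D (toggle c J)) (circles D J) S T * f (toggle c J, S) \<noteq> 0"
    by (rule sum.not_neutral_contains_not_neutral[OF sum])
  then have coeff: "saddle_coeff (circles D (toggle c J)) (circles D J) S T \<noteq> (0 :: 'c)"
    and "f (toggle c J, S) \<noteq> 0" by auto
  then have "\<delta>_degree D (toggle c J, S) = k" using f by (auto simp: twisted_Kh_simps)
  moreover have "g \<in> generators D" using J by (auto simp: JT generators_def)
  ultimately show False
    using g \<delta>_degree_saddle[OF D c _ J(3) coeff] S J(2) by (auto simp: JT)
qed

text \<open>Replacing 1 by \<open>x\<close> on a circle lowers the q-degree by 2 at constant
  homological degree, so a marking has the degree of a differential.\<close>

lemma dot_map_homog: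
  assumes D: "link_diagram D" and f: "f \<in> homog (twisted_Kh D ms) k"
  shows "dot_map D e f \<in> homog (twisted_Kh D ms') (k + 2)"
  unfolding twisted_Kh_simps
proof (intro CollectI allI impI, rule ccontr)
  fix g assume g: "\<not> (g \<in> generators D \<and> \<delta>_degree D g = k + 2)"
    and nz: "dot_map D e f g \<noteq> 0"
  obtain I T where IT: "g = (I, T)" by fastforce
  have gen: "(I, T) \<in> generators D" and sum: "(\<Sum>z | z \<in> T \<and> e \<in> z. f (I, T - {z})) \<noteq> 0"
    using nz unfolding IT by (auto simp: dot_map_def split: if_splits)
  obtain z where z: "z \<in> T" "f (I, T - {z}) \<noteq> 0"
    using sum.not_neutral_contains_not_neutral[OF sum] by blast
  then have k: "\<delta>_degree D (I, T - {z}) = k" using f by (auto simp: twisted_Kh_simps)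
  have zc: "z \<in> circles D I" using gen z by (auto simp: generators_def)
  have "(\<Sum>y\<in>circles D I - {z}. if y \<in> T - {z} then - 1 else 1) =
      (\<Sum>y\<in>circles D I - {z}. if y \<in> T then - 1 else (1 :: int))"
    by (intro sum.cong) auto
  then have "\<delta>_degree D (I, T) = \<delta>_degree D (I, T - {z}) + 2"
    using z(1) unfolding \<delta>_degree_def h_degree_def q_degree_def
    by (simp add: sum.remove[OF finite_circles[OF D] zc])
  then show False using g gen k IT by simp
qed


section \<open>Moving markings\<close>

context
  fixes D :: "('c, 'e) diagram" and R :: "'r::comm_ring_1 ring"
  assumes D: "link_diagram D" and char: "\<And>r::'r. r + r = 0"
  defines "R \<equiv> ring_of_type_algebra"
begin

lemma char_2_sum: "(a :: 'r) + b = 0 \<longleftrightarrow> a = b"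
  using char[of b] by (metis add_right_imp_eq)

lemma saddle_sum_dot_map:
  "e \<in> edges D \<Longrightarrow> dot_map D e (saddle_sum D f) = saddle_sum D (dot_map D e f)"
  by (rule linear_op_saddle_sum_commute[OF D linear_op_dot_map])
    (simp add: edge_map_dot_map[OF D])

lemma saddle_sum_marking_sum:
  "fst ` set ms \<subseteq> edges D \<Longrightarrow> saddle_sum D (marking_sum D ms f) = marking_sum D ms (saddle_sum D f)"
  by (rule linear_op_marking_sum_commute[OF linear_op_saddle_sum],
      rule saddle_sum_dot_map[symmetric, OF subsetD])

lemma dot_map_marking_sum:
  "e \<in> edges D \<Longrightarrow> fst ` set ms \<subseteq> edges D \<Longrightarrow>
    dot_map D e (marking_sum D ms f) = marking_sum D ms (dot_map D e f)"
  by (rule linear_op_marking_sum_commute[OF linear_op_dot_map])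
    (use dot_map_commute[OF D] in auto)

lemma saddle_sum_square:
  assumes f: "f \<in> supported D"
  shows "saddle_sum D (saddle_sum D f) = (\<lambda>g. 0 :: 'r)"
proof
  fix g
  have "saddle_sum D (saddle_sum D f) g =
      (\<Sum>c\<in>crossings D. \<Sum>c'\<in>crossings D. edge_map D c True (edge_map D c' True f) g)"
    using linear_op_sum[OF linear_op_edge_map finite_crossings[OF D], of D _ True "\<lambda>_. 1" "\<lambda>c. edge_map D c True f"]
    by (simp add: saddle_sum_def)
  also have "\<dots> = 0"
  proof (rule sum_symmetric_char_2[OF finite_crossings[OF D] char])
    fix c c' assume "c \<in> crossings D" "c' \<in> crossings D"
    then show "edge_map D c True (edge_map D c' True f) g = edge_map D c' True (edge_map D c True f) g"
      by (cases "c = c'") (simp_all add: edge_map_commute[OF D char _ _ _ f])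
  qed (simp add: edge_map_square)
  finally show "saddle_sum D (saddle_sum D f) g = 0" .
qed

text \<open>Squares of dots vanish, and by commutation every mixed product of two markings occurs
  twice.\<close>

lemma marking_sum_square:
  "fst ` set ms \<subseteq> edges D \<Longrightarrow> marking_sum D ms (marking_sum D ms f) = (\<lambda>g. 0 :: 'r)"
proof (induction ms)
  case (Cons m ms)
  obtain e w where m: "m = (e, w)" by fastforce
  have "e \<in> edges D" "fst ` set ms \<subseteq> edges D" using Cons.prems by (auto simp: m)
  then show ?case
    using Cons.IH char
    by (simp add: m marking_sum_simps linear_opD[OF linear_op_dot_map] linear_opD[OF linear_op_marking_sum]
        dot_map_square[OF D] dot_map_marking_sum)
qed (simp add: marking_sum_simps)

lemma twisted_Kh_complex:
  assumes ms: "fst ` set ms \<subseteq> edges D"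
  shows "is_complex R (twisted_Kh D (ms :: ('e \<times> 'r) list))"
  unfolding is_complex_def
proof (intro conjI allI ballI funcsetI)
  interpret M: module R "twisted_Kh D ms"
    unfolding R_def by (rule twisted_Kh_module[OF D char])
  show gr: "is_graded_module R (twisted_Kh D ms)"
    unfolding R_def by (rule twisted_Kh_graded_module[OF D char])
  show "diff (twisted_Kh D ms) \<in> linear_maps R (twisted_Kh D ms) (twisted_Kh D ms)"
    using supported_saddle_sum[of D] supported_marking_sum[of D ms]
    by (auto simp: linear_maps_def twisted_Kh_simps linear_opD[OF linear_op_saddle_sum]
        linear_opD[OF linear_op_marking_sum] algebra_simps intro!: supported_add)
  \<comment> \<open>Saddle part and marking part square to zero and commute, so the mixed terms
    cancel in characteristic 2.\<close>
  show "diff (twisted_Kh D ms) (diff (twisted_Kh D ms) f) = \<zero>\<^bsub>twisted_Kh D ms\<^esub>"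
    if "f \<in> carrier (twisted_Kh D ms)" for f
    using that char
    by (simp add: twisted_Kh_simps linear_opD[OF linear_op_saddle_sum] linear_opD[OF linear_op_marking_sum]
        saddle_sum_square marking_sum_square[OF ms] saddle_sum_marking_sum[OF ms])
  fix k f assume f: "f \<in> homog (twisted_Kh D ms) k"
  have "edge_map D c True f \<in> homog (twisted_Kh D ms) (k + 2)" if "c \<in> crossings D" for c
    using edge_map_homog[OF D that f, of True ms] by simp
  then have "saddle_sum D f \<in> homog (twisted_Kh D ms) (k + 2)"
    unfolding twisted_Kh_simps saddle_sum_def by simp
  moreover have "marking_sum D ms' f \<in> homog (twisted_Kh D ms) (k + 2)" for ms'
    using dot_map_homog[OF D f, of _ ms]
    by (induction ms') (auto simp: twisted_Kh_simps marking_sum_simps)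
  ultimately show "diff (twisted_Kh D ms) f \<in> homog (twisted_Kh D ms) (k + 2)"
    by (simp add: twisted_Kh_simps)
qed

definition marking_shift :: "'c \<Rightarrow> 'r \<Rightarrow> ('c set \<times> 'e set set \<Rightarrow> 'r) \<Rightarrow> 'c set \<times> 'e set set \<Rightarrow> 'r" where
  "marking_shift c w f = (\<lambda>g. f g + w * edge_map D c False f g)"

lemma marking_shift_involution: "marking_shift c w (marking_shift c w f) = f"
  using char by (simp add: marking_shift_def linear_opD[OF linear_op_edge_map] edge_map_square
      add.assoc flip: distrib_left)

lemma supported_marking_shift: "f \<in> supported D \<Longrightarrow> marking_shift c w f \<in> supported D"
  unfolding marking_shift_def by (intro supported_add supported_smult supported_edge_map)

lemma marking_shift_iso:
  assumes c: "c \<in> crossings D"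
  shows "marking_shift c w \<in> graded_isos R (twisted_Kh D ms) (twisted_Kh D ms')"
proof -
  have "marking_shift c w f \<in> homog (twisted_Kh D ms') k" if "f \<in> homog (twisted_Kh D ms) k" for ms ms' f k
    using that edge_map_homog[OF D c that, of False ms'] by (simp add: twisted_Kh_simps marking_shift_def)
  \<comment> \<open>The map respects degrees for all lists of markings, and as an involution it then
    attains every homogeneous element.\<close>
  then have "marking_shift c w ` homog (twisted_Kh D ms) k = homog (twisted_Kh D ms') k" for k
    using marking_shift_involution by (metis (no_types, lifting) image_eqI image_subsetI subsetI subset_antisym)
  moreover have "bij_betw (marking_shift c w) (supported D) (supported D)"
    by (rule bij_betwI[where g = "marking_shift c w"])
      (auto simp: marking_shift_involution supported_marking_shift)
  moreover have "marking_shift c w \<in> linear_maps R (twisted_Kh D ms) (twisted_Kh D ms')"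
    by (auto simp: linear_maps_def twisted_Kh_simps supported_marking_shift)
      (auto simp: marking_shift_def linear_opD[OF linear_op_edge_map] algebra_simps)
  ultimately show ?thesis by (simp add: graded_isos_def twisted_Kh_simps)
qed

lemma marking_shift_dot_map:
  assumes "c \<in> crossings D" "e \<in> edges D"
  shows "marking_shift c w (dot_map D e f) = dot_map D e (marking_shift c w f)"
  by (simp add: marking_shift_def edge_map_dot_map[OF D assms] linear_opD[OF linear_op_dot_map])

text \<open>Comparing powers of \<open>w\<close>, with \<open>d\<close> the sum of the saddles: the
  linear terms \<open>H d + x_e\<close> and \<open>d H + x_e'\<close> agree by the homotopy, the
  quadratic terms \<open>H x_e\<close> and \<open>x_e' H\<close> by \<open>slide\<close>. The other
  markings commute with \<open>H\<close>.\<close>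

lemma marking_shift_chain:
  assumes c: "c \<in> crossings D" and e: "e \<in> edges D" "e' \<in> edges D" and ms: "fst ` set ms \<subseteq> edges D"
    and homotopy: "\<And>f g. f \<in> supported D \<Longrightarrow>
      edge_map D c True (edge_map D c False f) g + edge_map D c False (edge_map D c True f) g =
      dot_map D e f g + (dot_map D e' f g :: 'r)"
    and slide: "\<And>f. f \<in> supported D \<Longrightarrow>
      dot_map D e (edge_map D c False f) = dot_map D e' (edge_map D c False f :: _ \<Rightarrow> 'r)"
    and f: "f \<in> supported D"
  shows "marking_shift c w (diff (twisted_Kh D ((e, w) # ms)) f) =
    diff (twisted_Kh D ((e', w) # ms)) (marking_shift c w f)"
proof
  fix g
  let ?H = "edge_map D c False"
  have markings: "?H (marking_sum D ms f) = marking_sum D ms (?H f)"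
    by (rule linear_op_marking_sum_commute[OF linear_op_edge_map],
        rule edge_map_dot_map[OF D c subsetD[OF ms]])
  have dot: "?H (dot_map D e f) = dot_map D e' (?H f)"
    using slide[OF f] by (simp add: edge_map_dot_map[OF D c e(1)])
  have H: "?H (saddle_sum D f) g = (\<Sum>b\<in>crossings D. ?H (edge_map D b True f) g)"
    using linear_op_sum[OF linear_op_edge_map finite_crossings[OF D], of D c False "\<lambda>_. 1" "\<lambda>c. edge_map D c True f"]
    by (simp add: saddle_sum_def)
  \<comment> \<open>Saddles at other crossings commute with \<open>H\<close>, so they contribute the
    same to \<open>H d\<close> and \<open>d H\<close> and cancel in the sum.\<close>
  have rest: "(\<Sum>b\<in>crossings D - {c}. ?H (edge_map D b True f) g) =
      (\<Sum>b\<in>crossings D - {c}. edge_map D b True (?H f) g)"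
    using edge_map_commute[OF D char c _ _ f] by (intro sum.cong) auto
  have cancel: "(a + x) + (b + x) = a + b" for a b x :: 'r
  proof -
    have "(a + x) + (b + x) = a + b + (x + x)" by (simp only: ac_simps)
    then show ?thesis by (simp add: char)
  qed
  have "?H (saddle_sum D f) g + saddle_sum D (?H f) g =
      ?H (edge_map D c True f) g + edge_map D c True (?H f) g"
    unfolding H unfolding saddle_sum_def sum.remove[OF finite_crossings[OF D] c] rest
    by (rule cancel)
  then have "?H (saddle_sum D f) g + saddle_sum D (?H f) g = dot_map D e f g + dot_map D e' f g"
    using homotopy[OF f] by (simp add: add.commute)
  then have "(?H (saddle_sum D f) g + dot_map D e f g) + (saddle_sum D (?H f) g + dot_map D e' f g) = 0"
    using char[of "dot_map D e f g + dot_map D e' f g"] by (simp add: ac_simps)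
  then have eq: "?H (saddle_sum D f) g + dot_map D e f g = saddle_sum D (?H f) g + dot_map D e' f g"
    by (simp add: char_2_sum)
  have "marking_shift c w (diff (twisted_Kh D ((e, w) # ms)) f) g =
      saddle_sum D f g + marking_sum D ms f g + w * (?H (saddle_sum D f) g + dot_map D e f g) +
      w * w * dot_map D e' (?H f) g + w * marking_sum D ms (?H f) g"
    by (simp add: marking_shift_def twisted_Kh_simps marking_sum_simps linear_opD[OF linear_op_edge_map]
        markings dot algebra_simps)
  also have "\<dots> = diff (twisted_Kh D ((e', w) # ms)) (marking_shift c w f) g"
    unfolding eq
    by (simp add: marking_shift_def twisted_Kh_simps marking_sum_simps linear_opD[OF linear_op_dot_map]
        linear_opD[OF linear_op_saddle_sum] linear_opD[OF linear_op_marking_sum] algebra_simps)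
  finally show "marking_shift c w (diff (twisted_Kh D ((e, w) # ms)) f) g =
    diff (twisted_Kh D ((e', w) # ms)) (marking_shift c w f) g" .
qed

lemma diff_dot_map:
  assumes "p \<in> edges D" "fst ` set ms \<subseteq> edges D"
  shows "diff (twisted_Kh D ms) (dot_map D p f) = dot_map D p (diff (twisted_Kh D ms) f :: _ \<Rightarrow> 'r)"
  using assms by (simp add: twisted_Kh_simps saddle_sum_dot_map dot_map_marking_sum linear_opD[OF linear_op_dot_map])

text \<open>The basepoint dot has degree 2 and commutes with the differential, so its image is a
  homogeneous subcomplex.\<close>

lemma basepoint_submodule:
  assumes "p \<in> edges D" "fst ` set ms \<subseteq> edges D"
  shows "graded_submodule R (twisted_Kh D (ms :: ('e \<times> 'r) list)) (dot_map D p ` carrier (twisted_Kh D ms))"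
    and "diff (twisted_Kh D ms) ` dot_map D p ` carrier (twisted_Kh D ms) \<subseteq> dot_map D p ` carrier (twisted_Kh D ms)"
proof -
  have gr: "is_graded_module R (twisted_Kh D ms)"
    unfolding R_def by (rule twisted_Kh_graded_module[OF D char])
  show "graded_submodule R (twisted_Kh D ms) (dot_map D p ` carrier (twisted_Kh D ms))"
  proof (rule graded_submodule_linear_image[OF gr gr, of _ 2])
    show "dot_map D p \<in> linear_maps R (twisted_Kh D ms) (twisted_Kh D ms)"
      by (auto simp: linear_maps_def twisted_Kh_simps linear_opD[OF linear_op_dot_map] supported_dot_map)
  qed (use dot_map_homog[OF D] in blast)
  show "diff (twisted_Kh D ms) ` dot_map D p ` carrier (twisted_Kh D ms) \<subseteq> dot_map D p ` carrier (twisted_Kh D ms)"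
  proof
    fix y assume "y \<in> diff (twisted_Kh D ms) ` dot_map D p ` carrier (twisted_Kh D ms)"
    then obtain f where y: "y = diff (twisted_Kh D ms) (dot_map D p f)" by blast
    have "diff (twisted_Kh D ms) f \<in> carrier (twisted_Kh D ms)"
      unfolding twisted_Kh_simps by (intro supported_add supported_saddle_sum supported_marking_sum)
    then show "y \<in> dot_map D p ` carrier (twisted_Kh D ms)"
      unfolding y diff_dot_map[OF assms] by (rule imageI)
  qed
qed

lemma reduced_Kh_complex:
  assumes "p \<in> edges D" "fst ` set ms \<subseteq> edges D"
  shows "is_complex R (reduced_Kh D p (ms :: ('e \<times> 'r) list))"
  unfolding reduced_Kh_def
  by (rule quotient_complex_is_complex[OF twisted_Kh_complex[OF assms(2)] basepoint_submodule[OF assms]])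

lemma reduced_Kh_move_marking:
  assumes p: "p \<in> edges D" and e: "(e, e') \<in> strands D \<union> (strands D)\<inverse>" and ms: "fst ` set ms \<subseteq> edges D"
  shows "complex_isomorphic R (reduced_Kh D p ((e, w :: 'r) # ms)) (reduced_Kh D p ((e', w) # ms))"
proof -
  obtain c where c: "c \<in> crossings D" and E: "e \<in> edges D" "e' \<in> edges D"
    and h: "\<And>(f :: _ \<Rightarrow> 'r) g. f \<in> supported D \<Longrightarrow>
      edge_map D c True (edge_map D c False f) g + edge_map D c False (edge_map D c True f) g =
      dot_map D e f g + dot_map D e' f g"
    and s: "\<And>f :: _ \<Rightarrow> 'r. f \<in> supported D \<Longrightarrow>
      dot_map D e (edge_map D c False f) = dot_map D e' (edge_map D c False f)"
    using strand_maps[OF D char e] by metis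
  let ?m = "(e, w) # ms" and ?m' = "(e', w) # ms"
  have m: "fst ` set ?m \<subseteq> edges D" "fst ` set ?m' \<subseteq> edges D" using E ms by auto
  note N' = basepoint_submodule[OF p m(2)]
  have zero: "\<zero>\<^bsub>twisted_Kh D ?m'\<^esub> \<in> dot_map D p ` carrier (twisted_Kh D ?m')"
    using submoduleD(2) N'(1) graded_module_module is_complexD(1) twisted_Kh_complex[OF m(2)]
    unfolding graded_submodule_def by blast
  show ?thesis
    unfolding reduced_Kh_def
  proof (rule quotient_complex_iso[OF twisted_Kh_complex[OF m(1)] basepoint_submodule[OF p m(1)]
        twisted_Kh_complex[OF m(2)] N' marking_shift_iso[OF c]])
    \<comment> \<open>The shift commutes with the basepoint dot and is onto, so it carries the image
      of the dot onto itself.\<close>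
    have "marking_shift c w ` dot_map D p ` supported D = dot_map D p ` marking_shift c w ` supported D"
      by (simp add: image_image marking_shift_dot_map[OF c p])
    also have "marking_shift c w ` supported D = supported D"
      using marking_shift_iso[OF c, of w "[]" "[]"]
      by (simp add: graded_isos_def bij_betw_def twisted_Kh_simps)
    finally show "marking_shift c w ` dot_map D p ` carrier (twisted_Kh D ?m) =
        dot_map D p ` carrier (twisted_Kh D ?m')"
      by (simp add: twisted_Kh_simps)
  next
    fix f assume "f \<in> carrier (twisted_Kh D ?m)"
    then have f: "f \<in> supported D" by (simp add: twisted_Kh_simps)
    have "diff (twisted_Kh D ?m') (marking_shift c w f) \<in> supported D"
      unfolding twisted_Kh_simps by (intro supported_add supported_saddle_sum supported_marking_sum)
    moreover have "marking_shift c w (diff (twisted_Kh D ?m) f) = diff (twisted_Kh D ?m') (marking_shift c w f)"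
      by (rule marking_shift_chain[OF c E ms h s f])
    ultimately have "marking_shift c w (diff (twisted_Kh D ?m) f) \<ominus>\<^bsub>twisted_Kh D ?m'\<^esub>
        diff (twisted_Kh D ?m') (marking_shift c w f) = \<zero>\<^bsub>twisted_Kh D ?m'\<^esub>"
      by (simp add: twisted_Kh_minus[OF D char]) (simp add: twisted_Kh_simps)
    then show "marking_shift c w (diff (twisted_Kh D ?m) f) \<ominus>\<^bsub>twisted_Kh D ?m'\<^esub>
        diff (twisted_Kh D ?m') (marking_shift c w f) \<in> dot_map D p ` carrier (twisted_Kh D ?m')"
      using zero by simp
  qed
qed

text \<open>For the identity map, the two differentials differ on \<open>f\<close> by
  \<open>w x_p f = x_p (w f)\<close>, which lies in the submodule divided out.\<close>

lemma reduced_Kh_basepoint_marking: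
  assumes p: "p \<in> edges D" and ms: "fst ` set ms \<subseteq> edges D"
  shows "complex_isomorphic R (reduced_Kh D p ((p, w :: 'r) # ms)) (reduced_Kh D p ms)"
proof -
  let ?m = "(p, w) # ms"
  have m: "fst ` set ?m \<subseteq> edges D" using assms by auto
  show ?thesis
    unfolding reduced_Kh_def
  proof (rule quotient_complex_iso[OF twisted_Kh_complex[OF m] basepoint_submodule[OF p m]
        twisted_Kh_complex[OF ms] basepoint_submodule[OF p ms], of id])
    show "id \<in> graded_isos R (twisted_Kh D ?m) (twisted_Kh D ms)"
      by (auto simp: graded_isos_def linear_maps_def twisted_Kh_simps)
    show "id ` dot_map D p ` carrier (twisted_Kh D ?m) = dot_map D p ` carrier (twisted_Kh D ms)"
      by (simp add: twisted_Kh_simps)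
    fix f assume "f \<in> carrier (twisted_Kh D ?m)"
    then have f: "f \<in> supported D" by (simp add: twisted_Kh_simps)
    have "id (diff (twisted_Kh D ?m) f) \<ominus>\<^bsub>twisted_Kh D ms\<^esub> diff (twisted_Kh D ms) (id f) =
        (\<lambda>g. diff (twisted_Kh D ?m) f g - diff (twisted_Kh D ms) f g)"
      unfolding id_apply by (rule twisted_Kh_minus[OF D char]; unfold twisted_Kh_simps)
        (intro supported_add supported_saddle_sum supported_marking_sum)+
    also have "\<dots> = dot_map D p (\<lambda>g. w * f g)"
      by (simp add: twisted_Kh_simps marking_sum_simps linear_opD[OF linear_op_dot_map])
    finally show "id (diff (twisted_Kh D ?m) f) \<ominus>\<^bsub>twisted_Kh D ms\<^esub> diff (twisted_Kh D ms) (id f)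
        \<in> dot_map D p ` carrier (twisted_Kh D ms)"
      using supported_smult[OF f] by (simp add: twisted_Kh_simps)
  qed
qed

text \<open>The strands through the crossings connect all edges of a knot diagram, so the first
  marking travels to the basepoint and is dropped there while the others stay in place.\<close>

lemma reduced_Kh_remove_markings:
  assumes K: "knot_diagram D" and p: "p \<in> edges D" and ms: "fst ` set ms \<subseteq> edges D"
  shows "complex_isomorphic R (reduced_Kh D p ms) (reduced_Kh D p ([] :: ('e \<times> 'r) list))"
  using ms
proof (induction ms)
  case Nil
  then show ?case by (intro complex_isomorphic_refl reduced_Kh_complex[OF p]) auto
next
  case (Cons m ms)
  obtain e w where m: "m = (e, w)" by fastforce
  have e: "e \<in> edges D" and ms: "fst ` set ms \<subseteq> edges D" using Cons.prems by (auto simp: m)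
  have strands: "strands D \<subseteq> edges D \<times> edges D"
    using edge_at_edges[OF D] by (auto simp: strands_def)
  obtain Y where Y: "gen_classes (edges D) (strands D) = {Y}"
    using K unfolding knot_diagram_def by (meson card_1_singletonE)
  have "Y = edges D"
    using partition_on_gen_classes[OF strands] unfolding Y by (auto simp: partition_on_def)
  then have "same_block (gen_classes (edges D) (strands D)) e p"
    using e p unfolding Y by (simp add: same_block_def)
  then have ep: "(e, p) \<in> gen_equiv (strands D)" by (simp add: same_block_gen_classes[OF strands])
  have "complex_isomorphic R (reduced_Kh D p ((e, w) # ms)) (reduced_Kh D p ((e', w) # ms))"
    if "(e, e') \<in> gen_equiv (strands D)" for e'
    using that
  proof (induction rule: rtrancl_induct)
    case base
    then show ?case using e ms by (intro complex_isomorphic_refl reduced_Kh_complex[OF p]) auto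
  next
    case (step y z)
    then show ?case using reduced_Kh_move_marking[OF p step(2) ms] complex_isomorphic_trans by blast
  qed
  from this[OF ep] show ?case
    unfolding m using reduced_Kh_basepoint_marking[OF p ms] Cons.IH[OF ms] complex_isomorphic_trans by blast
qed

end

theorem corollary3p2:
  fixes D :: "('c, 'e) diagram" and p :: 'e
    and ms ms' :: "('e \<times> 'r::comm_ring_1) list"
  assumes "CHAR('r) = 2"
    and "knot_diagram D"
    and "p \<in> edges D"
    and "fst ` set ms \<subseteq> edges D"
    and "fst ` set ms' \<subseteq> edges D"
  shows "complex_isomorphic ring_of_type_algebra (reduced_Kh D p ms) (reduced_Kh D p ms')
    \<and> graded_isomorphic ring_of_type_algebra (homology (reduced_Kh D p ms)) (homology (reduced_Kh D p ms'))
    \<and> complex_isomorphic ring_of_type_algebra (reduced_Kh D p ms) (reduced_Kh D p [])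
    \<and> graded_isomorphic ring_of_type_algebra (homology (reduced_Kh D p ms)) (homology (reduced_Kh D p []))"
proof -
  have D: "link_diagram D" using assms(2) by (simp add: knot_diagram_def)
  have "of_nat CHAR('r) = (0 :: 'r)" by (rule of_nat_CHAR)
  then have "1 + 1 = (0 :: 'r)" by (simp add: assms(1))
  then have char: "r + r = 0" for r :: 'r by (metis distrib_left mult_1_right mult_zero_right)
  note remove = reduced_Kh_remove_markings[OF D char assms(2,3)]
  \<comment> \<open>Both collections of markings are compared with the empty one.\<close>
  have "complex_isomorphic ring_of_type_algebra (reduced_Kh D p ms) (reduced_Kh D p ms')"
    using complex_isomorphic_trans[OF remove[OF assms(4)] complex_isomorphic_sym[OF remove[OF assms(5)]]] .
  then show ?thesis using remove[OF assms(4)] homology_iso by blast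
qed

end
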